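(* Fix constants $\gamma>1$ and $c_\lambda,c_p,c_\xi>0$ (independent of $n$ and $T$). There is a deterministic algorithm which, given any $n,T\in\mathbb N$, any $\epsilon\in(0,1/10)$ and any instance of the dynamic service recommendation problem (DSR) with $n$ services, horizon $T$ and congestion-sensitivity parameter $\gamma$ satisfying $$\max_{t\in[T]}\lambda_t\ge T^{-c_\lambda},\qquad p_j\ge T^{-c_p},\qquad \xi_j\ge T^{-c_\xi}\qquad (j\in[n]),$$ runs in time $$O\!\left(T\cdot (n+1)^{O(\log^8(T/\epsilon)/\epsilon^3)}\right)$$ and computes a policy whose expected net revenue is at least $(1-\epsilon)\cdot \mathrm{OPT}$. The constants hidden in $O(\cdot)$ may depend only on $\gamma,c_\lambda,c_p,c_\xi$.
   Context: Notation: $[m]=\{1,\dots,m\}$, $(x)^+=\max\{x,0\}$, $\mathbb Z_+=\{0,1,2,\dots\}$. The DSR problem. There are $n$ services and $T$ periods. Each service $j$ has a revenue $r_j\ge 0$, a baseline attractiveness $p_j\in[0,1]$ and a service probability $\xi_j\in(0,1]$; $\lambda_t\in(0,1]$ is the arrival probability in period $t$; $\gamma>1$ is a congestion-sensitivity parameter. $Q_j(t)\in\mathbb Z_+$ is the queue length of service $j$ at the beginning of period $t$, with $Q_j(1)=0$ for all $j$. In each period $t\in[T]$: a customer arrives with probability $\lambda_t$, independently across periods; the platform observes whether a customer arrived and, if so, may recommend one service or make no recommendation; if service $j$ is recommended when $Q_j(t)=q$, the customer joins service $j$ with probability $a_j(q)=p_j\gamma^{-q/\xi_j}$ and otherwise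 leaves. Let $A_{j,t}\in\{0,1\}$ indicate that a customer joins service $j$ in period $t$. Then service occurs and $Q_j(t+1)=(Q_j(t)+A_{j,t}-B_{j,t})^+$, where the $B_{j,t}\sim\mathrm{Bernoulli}(\xi_j)$ are mutually independent, and independent of arrivals. A policy is a (possibly randomized, history-dependent) rule choosing in each period the recommendation from the queue lengths and past arrival and joining outcomes observed so far; $\Pi$ is the set of all policies. The expected net revenue of $\pi$ is $$\mathcal R(\pi)=\mathbb E_\pi\Big[\sum_{t=1}^T\sum_{j=1}^n r_jA_{j,t}-\sum_{j=1}^n r_jQ_j(T+1)\Big],$$ and $\mathrm{OPT}=\sup_{\pi\in\Pi}\mathcal R(\pi)$. Running time counts elementary operations on real numbers (arithmetic, comparisons, powers, logarithms, rounding to integers). *)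

theory Defs
  imports "HOL-Probability.Probability"
begin

section \<open>The dynamic service recommendation problem\<close>

text \<open>Services are numbered \<open>1..n\<close> and periods \<open>1..T\<close>.  The fields \<open>revenue\<close>,
  \<open>attract\<close>, \<open>serv\<close>, \<open>arriv\<close>, \<open>sens\<close> are $r$, $p$, $\xi$, $\lambda$, $\gamma$.\<close>

record dsr =
  services :: nat
  horizon :: nat
  revenue :: "nat \<Rightarrow> real"
  attract :: "nat \<Rightarrow> real"
  serv :: "nat \<Rightarrow> real"
  arriv :: "nat \<Rightarrow> real"
  sens :: real

definition valid_dsr :: "dsr \<Rightarrow> bool" where
  "valid_dsr I \<longleftrightarrow>
     1 \<le> horizon I \<and>
     (\<forall>j\<in>{1..services I}. 0 \<le> revenue I j \<and> 0 \<le> attract I j \<and> attract I j \<le> 1 \<and>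
                          0 < serv I j \<and> serv I j \<le> 1) \<and>
     (\<forall>t\<in>{1..horizon I}. 0 < arriv I t \<and> arriv I t \<le> 1) \<and>
     1 < sens I"

definition join_prob :: "dsr \<Rightarrow> nat \<Rightarrow> nat \<Rightarrow> real" where
  "join_prob I j q = attract I j * sens I powr (- (real q / serv I j))"

type_synonym queues = "nat \<Rightarrow> nat"

text \<open>One entry per past period: the queue lengths at its beginning, whether a customer arrived,
  and which service (if any) the customer joined.\<close>

type_synonym history = "(queues \<times> bool \<times> nat option) list"

text \<open>A deterministic rule maps the past and the current queue lengths to a recommendation.
  It is consulted only in periods with an arrival.\<close>

type_synonym rule = "history \<Rightarrow> queues \<Rightarrow> nat option"

definition period :: "dsr \<Rightarrow> rule \<Rightarrow> nat \<Rightarrow> history \<Rightarrow> queues \<Rightarrow> (history \<times> queues) pmf" where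
  "period I \<rho> t h q =
     do {
       x \<leftarrow> bernoulli_pmf (arriv I t);
       y \<leftarrow> (case (if x then \<rho> h q else None) of
               None \<Rightarrow> return_pmf None
             | Some j \<Rightarrow> map_pmf (\<lambda>a. if a then Some j else None)
                                 (bernoulli_pmf (join_prob I j (q j))));
       B \<leftarrow> Pi_pmf {1..services I} False (\<lambda>j. bernoulli_pmf (serv I j));
       return_pmf (h @ [(q, x, y)], \<lambda>j. q j + of_bool (y = Some j) - of_bool (B j))
     }"

text \<open>Joint law of the history of the first \<open>t\<close> periods and of the queue lengths after them.\<close>

primrec trajectory :: "dsr \<Rightarrow> rule \<Rightarrow> nat \<Rightarrow> (history \<times> queues) pmf" where
  "trajectory I \<rho> 0 = return_pmf ([], \<lambda>_. 0)"
| "trajectory I \<rho> (Suc t) = trajectory I \<rho> t \<bind> (\<lambda>(h, q). period I \<rho> (Suc t) h q)"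

definition realized_revenue :: "dsr \<Rightarrow> history \<times> queues \<Rightarrow> real" where
  "realized_revenue I = (\<lambda>(h, q).
     (\<Sum>(_, _, y)\<leftarrow>h. \<Sum>j=1..services I. revenue I j * of_bool (y = Some j))
     - (\<Sum>j=1..services I. revenue I j * real (q j)))"

definition rule_revenue :: "dsr \<Rightarrow> rule \<Rightarrow> real" where
  "rule_revenue I \<rho> = measure_pmf.expectation (trajectory I \<rho> (horizon I)) (realized_revenue I)"

text \<open>A randomized policy is a measurable family of deterministic rules, indexed by a private seed
  that is drawn once, uniformly from the unit interval and independently of everything else; a
  single such seed provides the randomization of all periods.\<close>

type_synonym policy = "real \<Rightarrow> rule"

definition policies :: "dsr \<Rightarrow> policy set" where
  "policies I = {\<pi>. (\<forall>u h q. \<pi> u h q \<in> insert None (Some ` {1..services I})) \<and>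
                    (\<forall>h q. (\<lambda>u. \<pi> u h q) \<in> borel \<rightarrow>\<^sub>M count_space UNIV)}"

definition net_revenue :: "dsr \<Rightarrow> policy \<Rightarrow> real" where
  "net_revenue I \<pi> = (\<integral>u. rule_revenue I (\<pi> u) \<partial>uniform_measure lborel {0..1})"

definition OPT :: "dsr \<Rightarrow> real" where
  "OPT I = (SUP \<pi>\<in>policies I. net_revenue I \<pi>)"

text \<open>The supremum in \<open>OPT\<close> is over a bounded set of reals.\<close>

lemma trajectory_length: "(h,q) \<in> set_pmf (trajectory I \<rho> t) \<Longrightarrow> length h = t"
  by (induction t arbitrary: h q) (fastforce simp: period_def)+

lemma realized_revenue_le:
  assumes "valid_dsr I"
  shows "realized_revenue I (h,q) \<le> real (length h) * (\<Sum>j=1..services I. revenue I j)"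
proof -
  have 1: "(\<Sum>j=1..services I. revenue I j * real (q j)) \<ge> 0"
    using assms by (auto intro!: sum_nonneg simp: valid_dsr_def)
  have "(\<Sum>j=1..services I. revenue I j * of_bool (y = Some j)) \<le> (\<Sum>j=1..services I. revenue I j)" for y
    using assms by (intro sum_mono) (auto simp: valid_dsr_def of_bool_def)
  then have "(\<Sum>(_, _, y)\<leftarrow>h. \<Sum>j=1..services I. revenue I j * of_bool (y = Some j))
     \<le> real (length h) * (\<Sum>j=1..services I. revenue I j)"
    by (induction h) (auto simp: algebra_simps intro!: add_mono)
  with 1 show ?thesis unfolding realized_revenue_def by simp
qed

lemma net_revenue_bdd_above:
  assumes "valid_dsr I"
  shows "bdd_above (net_revenue I ` policies I)"
proof -
  define K where "K = real (horizon I) * (\<Sum>j=1..services I. revenue I j)"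
  have K0: "K \<ge> 0" using assms by (auto simp: K_def valid_dsr_def intro!: mult_nonneg_nonneg sum_nonneg)
  have a: "rule_revenue I \<rho> \<le> K" for \<rho>
  proof (cases "integrable (trajectory I \<rho> (horizon I)) (realized_revenue I)")
    case True
    have "AE z in trajectory I \<rho> (horizon I). realized_revenue I z \<le> K"
      unfolding AE_measure_pmf_iff
    proof
      fix z assume z: "z \<in> set_pmf (trajectory I \<rho> (horizon I))"
      obtain h q where hq: "z = (h, q)" by fastforce
      from z have "length h = horizon I" unfolding hq by (rule trajectory_length)
      with realized_revenue_le[OF assms, of h q] show "realized_revenue I z \<le> K"
        by (simp add: hq K_def)
    qed
    with True show ?thesis unfolding rule_revenue_def
      by (intro measure_pmf.integral_le_const)
  next
    case False then show ?thesis using K0 by (simp add: rule_revenue_def not_integrable_integral_eq)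
  qed
  interpret prob_space "uniform_measure lborel {0..1::real}"
    by (rule prob_space_uniform_measure) auto
  have "net_revenue I \<pi> \<le> K" for \<pi>
  proof (cases "integrable (uniform_measure lborel {0..1}) (\<lambda>u. rule_revenue I (\<pi> u))")
    case True then show ?thesis unfolding net_revenue_def using a by (intro integral_le_const) auto
  next
    case False then show ?thesis using K0 by (simp add: net_revenue_def not_integrable_integral_eq)
  qed
  then show ?thesis by (auto simp: bdd_above_def)
qed


section \<open>Algorithms over the reals\<close>

text \<open>A real random access machine, presented as a while language.  Its memory consists of arrays
  of real numbers (a fixed program touches finitely many of them), and every elementary operation
  has unit cost.  Literals are rational, so that a program is a finite object that cannot carry
  information in the digits of a constant.  Operations outside their natural domain return the
  default values of HOL (\<open>x / 0 = 0\<close> etc.), and array indices are rounded down.\<close>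

datatype arr = Param | Rev | Attract | Serv | Arriv | Obs | Queue | Rec | Work nat

datatype uop = Floor | Ln
datatype bop = Add | Sub | Mul | Div | Pow

datatype exp = Num rat | Get arr exp | Unop uop exp | Binop bop exp exp

datatype bexp = Less exp exp | Not bexp | And bexp bexp

datatype com = Skip | Assign arr exp exp | Seq com com | If bexp com com | While bexp com

type_synonym memory = "arr \<Rightarrow> nat \<Rightarrow> real"

definition index :: "real \<Rightarrow> nat" where
  "index x = nat \<lfloor>x\<rfloor>"

fun uop_val :: "uop \<Rightarrow> real \<Rightarrow> real" where
  "uop_val Floor x = of_int \<lfloor>x\<rfloor>"
| "uop_val Ln x = ln x"

fun bop_val :: "bop \<Rightarrow> real \<Rightarrow> real \<Rightarrow> real" where
  "bop_val Add x y = x + y"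
| "bop_val Sub x y = x - y"
| "bop_val Mul x y = x * y"
| "bop_val Div x y = x / y"
| "bop_val Pow x y = x powr y"

primrec exp_val :: "exp \<Rightarrow> memory \<Rightarrow> real" where
  "exp_val (Num c) m = of_rat c"
| "exp_val (Get a e) m = m a (index (exp_val e m))"
| "exp_val (Unop f e) m = uop_val f (exp_val e m)"
| "exp_val (Binop f e e') m = bop_val f (exp_val e m) (exp_val e' m)"

primrec exp_cost :: "exp \<Rightarrow> nat" where
  "exp_cost (Num c) = 1"
| "exp_cost (Get a e) = 1 + exp_cost e"
| "exp_cost (Unop f e) = 1 + exp_cost e"
| "exp_cost (Binop f e e') = 1 + exp_cost e + exp_cost e'"

primrec bexp_val :: "bexp \<Rightarrow> memory \<Rightarrow> bool" where
  "bexp_val (Less e e') m \<longleftrightarrow> exp_val e m < exp_val e' m"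
| "bexp_val (Not b) m \<longleftrightarrow> \<not> bexp_val b m"
| "bexp_val (And b b') m \<longleftrightarrow> bexp_val b m \<and> bexp_val b' m"

primrec bexp_cost :: "bexp \<Rightarrow> nat" where
  "bexp_cost (Less e e') = 1 + exp_cost e + exp_cost e'"
| "bexp_cost (Not b) = 1 + bexp_cost b"
| "bexp_cost (And b b') = 1 + bexp_cost b + bexp_cost b'"

text \<open>\<open>exec c m k m'\<close>: started in memory \<open>m\<close>, the program \<open>c\<close> halts after \<open>k\<close> elementary steps
  with memory \<open>m'\<close>.\<close>

inductive exec :: "com \<Rightarrow> memory \<Rightarrow> nat \<Rightarrow> memory \<Rightarrow> bool" where
  Skip: "exec Skip m 1 m"
| Assign: "exec (Assign a i e) m (1 + exp_cost i + exp_cost e)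
             (m(a := (m a)(index (exp_val i m) := exp_val e m)))"
| Seq: "exec c m k m' \<Longrightarrow> exec c' m' k' m'' \<Longrightarrow> exec (Seq c c') m (k + k') m''"
| IfTrue: "bexp_val b m \<Longrightarrow> exec c m k m' \<Longrightarrow> exec (If b c c') m (1 + bexp_cost b + k) m'"
| IfFalse: "\<not> bexp_val b m \<Longrightarrow> exec c' m k m' \<Longrightarrow> exec (If b c c') m (1 + bexp_cost b + k) m'"
| WhileFalse: "\<not> bexp_val b m \<Longrightarrow> exec (While b c) m (1 + bexp_cost b) m"
| WhileTrue: "bexp_val b m \<Longrightarrow> exec c m k m' \<Longrightarrow> exec (While b c) m' k' m'' \<Longrightarrow>
                exec (While b c) m (1 + bexp_cost b + k + k') m''"

lemma exec_deterministic:
  "exec c m k m' \<Longrightarrow> exec c m l m'' \<Longrightarrow> l = k \<and> m'' = m'"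
proof (induction arbitrary: l m'' rule: exec.induct)
  case (Seq c m k m' c' k' m2)
  from Seq.prems show ?case by (cases rule: exec.cases) (use Seq.IH in blast)+
next
  case (WhileTrue b m c k m' k' m2)
  from WhileTrue.prems show ?case
    by (cases rule: exec.cases) (use WhileTrue.IH WhileTrue.hyps in blast)+
qed (erule exec.cases; force)+


section \<open>Computing a policy\<close>

text \<open>An algorithm consists of two programs.  The first is run once, on the instance, the accuracy
  \<open>\<epsilon>\<close> and the list \<open>cs\<close> of fixed constants; what it leaves in memory represents the policy.  The
  second one evaluates this policy: it is run in each period on that memory, is shown what the
  platform observes (and the seed), and writes its recommendation to cell 0 of \<open>Rec\<close>.  The running
  time covers the first program and all the evaluations.  Only the seed is random; the programs
  themselves are deterministic.\<close>

definition instance_memory :: "dsr \<Rightarrow> real \<Rightarrow> real list \<Rightarrow> memory" where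
  "instance_memory I \<epsilon> cs = (\<lambda>a i. case a of
       Param \<Rightarrow> (let ps = [real (services I), real (horizon I), \<epsilon>, sens I] @ cs
                 in if i < length ps then ps ! i else 0)
     | Rev \<Rightarrow> (if i \<in> {1..services I} then revenue I i else 0)
     | Attract \<Rightarrow> (if i \<in> {1..services I} then attract I i else 0)
     | Serv \<Rightarrow> (if i \<in> {1..services I} then serv I i else 0)
     | Arriv \<Rightarrow> (if i \<in> {1..horizon I} then arriv I i else 0)
     | _ \<Rightarrow> 0)"

definition encode :: "nat option \<Rightarrow> real" where
  "encode y = (case y of None \<Rightarrow> 0 | Some j \<Rightarrow> real j)"

text \<open>Array \<open>Obs\<close> holds the period number, the arrival indicator, the joining outcome of the
  preceding period and the seed.\<close>

definition observe :: "dsr \<Rightarrow> real \<Rightarrow> history \<Rightarrow> queues \<Rightarrow> bool \<Rightarrow> memory \<Rightarrow> memory" where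
  "observe I u h q x m = m(
     Obs := (\<lambda>i. if i = 0 then real (Suc (length h))
                 else if i = 1 then of_bool x
                 else if i = 2 then (if h = [] then 0 else encode (snd (snd (last h))))
                 else if i = 3 then u else 0),
     Queue := (\<lambda>i. if i \<in> {1..services I} then real (q i) else 0))"

text \<open>\<open>follows I c \<rho> u m h k m'\<close>: along the history \<open>h\<close>, the evaluation program \<open>c\<close>, started from
  the memory \<open>m\<close>, makes the recommendations of \<open>\<rho>\<close>, in \<open>k\<close> steps altogether.\<close>

inductive follows ::
  "dsr \<Rightarrow> com \<Rightarrow> rule \<Rightarrow> real \<Rightarrow> memory \<Rightarrow> history \<Rightarrow> nat \<Rightarrow> memory \<Rightarrow> bool"
  for I c \<rho> u m where
  Nil: "follows I c \<rho> u m [] 0 m"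
| snoc: "follows I c \<rho> u m h k m' \<Longrightarrow> exec c (observe I u h q x m') k' m'' \<Longrightarrow>
           (x \<Longrightarrow> m'' Rec 0 = encode (\<rho> h q)) \<Longrightarrow>
           follows I c \<rho> u m (h @ [(q, x, y)]) (k + k') m''"

text \<open>The time bound and the recommendations are required for every seed and for every history
  that occurs with positive probability.\<close>

definition computes_within ::
  "com \<Rightarrow> com \<Rightarrow> dsr \<Rightarrow> real \<Rightarrow> real list \<Rightarrow> policy \<Rightarrow> real \<Rightarrow> bool" where
  "computes_within prep evalc I \<epsilon> cs \<pi> \<tau> \<longleftrightarrow>
     (\<exists>k m. exec prep (instance_memory I \<epsilon> cs) k m \<and>
        (\<forall>u\<in>{0..1}. \<forall>(h, q)\<in>set_pmf (trajectory I (\<pi> u) (horizon I)).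
           \<exists>k' m'. follows I evalc (\<pi> u) u m h k' m' \<and> real (k + k') \<le> \<tau>))"

end

theory Submission
  imports Defs
begin

text \<open>
  Let \<open>V\<close> be the optimal value function on queue vectors.  Adding a customer to queue \<open>j\<close> changes \<open>V\<close>
  by an amount between $-r_j$ and \<open>0\<close>, and her marginal value is at most the one she would have if
  nobody joined any more.  Hence \<open>V\<close> is robust: lowering joining probabilities and service
  probabilities by a factor $1 - O(\epsilon)$, and dropping tiny revenues and joining probabilities,
  costs only a factor $1 - O(\epsilon)$ in total, and the optimal policy of an instance with smaller
  parameters, applied to the actual queues of the original one, earns at least the value of the
  smaller instance.  So revenues, attractiveness and service probabilities may be rounded down to
  powers of a number close to \<open>1\<close>, and recommendations stop at logarithmic queue lengths.
  Afterwards there are only polylogarithmically many kinds of services and of queue lengths; a state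
  is described by the number of services of each kind and length, and dynamic programming over these
  counts is fast enough.
\<close>

section \<open>Service of the queues\<close>

text \<open>Two obstacles shape the details. All services complete simultaneously, so one transition
  has exponentially many outcomes. The dynamic program therefore completes them one at a time, on
  pairs of count vectors: one for the services still to be treated, one for the others. With
  \<open>N = (n + 1) ^ D\<close> this means \<open>N * N\<close> entries per period, each found by a
  scan of \<open>D\<close> cells, hence time of order \<open>T * N ^ 3\<close>. Secondly, waiting
  customers carry a final penalty, so values may be negative and a bound by a factor
  \<open>1 - e\<close> is no induction hypothesis. For joining probabilities the induction uses the
  convex combination of the optimal value with the value of idling; for revenues and service
  probabilities it uses the value plus the worth of the waiting customers. Both corrections vanish
  at empty queues. The loss \<epsilon> is spent as five shares \<epsilon>/5, and everything below
  the relative size \<open>exp (- depth)\<close> is negligible. Each of the three rounded parameters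
  has O(log^2 / \<epsilon>) levels and there are O(log) queue lengths, so \<open>D\<close> is
  O(log^7 / \<epsilon>^3).\<close>

definition inc :: "queues \<Rightarrow> nat \<Rightarrow> queues" where
  "inc q j = q(j := Suc (q j))"

definition dec :: "queues \<Rightarrow> nat \<Rightarrow> queues" where
  "dec q j = q(j := q j - 1)"

lemma inc_apply: "inc q j i = (if i = j then Suc (q j) else q i)"
  by (simp add: inc_def)

lemma dec_apply: "dec q j i = (if i = j then q j - 1 else q i)"
  by (simp add: dec_def)

lemma dec_zero: "q j = 0 \<Longrightarrow> dec q j = q"
  by (auto simp: dec_def)

lemma dec_inc [simp]: "dec (inc q j) j = q"
  by (auto simp: dec_def inc_def)

lemma inc_dec: "q j \<noteq> 0 \<Longrightarrow> inc (dec q j) j = q"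
  by (auto simp: dec_def inc_def)

lemma dec_inc_commute: "i \<noteq> j \<Longrightarrow> dec (inc q j) i = inc (dec q i) j"
  by (auto simp: dec_def inc_def)

lemma inc_commute: "inc (inc q i) j = inc (inc q j) i"
  by (auto simp: inc_def)

lemma sum_dec:
  fixes s :: "nat \<Rightarrow> real"
  assumes i: "i \<in> {1..n}" and "q i \<noteq> 0"
  shows "(\<Sum>j=1..n. s j * real (dec q i j)) = (\<Sum>j=1..n. s j * real (q j)) - s i"
proof -
  have "(\<Sum>j\<in>{1..n}-{i}. s j * real (dec q i j)) = (\<Sum>j\<in>{1..n}-{i}. s j * real (q j))"
    by (rule sum.cong) (auto simp: dec_def)
  moreover have "s i * real (dec q i i) = s i * real (q i) - s i"
    using assms(2) by (simp add: dec_def algebra_simps of_nat_diff)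
  ultimately show ?thesis
    using i by (simp only: sum.remove[of "{1..n}" i] finite_atLeastAtMost)
qed

lemma sum_inc:
  fixes s :: "nat \<Rightarrow> real"
  assumes "i \<in> {1..n}"
  shows "(\<Sum>j=1..n. s j * real (inc q i j)) = (\<Sum>j=1..n. s j * real (q j)) + s i"
  using sum_dec[OF assms, of "inc q i" s] by (simp add: inc_apply)

lemma expectation_bind_finite:
  fixes h :: "'b \<Rightarrow> real"
  assumes "finite (set_pmf p)" "\<And>x. x \<in> set_pmf p \<Longrightarrow> finite (set_pmf (f x))"
  shows "measure_pmf.expectation (p \<bind> f) h =
         measure_pmf.expectation p (\<lambda>x. measure_pmf.expectation (f x) h)"
  by (subst pmf_expectation_bind[OF assms(1)]) (auto simp: assms integral_measure_pmf[OF assms(1)])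

lemma finite_set_Pi_bernoulli:
  "finite A \<Longrightarrow> finite (set_pmf (Pi_pmf A False (\<lambda>j. bernoulli_pmf (x j))))"
  by (rule finite_subset[OF set_Pi_pmf_subset'])
     (auto intro!: finite_PiE_dflt)

text \<open>Averages over the completions of the services in \<open>A\<close> only, so that facts
  can be proved by adding one service at a time; truncated subtraction leaves empty queues empty.
  The tables of the algorithm use proper subsets \<open>A\<close> for the same reason.\<close>

definition served :: "(nat \<Rightarrow> real) \<Rightarrow> nat set \<Rightarrow> (queues \<Rightarrow> real) \<Rightarrow> queues \<Rightarrow> real" where
  "served x A F q = measure_pmf.expectation (Pi_pmf A False (\<lambda>j. bernoulli_pmf (x j)))
                      (\<lambda>B. F (\<lambda>j. q j - of_bool (B j)))"

lemma served_empty [simp]: "served x {} F q = F q"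
  by (simp add: served_def)

lemma served_insert:
  assumes "finite A" "j \<notin> A" "0 \<le> x j" "x j \<le> 1"
  shows "served x (insert j A) F q = x j * served x A F (dec q j) + (1 - x j) * served x A F q"
proof -
  let ?P = "Pi_pmf A False (\<lambda>j. bernoulli_pmf (x j))"
  have fin: "finite (set_pmf ?P)" using assms(1) by (rule finite_set_Pi_bernoulli)
  have B: "B j = False" if "B \<in> set_pmf ?P" for B
    using set_Pi_pmf_subset[OF assms(1), of False "\<lambda>j. bernoulli_pmf (x j)"] that assms(2) by blast
  have "(\<lambda>i. q i - of_bool ((B(j := b)) i)) = (\<lambda>i. ((if b then dec q j else q) i) - of_bool (B i))"
    if "B \<in> set_pmf ?P" for B b
    using B[OF that] by (auto simp: fun_eq_iff dec_apply)
  then have *: "measure_pmf.expectation ?P (\<lambda>B. F (\<lambda>i. q i - of_bool ((B(j := b)) i)))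
      = served x A F (if b then dec q j else q)" for b
    unfolding served_def by (intro integral_cong_AE) (auto simp: AE_measure_pmf_iff)
  show ?thesis
    unfolding served_def[of x "insert j A"] Pi_pmf_insert'[OF assms(1,2)]
    by (subst expectation_bind_finite, (simp_all add: fin)[2],
        subst expectation_bind_finite, (simp_all add: fin)[2])
       (use * [of True] * [of False] assms in \<open>simp add: algebra_simps\<close>)
qed

lemma served_cong_zero:
  assumes "finite A" "j \<notin> A" "0 \<le> x j" "x j \<le> 1" "q j = 0"
  shows "served x (insert j A) F q = served x A F q"
proof -
  have "dec q j = q" using assms(5) by (rule dec_zero)
  then show ?thesis by (simp add: served_insert[where x=x, OF assms(1-4)] algebra_simps)
qed

lemma convex_mono:
  fixes x a b c d :: real
  assumes "0 \<le> x" "x \<le> 1" "a \<le> c" "b \<le> d"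
  shows "x * a + (1 - x) * b \<le> x * c + (1 - x) * d"
  using assms by (intro add_mono mult_left_mono) auto

text \<open>Both queue vectors use the same coins, so the extra customer persists until she is
  served. If she is alone in queue \<open>j\<close> and the coin of \<open>j\<close> succeeds, the
  two vectors coincide, and \<open>0 \<le> c\<close> settles the case.\<close>

lemma served_lower_slope:
  assumes "finite A" "\<forall>i\<in>A. 0 \<le> x i \<and> x i \<le> 1"
    and "\<And>q. F q \<le> F (inc q j) + (c::real)" "0 \<le> c"
  shows "served x A F q \<le> served x A F (inc q j) + c"
  using assms(1,2)
proof (induction A arbitrary: q rule: finite_induct)
  case empty then show ?case by (simp only: served_empty assms(3) empty_iff if_False)
next
  case (insert i A)
  then have xi: "0 \<le> x i" "x i \<le> 1" and IH: "\<And>q. served x A F q \<le> served x A F (inc q j) + c" by auto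
  have 1: "served x A F (dec q i) \<le> served x A F (dec (inc q j) i) + c"
  proof (cases "i = j")
    case True
    show ?thesis
    proof (cases "q j")
      case 0
      then have "dec q j = q" by (rule dec_zero)
      then show ?thesis using True assms(4) by simp
    next
      case (Suc m)
      then have "inc (dec q j) j = q" by (simp add: inc_dec)
      then show ?thesis using IH[of "dec q j"] True by simp
    qed
  next
    case False
    then have "inc (dec q i) j = dec (inc q j) i" by (simp add: dec_inc_commute)
    then show ?thesis using IH[of "dec q i"] by simp
  qed
  from convex_mono[OF xi 1 IH[of q]]
  show ?case using insert.hyps xi by (simp add: served_insert algebra_simps)
qed

text \<open>The slope of \<open>F\<close> in queue \<open>j\<close> is compared with that of a
  function \<open>\<phi>\<close> of this queue alone. The coins of other services leave the bound as
  it is; the coin of \<open>j\<close> replaces \<open>\<phi>\<close> by its average over one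
  completion. With \<open>\<phi> = idle k j\<close> this is the passage to
  \<open>idle (Suc k) j\<close>.\<close>

lemma served_upper_slope:
  assumes "finite A" "\<forall>i\<in>A. 0 \<le> x i \<and> x i \<le> 1"
    and "\<And>q. F (inc q j) - F q \<le> \<phi> (Suc (q j)) - (\<phi> (q j) :: real)"
  shows "served x A F (inc q j) - served x A F q \<le>
    (if j \<in> A then (x j * \<phi> (q j) + (1 - x j) * \<phi> (Suc (q j))) - (x j * \<phi> (q j - 1) + (1 - x j) * \<phi> (q j))
     else \<phi> (Suc (q j)) - \<phi> (q j))"
  using assms(1,2)
proof (induction A arbitrary: q rule: finite_induct)
  case empty then show ?case by (simp only: served_empty assms(3) empty_iff if_False)
next
  case (insert i A)
  then have xi: "0 \<le> x i" "x i \<le> 1" by auto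
  have e: "served x (insert i A) F (inc q j) - served x (insert i A) F q =
     x i * (served x A F (dec (inc q j) i) - served x A F (dec q i)) +
     (1 - x i) * (served x A F (inc q j) - served x A F q)"
    using insert.hyps xi by (simp add: served_insert algebra_simps)
  show ?case
  proof (cases "i = j")
    case True
    then have jA: "j \<notin> A" using insert.hyps by auto
    have IH: "\<And>q. served x A F (inc q j) - served x A F q \<le> \<phi> (Suc (q j)) - \<phi> (q j)"
      using insert.IH insert.prems jA by auto
    have "served x A F (dec (inc q j) i) - served x A F (dec q i) \<le> \<phi> (q j) - \<phi> (q j - 1)"
    proof (cases "q j")
      case 0
      then have "dec q j = q" by (rule dec_zero)
      then show ?thesis using True 0 by simp
    next
      case (Suc m)
      then have "inc (dec q j) j = q" by (simp add: inc_dec)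
      then show ?thesis using IH[of "dec q j"] True Suc by (simp add: dec_apply)
    qed
    from convex_mono[OF xi this IH[of q]] show ?thesis
      unfolding e using True by (simp add: algebra_simps)
  next
    case False
    let ?c = "(if j \<in> A then (x j * \<phi> (q j) + (1 - x j) * \<phi> (Suc (q j))) - (x j * \<phi> (q j - 1) + (1 - x j) * \<phi> (q j))
     else \<phi> (Suc (q j)) - \<phi> (q j))"
    have IH: "\<And>q. served x A F (inc q j) - served x A F q \<le>
      (if j \<in> A then (x j * \<phi> (q j) + (1 - x j) * \<phi> (Suc (q j))) - (x j * \<phi> (q j - 1) + (1 - x j) * \<phi> (q j))
     else \<phi> (Suc (q j)) - \<phi> (q j))"
      using insert.IH insert.prems by auto
    from False have "inc (dec q i) j = dec (inc q j) i" by (simp add: dec_inc_commute)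
    then have "served x A F (dec (inc q j) i) - served x A F (dec q i) \<le> ?c"
      using IH[of "dec q i"] False by (auto simp: dec_apply)
    from convex_mono[OF xi this IH[of q]] show ?thesis
      unfolding e using False by (simp add: algebra_simps)
  qed
qed

lemma real_le_chain:
  "m' \<le> m \<Longrightarrow> L - a + b \<le> w - m \<Longrightarrow> z + b \<ge> a \<Longrightarrow> L \<le> w - m' + (z :: real)"
  by linarith

text \<open>The comparison is made for \<open>F + P\<close>, that is, with the revenue credited at the time of service.\<close>

lemma served_compare:
  fixes r r' x x' :: "nat \<Rightarrow> real" and n :: nat
  defines "P \<equiv> \<lambda>q::queues. \<Sum>j=1..n. r j * real (q j)"
    and "P' \<equiv> \<lambda>q::queues. \<Sum>j=1..n. r' j * real (q j)"
    and "N \<equiv> \<lambda>q::queues. \<Sum>j=1..n. real (q j)"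
  assumes A: "A \<subseteq> {1..n}"
    and x: "\<And>j. j \<in> {1..n} \<Longrightarrow> 0 \<le> x' j \<and> x' j \<le> x j \<and> x j \<le> 1"
    and xr: "\<And>j. j \<in> {1..n} \<Longrightarrow> x' j * r' j + c * x j \<ge> (1 - e) * (x j * r j)"
    and r': "\<And>j. j \<in> {1..n} \<Longrightarrow> 0 \<le> r' j"
    and mono: "\<And>q j. j \<in> {1..n} \<Longrightarrow> F' q \<le> F' (inc q j) + r' j"
    and le: "\<And>q. F' q + P' q \<ge> (1 - e) * (F q + P q) - c * (k + N q)"
  shows "served x' A F' q + P' q \<ge> (1 - e) * (served x A F q + P q) - c * (k + N q)"
proof -
  have "finite A" by (rule finite_subset[OF A]) simp
  then show ?thesis using A
  proof (induction A arbitrary: q rule: finite_induct)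
    case empty show ?case by (simp only: served_empty le)
  next
    case (insert i A)
    from insert.prems have i: "i \<in> {1..n}" and A: "A \<subseteq> {1..n}" by auto
    note xi = x[OF i]
    show ?case
    proof (cases "q i = 0")
      case True
      have "served x (insert i A) F q = served x A F q" "served x' (insert i A) F' q = served x' A F' q"
        using xi by (auto intro!: served_cong_zero insert.hyps True)
      then show ?thesis using insert.IH[OF A, of q] by (simp only:)
    next
      case False
      define d where "d = dec q i"
      have P: "P d = P q - r i" "P' d = P' q - r' i" "N d = N q - 1"
        unfolding P_def P'_def N_def d_def
        by (simp_all only: sum_dec[where q=q, OF i False] sum_dec[where q=q and s="\<lambda>_. 1", OF i False, unfolded mult_1])
      have d: "inc d i = q" using False by (simp add: d_def inc_dec)
      have x01: "\<forall>i\<in>A. 0 \<le> x' i \<and> x' i \<le> 1"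
        using A x by (meson order_trans subsetD)
      define s s' u u' where "s = served x A F d" and "s' = served x' A F' d"
        and "u = served x A F q" and "u' = served x' A F' q"
      have "served x' A F' d \<le> served x' A F' (inc d i) + r' i"
        by (rule served_lower_slope[where F=F', OF insert.hyps(1) x01 mono[OF i] r'[OF i]])
      then have "s' \<le> u' + r' i" by (simp only: d s'_def u'_def)
      \<comment> \<open>By the slope bound, \<open>u' + r' i - s'\<close> is nonnegative, so it may
        be charged at the larger rate \<open>x i\<close>. At that rate the induction hypothesis
        applies to both outcomes. The shortfall of \<open>x' i * r' i\<close> against
        \<open>(1 - e) * (x i * r i)\<close> is covered by \<open>c * x i\<close>, released because
        a completion lowers \<open>N\<close> by one.\<close>
      then have 1: "x' i * (u' + r' i - s') \<le> x i * (u' + r' i - s')"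
        using xi by (intro mult_right_mono) simp_all
      have 2: "x i * ((1 - e) * (s + P d) - c * (k + N d)) + (1 - x i) * ((1 - e) * (u + P q) - c * (k + N q))
         \<le> x i * (s' + P' d) + (1 - x i) * (u' + P' q)"
        unfolding s_def s'_def u_def u'_def
        by (rule convex_mono[OF _ _ insert.IH[OF A] insert.IH[OF A]]) (use xi in auto)
      have 3: "served x (insert i A) F q = x i * s + (1 - x i) * u"
              "served x' (insert i A) F' q = x' i * s' + (1 - x' i) * u'"
        unfolding s_def s'_def u_def u'_def d_def
        by (rule served_insert; use xi insert.hyps in simp)+
      have 4: "x i * ((1 - e) * (s + P d) - c * (k + N d)) + (1 - x i) * ((1 - e) * (u + P q) - c * (k + N q))
         = ((1 - e) * (x i * s + (1 - x i) * u + P q) - c * (k + N q)) - (1 - e) * (x i * r i) + c * x i"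
        unfolding P by (simp add: algebra_simps)
      have 5: "x i * (s' + P' d) + (1 - x i) * (u' + P' q) = u' + P' q - x i * (u' + r' i - s')"
        unfolding P by (simp add: algebra_simps)
      have 6: "x' i * s' + (1 - x' i) * u' + P' q = u' + P' q - x' i * (u' + r' i - s') + x' i * r' i"
        by (simp add: algebra_simps)
      show ?thesis
        unfolding 3 6 by (rule real_le_chain[OF 1 2[unfolded 4 5] xr[OF i]])
    qed
  qed
qed

lemma served_mono_add:
  assumes "finite A" "\<forall>i\<in>A. 0 \<le> x i \<and> x i \<le> 1" "\<And>q. F q + c \<le> (G q :: real)"
  shows "served x A F q + c \<le> served x A G q"
  using assms(1,2)
proof (induction A arbitrary: q rule: finite_induct)
  case empty then show ?case by (simp only: served_empty assms(3) empty_iff if_False)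
next
  case (insert i A)
  then have xi: "0 \<le> x i" "x i \<le> 1" and IH: "\<And>q. served x A F q + c \<le> served x A G q" by auto
  from convex_mono[OF xi IH[of "dec q i"] IH[of q]]
  show ?case using insert.hyps xi by (simp add: served_insert algebra_simps)
qed

lemma served_linear:
  assumes "finite A" "\<forall>i\<in>A. 0 \<le> x i \<and> x i \<le> 1"
  shows "served x A (\<lambda>q. a * F q + b * G q) q = a * served x A F q + b * served x A G q"
  using assms
proof (induction A arbitrary: q rule: finite_induct)
  case (insert i A)
  then show ?case by (simp add: served_insert algebra_simps)
qed simp

text \<open>Linearity of expectation: each summand sees only the coin of its own queue.\<close>

lemma served_separable:
  assumes "A \<subseteq> {1..n}" "\<forall>i\<in>A. 0 \<le> x i \<and> x i \<le> 1"
  shows "served x A (\<lambda>q. \<Sum>j=1..n. \<phi> j (q j)) q =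
     (\<Sum>j=1..n. if j \<in> A then x j * \<phi> j (q j - 1) + (1 - x j) * \<phi> j (q j) else (\<phi> j (q j) :: real))"
proof -
  have "finite A" by (rule finite_subset[OF assms(1)]) simp
  then show ?thesis using assms
  proof (induction A arbitrary: q rule: finite_induct)
    case (insert i A)
    let ?f = "\<lambda>A q j. if j \<in> A then x j * \<phi> j (q j - 1) + (1 - x j) * \<phi> j (q j) else \<phi> j (q j)"
    have i: "i \<in> {1..n}" and xi: "0 \<le> x i" "x i \<le> 1" using insert.prems by auto
    have IH: "served x A (\<lambda>q. \<Sum>j=1..n. \<phi> j (q j)) q = (\<Sum>j=1..n. ?f A q j)" for q
      using insert.prems by (intro insert.IH) auto
    have s: "(\<Sum>j\<in>{1..n} - {i}. ?f A (dec q i) j) = (\<Sum>j\<in>{1..n} - {i}. ?f (insert i A) q j)"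
            "(\<Sum>j\<in>{1..n} - {i}. ?f A q j) = (\<Sum>j\<in>{1..n} - {i}. ?f (insert i A) q j)"
      by (rule sum.cong[OF refl]; auto simp: dec_apply)+
    have r: "(\<Sum>j=1..n. ?f A' q' j) = ?f A' q' i + (\<Sum>j\<in>{1..n} - {i}. ?f A' q' j)" for A' q'
      by (rule sum.remove[OF _ i]) simp
    have "served x (insert i A) (\<lambda>q. \<Sum>j=1..n. \<phi> j (q j)) q =
       x i * (\<Sum>j=1..n. ?f A (dec q i) j) + (1 - x i) * (\<Sum>j=1..n. ?f A q j)"
      by (subst served_insert[where x=x, OF insert.hyps xi]) (simp only: IH)
    also have "\<dots> = (\<Sum>j=1..n. ?f (insert i A) q j)"
    proof -
      define S where "S = (\<Sum>j\<in>{1..n} - {i}. ?f (insert i A) q j)"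
      have "(\<Sum>j=1..n. ?f A (dec q i) j) = \<phi> i (q i - 1) + S" "(\<Sum>j=1..n. ?f A q j) = \<phi> i (q i) + S"
        "(\<Sum>j=1..n. ?f (insert i A) q j) = x i * \<phi> i (q i - 1) + (1 - x i) * \<phi> i (q i) + S"
        unfolding r S_def s using insert.hyps(2) by (simp_all only: dec_apply refl if_True if_False insertI1)
      then show ?thesis by (simp only:) (simp add: algebra_simps)
    qed
    finally show ?case .
  qed simp
qed

section \<open>Optimal values\<close>

text \<open>The entry \<open>0\<close> stands for making no recommendation.\<close>

definition topgain :: "(nat \<Rightarrow> real) \<Rightarrow> nat \<Rightarrow> real" where
  "topgain g n = Max (insert 0 (g ` {1..n}))"

lemma topgain_nonneg: "0 \<le> topgain g n"
  unfolding topgain_def by (rule Max_ge) auto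

lemma topgain_ge: "j \<in> {1..n} \<Longrightarrow> g j \<le> topgain g n"
  unfolding topgain_def by (rule Max_ge) auto

lemma topgain_cases: "topgain g n = 0 \<or> (\<exists>j\<in>{1..n}. topgain g n = g j)"
proof -
  have "topgain g n \<in> insert 0 (g ` {1..n})"
    unfolding topgain_def by (rule Max_in) auto
  then show ?thesis by auto
qed

text \<open>\<open>val k q\<close> is the optimal expected revenue of the last \<open>k\<close> periods, minus the final
  penalty, from queues \<open>q\<close>; \<open>l k\<close> is the arrival probability \<open>k\<close> periods before the last one.\<close>

locale dsr_dp =
  fixes n :: nat and r :: "nat \<Rightarrow> real" and a :: "nat \<Rightarrow> nat \<Rightarrow> real" and x l :: "nat \<Rightarrow> real"
  assumes r_nonneg: "j \<in> {1..n} \<Longrightarrow> 0 \<le> r j"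
    and a_bounds: "j \<in> {1..n} \<Longrightarrow> 0 \<le> a j m \<and> a j m \<le> 1"
    and a_antimono: "j \<in> {1..n} \<Longrightarrow> a j (Suc m) \<le> a j m"
    and x_bounds: "j \<in> {1..n} \<Longrightarrow> 0 \<le> x j \<and> x j \<le> 1"
    and l_bounds: "0 \<le> l k \<and> l k \<le> 1"
begin

definition worth :: "queues \<Rightarrow> real" where
  "worth q = (\<Sum>j=1..n. r j * real (q j))"

definition gain :: "(queues \<Rightarrow> real) \<Rightarrow> queues \<Rightarrow> nat \<Rightarrow> real" where
  "gain W q j = a j (q j) * (r j + W (inc q j) - W q)"

primrec val :: "nat \<Rightarrow> queues \<Rightarrow> real" where
  "val 0 = (\<lambda>q. - worth q)"
| "val (Suc k) = (\<lambda>q. served x {1..n} (val k) q + l k * topgain (gain (served x {1..n} (val k)) q) n)"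

text \<open>Expected value between the joining decision of a period and its completions, with
  \<open>k\<close> periods to follow. Gains are differences of this function, since a new customer
  may be served in the period in which she joins.\<close>

definition post :: "nat \<Rightarrow> queues \<Rightarrow> real" where
  "post k = served x {1..n} (val k)"

lemma val_Suc: "val (Suc k) q = post k q + l k * topgain (gain (post k) q) n"
  by (simp add: post_def)

declare val.simps(2) [simp del]

lemma l01: "0 \<le> l k" "l k \<le> 1" using l_bounds by auto

lemma x01: "\<forall>i\<in>{1..n}. 0 \<le> x i \<and> x i \<le> 1" using x_bounds by blast

lemma worth_inc: "j \<in> {1..n} \<Longrightarrow> worth (inc q j) = worth q + r j"
  unfolding worth_def by (rule sum_inc)

lemma val_Suc_ge_post: "post k q \<le> val (Suc k) q"
  using topgain_nonneg l01 by (simp add: val_Suc)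

lemma val_Suc_ge:
  assumes "j \<in> {1..n}"
  shows "post k q + l k * gain (post k) q j \<le> val (Suc k) q"
  using topgain_ge[OF assms] l01 by (simp add: val_Suc mult_left_mono)

lemma val_Suc_cases:
  obtains "val (Suc k) q = post k q"
    | j where "j \<in> {1..n}" "val (Suc k) q = post k q + l k * gain (post k) q j"
  using topgain_cases[of "gain (post k) q" n] by (auto simp: val_Suc)

lemma val_Suc_le:
  assumes "post k q \<le> c" "\<And>j. j \<in> {1..n} \<Longrightarrow> post k q + l k * gain (post k) q j \<le> c"
  shows "val (Suc k) q \<le> c"
  by (rule val_Suc_cases[of k q]) (use assms in auto)

lemma join_prob01: "j \<in> {1..n} \<Longrightarrow> 0 \<le> l k * a j m \<and> l k * a j m \<le> 1"
  using a_bounds[of j m] l01[of k] by (simp add: mult_le_one)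

section \<open>Slopes of the value function in a single queue length\<close>

lemma join_value:
  "post k q + l k * gain (post k) q j =
   (l k * a j (q j)) * (r j + post k (inc q j)) + (1 - l k * a j (q j)) * post k q"
  by (simp add: gain_def algebra_simps)

text \<open>From \<open>inc q j\<close>, imitate the recommendation that is optimal at
  \<open>q\<close>, except that nothing is recommended where it would be \<open>j\<close>: the extra
  customer already plays the role of the one who might join, and \<open>r j\<close> pays for
  her.\<close>

lemma val_lower_slope:
  assumes j: "j \<in> {1..n}"
  shows "val k q \<le> val k (inc q j) + r j"
proof (induction k arbitrary: q)
  case 0
  show ?case using worth_inc[OF j] by simp
next
  case (Suc k)
  have W: "post k q \<le> post k (inc q j) + r j" for q
    unfolding post_def by (rule served_lower_slope) (use x01 Suc.IH r_nonneg[OF j] in auto)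
  show ?case
  proof (rule val_Suc_le)
    show "post k q \<le> val (Suc k) (inc q j) + r j"
      using W[of q] val_Suc_ge_post[of k "inc q j"] by simp
  next
    fix i assume i: "i \<in> {1..n}"
    note c = join_prob01[OF i, of k "q i"]
    show "post k q + l k * gain (post k) q i \<le> val (Suc k) (inc q j) + r j"
    proof (cases "i = j")
      case True
      have "post k q + l k * gain (post k) q i \<le>
          (l k * a i (q i)) * (r j + post k (inc q j)) + (1 - l k * a i (q i)) * (r j + post k (inc q j))"
        unfolding join_value using c True W[of q] by (intro convex_mono) auto
      also have "\<dots> = r j + post k (inc q j)" by (simp add: algebra_simps)
      finally show ?thesis using val_Suc_ge_post[of k "inc q j"] by simp
    next
      case False
      have "post k q + l k * gain (post k) q i \<le>
          (l k * a i (q i)) * (r i + post k (inc (inc q i) j) + r j) + (1 - l k * a i (q i)) * (post k (inc q j) + r j)"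
        unfolding join_value using c W[of q] W[of "inc q i"] by (intro convex_mono) auto
      also have "\<dots> = post k (inc q j) + l k * gain (post k) (inc q j) i + r j"
        unfolding join_value inc_commute[of q i j] using False by (simp add: inc_apply algebra_simps)
      finally show ?thesis using val_Suc_ge[OF i, of k "inc q j"] by simp
    qed
  qed
qed

lemma post_lower_slope: "j \<in> {1..n} \<Longrightarrow> post k q \<le> post k (inc q j) + r j"
  unfolding post_def
  by (rule served_lower_slope) (use x01 val_lower_slope r_nonneg in auto)

text \<open>\<open>idle k j m\<close> is the value of \<open>m\<close> customers in queue \<open>j\<close> if nobody joins any more.  The
  marginal value of a customer never exceeds the one without further joining: she can only displace
  later customers.\<close>

primrec idle :: "nat \<Rightarrow> nat \<Rightarrow> nat \<Rightarrow> real" where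
  "idle 0 j m = - r j * real m"
| "idle (Suc k) j m = x j * idle k j (m - 1) + (1 - x j) * idle k j m"

lemma idle_slope_nonpos: "j \<in> {1..n} \<Longrightarrow> idle k j (Suc m) \<le> idle k j m"
proof (induction k arbitrary: m)
  case 0 then show ?case using r_nonneg[of j] by (simp add: algebra_simps)
next
  case (Suc k)
  have "idle k j m \<le> idle k j (m - 1)" using Suc.IH[OF Suc.prems, of "m - 1"] by (cases m) auto
  then show ?case
    using x_bounds[OF Suc.prems] Suc.IH[OF Suc.prems] by (simp only: idle.simps diff_Suc_1, intro convex_mono) auto
qed

text \<open>The slope of \<open>idle k j\<close> at \<open>m\<close> is \<open>- r j\<close> times
  the probability that the customer in position \<open>m + 1\<close> is still waiting after
  \<open>k\<close> periods, which grows with the position.\<close>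

lemma idle_concave:
  "j \<in> {1..n} \<Longrightarrow> idle k j (Suc (Suc m)) - idle k j (Suc m) \<le> idle k j (Suc m) - idle k j m"
proof (induction k arbitrary: m)
  case 0 then show ?case by (simp add: algebra_simps)
next
  case (Suc k)
  note x = x_bounds[OF Suc.prems]
  have 1: "idle k j (Suc m) - idle k j m \<le> idle k j m - idle k j (m - 1)"
    using Suc.IH[OF Suc.prems, of "m - 1"] idle_slope_nonpos[OF Suc.prems, of k m] by (cases m) auto
  have "x j * (idle k j (Suc m) - idle k j m) + (1 - x j) * (idle k j (Suc (Suc m)) - idle k j (Suc m))
    \<le> x j * (idle k j m - idle k j (m - 1)) + (1 - x j) * (idle k j (Suc m) - idle k j m)"
    by (rule convex_mono[OF _ _ 1 Suc.IH[OF Suc.prems]]) (use x in auto)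
  then show ?case by (simp add: algebra_simps)
qed

lemma post_upper_slope_step:
  assumes j: "j \<in> {1..n}" and IH: "\<And>q. val k (inc q j) - val k q \<le> idle k j (Suc (q j)) - idle k j (q j)"
  shows "post k (inc q j) - post k q \<le> idle (Suc k) j (Suc (q j)) - idle (Suc k) j (q j)"
  using served_upper_slope[where F="val k" and \<phi>="idle k j", OF _ x01 IH, of q] j
  by (simp add: post_def)

text \<open>From \<open>q\<close>, make the recommendation that is optimal at \<open>inc q j\<close>
  and compare outcome by outcome. Only \<open>i = j\<close> is delicate: concavity of
  \<open>idle\<close> bounds the slope at the longer queue, and the larger joining probability at
  \<open>q\<close> helps because the reward of a join is nonnegative by the lower slope
  bound.\<close>

lemma val_upper_slope:
  assumes j: "j \<in> {1..n}"
  shows "val k (inc q j) - val k q \<le> idle k j (Suc (q j)) - idle k j (q j)"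
proof (induction k arbitrary: q)
  case 0
  show ?case using worth_inc[OF j] by (simp add: algebra_simps)
next
  case (Suc k)
  note W = post_upper_slope_step[OF j Suc.IH]
  define D where "D m = idle (Suc k) j (Suc m) - idle (Suc k) j m" for m
  have W: "post k (inc q j) \<le> post k q + D (q j)" for q
    using W[of q] unfolding D_def by linarith
  have "val (Suc k) (inc q j) \<le> val (Suc k) q + D (q j)"
  proof (rule val_Suc_le)
    show "post k (inc q j) \<le> val (Suc k) q + D (q j)"
      using W[of q] val_Suc_ge_post[of k q] by simp
  next
    fix i assume i: "i \<in> {1..n}"
    note c = join_prob01[OF i, of k "inc q j i"]
    show "post k (inc q j) + l k * gain (post k) (inc q j) i \<le> val (Suc k) q + D (q j)"
    proof (cases "i = j")
      case True
      let ?c = "l k * a j (Suc (q j))"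
      have "post k (inc (inc q j) j) \<le> post k (inc q j) + D (Suc (q j))"
        using W[of "inc q j"] by (simp add: inc_apply)
      also have "D (Suc (q j)) \<le> D (q j)" unfolding D_def by (rule idle_concave[OF j])
      finally have "post k (inc q j) + l k * gain (post k) (inc q j) i \<le>
          ?c * (r j + post k (inc q j) + D (q j)) + (1 - ?c) * (post k q + D (q j))"
        unfolding join_value using c True W[of q] by (simp only: True inc_apply if_True, intro convex_mono) auto
      also have "\<dots> = post k q + ?c * (r j + post k (inc q j) - post k q) + D (q j)" by (simp add: algebra_simps)
      also have "\<dots> \<le> post k q + (l k * a j (q j)) * (r j + post k (inc q j) - post k q) + D (q j)"
        using post_lower_slope[OF j, of k q] a_antimono[OF j, of "q j"] l01[of k]
        by (intro add_right_mono add_left_mono mult_right_mono mult_left_mono) auto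
      also have "\<dots> = post k q + l k * gain (post k) q j + D (q j)" by (simp add: gain_def)
      finally show ?thesis using val_Suc_ge[OF j, of k q] by simp
    next
      case False
      then have D: "D (inc q i j) = D (q j)" by (simp add: inc_apply)
      have "post k (inc q j) + l k * gain (post k) (inc q j) i \<le>
          (l k * a i (inc q j i)) * (r i + post k (inc q i) + D (q j)) + (1 - l k * a i (inc q j i)) * (post k q + D (q j))"
        unfolding join_value inc_commute[of q j i] using c W[of q] W[of "inc q i"] D by (intro convex_mono) auto
      also have "\<dots> = post k q + l k * gain (post k) q i + D (q j)"
        unfolding join_value using False by (simp add: inc_apply algebra_simps)
      finally show ?thesis using val_Suc_ge[OF i, of k q] by simp
    qed
  qed
  then show ?case unfolding D_def by linarith
qed

lemma post_upper_slope:
  "j \<in> {1..n} \<Longrightarrow> post k (inc q j) - post k q \<le> idle (Suc k) j (Suc (q j)) - idle (Suc k) j (q j)"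
  using post_upper_slope_step val_upper_slope by blast

lemma val_antimono: "j \<in> {1..n} \<Longrightarrow> val k (inc q j) \<le> val k q"
  using val_upper_slope[of j k q] idle_slope_nonpos[of j k "q j"] by simp

lemma post_antimono: "j \<in> {1..n} \<Longrightarrow> post k (inc q j) \<le> post k q"
  using post_upper_slope[of j k q] idle_slope_nonpos[of j "Suc k" "q j"] by simp

text \<open>Both slope bounds in the form in which they are used: the net reward of a join lies
  between \<open>0\<close> and \<open>r j\<close>. Hence larger joining probabilities never hurt,
  and a joining probability lost by an amount \<open>\<eta>\<close> costs at most
  \<open>\<eta> * r j\<close>.\<close>

lemma gain_bounds:
  assumes j: "j \<in> {1..n}"
  shows "0 \<le> r j + post k (inc q j) - post k q" "r j + post k (inc q j) - post k q \<le> r j"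
  using post_lower_slope[OF j, of k q] post_antimono[OF j, of k q] by auto

text \<open>Value of the whole system when nobody joins any more; the reference value that absorbs
  the effect of lost joins.\<close>

definition idle_sum :: "nat \<Rightarrow> queues \<Rightarrow> real" where
  "idle_sum k q = (\<Sum>j=1..n. idle k j (q j))"

lemma served_idle_sum: "served x {1..n} (idle_sum k) q = idle_sum (Suc k) q"
  unfolding idle_sum_def[abs_def] using x01
  by (subst served_separable) (auto intro!: sum.cong)

lemma idle_sum_inc:
  assumes "j \<in> {1..n}"
  shows "idle_sum k (inc q j) - idle_sum k q = idle k j (Suc (q j)) - idle k j (q j)"
proof -
  have "(\<Sum>i\<in>{1..n}-{j}. idle k i (inc q j i)) = (\<Sum>i\<in>{1..n}-{j}. idle k i (q i))"
    by (rule sum.cong) (auto simp: inc_apply)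
  moreover have "idle_sum k q' = idle k j (q' j) + (\<Sum>i\<in>{1..n}-{j}. idle k i (q' i))" for q'
    unfolding idle_sum_def by (rule sum.remove[OF _ assms]) simp
  ultimately show ?thesis by (simp add: inc_apply)
qed

lemma idle_sum_empty: "idle_sum k (\<lambda>_. 0) = 0"
proof -
  have "idle k j 0 = 0" for j by (induction k) auto
  then show ?thesis by (simp add: idle_sum_def)
qed

lemma worth_empty: "worth (\<lambda>_. 0) = 0"
  by (simp add: worth_def)

lemma val_plus_worth_nonneg: "0 \<le> val k q + worth q"
proof (induction k arbitrary: q)
  case 0 show ?case by simp
next
  case (Suc k)
  have "served x {1..n} (\<lambda>_. 0) q = 0" by (simp add: served_def)
  \<comment> \<open>With \<open>e = 1\<close> and \<open>c = 0\<close> the comparison says just that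
    nonnegativity survives the completions.\<close>
  then have "0 \<le> served x {1..n} (val k) q + worth q"
    using served_compare[where n=n and A="{1..n}" and x=x and x'=x and r=r and r'=r and c=0 and e=1
        and k=0 and F="\<lambda>_. 0" and F'="val k" and q=q] x_bounds r_nonneg val_lower_slope Suc.IH
    by (fastforce simp: worth_def)
  then show ?case using val_Suc_ge_post[of k q] by (simp add: post_def)
qed

end

section \<open>Perturbation of the parameters\<close>

text \<open>Completions never lengthen a queue, so only vectors below \<open>q\<close> occur. This
  permits comparison with a quantity frozen at \<open>q\<close>.\<close>

lemma served_mono_below:
  assumes "finite A" "\<And>q'. (\<And>j. q' j \<le> q j) \<Longrightarrow> F q' \<le> (G q' :: real)"
  shows "served x A F q \<le> served x A G q"
  unfolding served_def
  by (intro integral_mono integrable_measure_pmf_finite finite_set_Pi_bernoulli assms) auto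

text \<open>Raising one rate moves weight from \<open>q\<close> to \<open>dec q i\<close>, where an
  antitone function is larger. The slope bound with \<open>\<phi> = 0\<close> carries antitonicity
  through the completions of the other services.\<close>

lemma served_rate_mono:
  assumes "finite A" "\<forall>i\<in>A. 0 \<le> x' i \<and> x' i \<le> x i \<and> x i \<le> (1::real)"
    and "\<And>q j. j \<in> A \<Longrightarrow> F (inc q j) \<le> (F q :: real)"
  shows "served x' A F q \<le> served x A F q"
  using assms
proof (induction A arbitrary: q rule: finite_induct)
  case empty then show ?case by simp
next
  case (insert i A)
  have xi: "0 \<le> x' i" "x' i \<le> x i" "x i \<le> 1" and x01: "\<forall>i\<in>A. 0 \<le> x i \<and> x i \<le> 1"
    using insert.prems(1) by force+
  have IH: "served x' A F q \<le> served x A F q" for q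
    using insert.prems by (intro insert.IH) auto
  have mono: "served x A F (inc q i) \<le> served x A F q" for q
    using served_upper_slope[where \<phi>="\<lambda>_. 0" and F=F and x=x and j=i and q=q, OF insert.hyps(1) x01]
      insert.prems(2)[of i] by (simp split: if_splits)
  have le: "served x A F q \<le> served x A F (dec q i)"
    by (cases "q i = 0") (use mono[of "dec q i"] in \<open>auto simp: dec_zero inc_dec\<close>)
  have "served x' (insert i A) F q \<le> x' i * served x A F (dec q i) + (1 - x' i) * served x A F q"
    using xi insert.hyps by (subst served_insert) (auto intro!: convex_mono IH)
  also have "\<dots> = served x A F q + x' i * (served x A F (dec q i) - served x A F q)"
    by (simp add: algebra_simps)
  also have "\<dots> \<le> served x A F q + x i * (served x A F (dec q i) - served x A F q)"
    using xi le by (intro add_left_mono mult_right_mono) auto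
  also have "\<dots> = served x (insert i A) F q"
    using xi insert.hyps by (subst served_insert) (auto simp: algebra_simps)
  finally show ?case .
qed

lemma served_diff_const:
  assumes "finite A" "\<forall>i\<in>A. 0 \<le> x i \<and> x i \<le> 1"
  shows "served x A (\<lambda>q. F q - c) q = served x A F q - (c :: real)"
  using served_linear[OF assms, of 1 F "-c" "\<lambda>_. 1" q] by (simp add: served_def)

text \<open>Thinning the joins by \<open>1 - e\<close> amounts to mixing the optimal value with the
  value of idling. This is consistent over time because the marginal value of a customer is at most
  her marginal value under idling. The additive loss \<open>\<eta>\<close> of a joining probability
  costs at most \<open>\<eta> * R\<close> per period.\<close>

lemma join_perturbation:
  assumes I: "dsr_dp n r a x l" and J: "dsr_dp n r a' x l"
    and e: "0 \<le> e" "e \<le> 1" and \<eta>: "0 \<le> \<eta>" and R: "\<And>j. j \<in> {1..n} \<Longrightarrow> r j \<le> R" "0 \<le> R"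
    and a': "\<And>j m. j \<in> {1..n} \<Longrightarrow> a' j m \<ge> (1 - e) * a j m - \<eta>"
  shows "dsr_dp.val n r a' x l k q \<ge>
     (1 - e) * dsr_dp.val n r a x l k q + e * dsr_dp.idle_sum n r x k q - real k * \<eta> * R"
proof -
  interpret I: dsr_dp n r a x l by fact
  interpret J: dsr_dp n r a' x l by fact
  show ?thesis
  proof (induction k arbitrary: q)
    case 0
    have "I.idle_sum 0 q = - I.worth q"
      by (simp add: I.idle_sum_def I.worth_def sum_negf)
    then show ?case by (simp add: algebra_simps)
  next
    case (Suc k)
    define c where "c = real k * \<eta> * R"
    have post: "J.post k q \<ge> (1 - e) * I.post k q + e * I.idle_sum (Suc k) q - c" for q
      using served_mono_add[where F="\<lambda>q. (1 - e) * I.val k q + e * I.idle_sum k q" and c="-c" and x=x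
          and G="J.val k" and A="{1..n}", OF _ I.x01] Suc.IH
      unfolding served_linear[where x=x and A="{1..n}", OF finite_atLeastAtMost I.x01]
        I.served_idle_sum I.post_def J.post_def c_def by simp
    have \<eta>R: "0 \<le> \<eta> * R" using \<eta> R by simp
    have "I.val (Suc k) q * (1 - e) + e * I.idle_sum (Suc k) q - c - \<eta> * R \<le> J.val (Suc k) q"
    proof -
      show ?thesis
      proof (cases rule: I.val_Suc_cases[of k q])
        case 1
        then show ?thesis using post[of q] J.val_Suc_ge_post[of k q] \<eta>R
          by (simp add: algebra_simps)
      next
        case (2 j)
        note j = 2(1)
        define g where "g = r j + I.post k (inc q j) - I.post k q"
        define g' where "g' = r j + J.post k (inc q j) - J.post k q"
        define b where "b = l k * ((1 - e) * a j (q j))"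
        have b: "0 \<le> b" "b \<le> 1"
          unfolding b_def mult.left_commute[of "l k"]
          by (rule mult_nonneg_nonneg mult_le_one; use I.join_prob01[OF j, of k "q j"] e in simp)+
        have g': "0 \<le> g'" "g' \<le> R"
          using J.gain_bounds[OF j, of k q] R(1)[OF j] by (auto simp: g'_def)
        have "l k * \<eta> * g' \<le> 1 * \<eta> * R"
          using I.l01[of k] \<eta> g' by (intro mult_mono) auto
        then have "J.post k q + b * g' - \<eta> * R \<le> J.post k q + l k * ((1 - e) * a j (q j) - \<eta>) * g'"
          by (simp add: b_def algebra_simps)
        also have "\<dots> \<le> J.post k q + l k * a' j (q j) * g'"
          using a'[OF j] I.l01 g' by (intro add_left_mono mult_right_mono mult_left_mono) auto
        also have "\<dots> \<le> J.val (Suc k) q"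
          using J.val_Suc_ge[OF j, of k q] by (simp add: J.gain_def g'_def)
        finally have 1: "J.post k q + b * g' - \<eta> * R \<le> J.val (Suc k) q" .
        define S where "S = I.idle_sum (Suc k)"
        let ?L = "b * (r j + ((1 - e) * I.post k (inc q j) + e * S (inc q j) - c)) + (1 - b) * ((1 - e) * I.post k q + e * S q - c)"
        have "?L \<le> b * (r j + J.post k (inc q j)) + (1 - b) * J.post k q"
          using b post[of q] post[of "inc q j"] unfolding S_def by (intro convex_mono) auto
        also have "\<dots> = J.post k q + b * g'" by (simp add: g'_def algebra_simps)
        finally have 2: "?L \<le> J.post k q + b * g'" .
        \<comment> \<open>Inserting the induction hypothesis into the thinned join leaves, besides
          the target, \<open>b * e\<close> times the excess of the idle slope over the optimal
          slope, which is nonnegative.\<close>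
        have 3: "?L = (1 - e) * I.post k q + e * S q - c + b * (g + e * ((S (inc q j) - S q) - (I.post k (inc q j) - I.post k q)))"
          by (simp add: g_def algebra_simps)
        have 4: "0 \<le> b * (e * ((S (inc q j) - S q) - (I.post k (inc q j) - I.post k q)))"
          using b e I.post_upper_slope[OF j, of k q] unfolding S_def I.idle_sum_inc[OF j]
          by (intro mult_nonneg_nonneg) auto
        have 5: "(1 - e) * (l k * I.gain (I.post k) q j) = b * g"
          by (simp add: b_def g_def I.gain_def)
        have "I.val (Suc k) q * (1 - e) = (1 - e) * I.post k q + b * g"
          using 5 unfolding \<open>I.val (Suc k) q = _\<close> by (simp add: algebra_simps)
        then show ?thesis
          using 1 2[unfolded 3, unfolded distrib_left[of b]] 4 unfolding S_def by linarith
      qed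
    qed
    then show ?case by (simp add: c_def algebra_simps)
  qed
qed

text \<open>The error \<open>c * (k + N)\<close> is a potential: each customer who waits now or
  joins in one of the \<open>k\<close> remaining periods is charged \<open>c\<close> once, on being
  served. A join turns one unit of \<open>k\<close> into one unit of \<open>N\<close>, and a
  completion releases one.\<close>

lemma service_perturbation:
  assumes I: "dsr_dp n r a x l" and J: "dsr_dp n r' a x' l"
    and x': "\<And>j. j \<in> {1..n} \<Longrightarrow> x' j \<le> x j"
    and xr: "\<And>j. j \<in> {1..n} \<Longrightarrow> x' j * r' j + c * x j \<ge> (1 - e) * (x j * r j)"
    and e: "e \<le> 1" and c: "0 \<le> c"
  shows "dsr_dp.val n r' a x' l k q + dsr_dp.worth n r' q \<ge>
     (1 - e) * (dsr_dp.val n r a x l k q + dsr_dp.worth n r q) - c * (real k + (\<Sum>j=1..n. real (q j)))"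
proof -
  interpret I: dsr_dp n r a x l by fact
  interpret J: dsr_dp n r' a x' l by fact
  define N where "N q = (\<Sum>j=1..n. real (q j))" for q :: queues
  have N_inc: "N (inc q j) = N q + 1" if "j \<in> {1..n}" for q j
    using sum_inc[OF that, of "\<lambda>_. 1" q] by (simp add: N_def)
  have N0: "0 \<le> N q" for q by (auto simp: N_def intro: sum_nonneg)
  have "J.val k q + J.worth q \<ge> (1 - e) * (I.val k q + I.worth q) - c * (real k + N q)"
  proof (induction k arbitrary: q)
    case 0
    show ?case using c N0 by simp
  next
    case (Suc k)
    have post: "J.post k q + J.worth q \<ge> (1 - e) * (I.post k q + I.worth q) - c * (real k + N q)" for q
      unfolding I.post_def J.post_def I.worth_def J.worth_def N_def
    proof (rule served_compare)
      show "0 \<le> x' j \<and> x' j \<le> x j \<and> x j \<le> 1" if "j \<in> {1..n}" for j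
        using that I.x_bounds J.x_bounds x' by auto
      show "J.val k q + (\<Sum>j=1..n. r' j * real (q j)) \<ge> (1 - e) * (I.val k q + (\<Sum>j=1..n. r j * real (q j))) - c * (real k + (\<Sum>j=1..n. real (q j)))" for q
        using Suc.IH[of q] by (simp only: I.worth_def J.worth_def N_def)
    qed (use xr J.r_nonneg J.val_lower_slope in auto)
    show ?case
    proof (cases rule: I.val_Suc_cases[of k q])
      case 1
      then show ?thesis using post[of q] J.val_Suc_ge_post[of k q] c
        by (simp add: algebra_simps)
    next
      case (2 j)
      note j = 2(1)
      define b where "b = l k * a j (q j)"
      have b: "0 \<le> b" "b \<le> 1" using I.join_prob01[OF j] by (auto simp: b_def)
      have "(1 - e) * (I.val (Suc k) q + I.worth q) =
         b * ((1 - e) * (I.post k (inc q j) + I.worth (inc q j))) + (1 - b) * ((1 - e) * (I.post k q + I.worth q))"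
        by (simp add: 2(2) I.join_value b_def I.worth_inc[OF j] algebra_simps)
      also have "\<dots> \<le> b * (J.post k (inc q j) + J.worth (inc q j) + c * (real (Suc k) + N q))
          + (1 - b) * (J.post k q + J.worth q + c * (real (Suc k) + N q))"
      proof (intro convex_mono b)
        show "(1 - e) * (I.post k (inc q j) + I.worth (inc q j)) \<le> J.post k (inc q j) + J.worth (inc q j) + c * (real (Suc k) + N q)"
          using post[of "inc q j"] by (simp add: N_inc[OF j] algebra_simps)
        show "(1 - e) * (I.post k q + I.worth q) \<le> J.post k q + J.worth q + c * (real (Suc k) + N q)"
          using post[of q] c by (simp add: algebra_simps)
      qed
      also have "\<dots> = J.post k q + l k * J.gain (J.post k) q j + J.worth q + c * (real (Suc k) + N q)"
        by (simp add: J.join_value b_def J.worth_inc[OF j] algebra_simps)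
      also have "\<dots> \<le> J.val (Suc k) q + J.worth q + c * (real (Suc k) + N q)"
        using J.val_Suc_ge[OF j, of k q] by simp
      finally show ?thesis by simp
    qed
  qed
  then show ?thesis by (simp only: N_def)
qed

text \<open>A left-to-right search for a maximum with strict comparison, \<open>0\<close> meaning no
  recommendation. The evaluation program performs the same scan, so ties are broken alike and its
  output equals the rule exactly.\<close>

primrec pick :: "(nat \<Rightarrow> real) \<Rightarrow> nat \<Rightarrow> nat" where
  "pick g 0 = 0"
| "pick g (Suc m) = (if (if pick g m = 0 then 0 else g (pick g m)) < g (Suc m) then Suc m else pick g m)"

lemma pick_le: "pick g m \<le> m"
  by (induction m) auto

lemma topgain_Suc: "topgain g (Suc m) = max (topgain g m) (g (Suc m))"
proof -
  have "insert 0 (g ` {1..Suc m}) = insert (g (Suc m)) (insert 0 (g ` {1..m}))"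
    by (auto simp: atLeastAtMostSuc_conv)
  then show ?thesis unfolding topgain_def by (simp only:) (subst Max_insert, auto simp: max.commute)
qed

lemma pick_topgain: "(if pick g m = 0 then 0 else g (pick g m)) = topgain g m"
proof (induction m)
  case 0 then show ?case by (simp add: topgain_def)
next
  case (Suc m)
  then show ?case using topgain_nonneg[of g m] by (auto simp: max_def topgain_Suc)
qed

lemma pick_pos: "pick g m \<noteq> 0 \<Longrightarrow> 0 < g (pick g m)"
  by (induction m) (auto split: if_splits)

section \<open>Greedy recommendations, applied to an instance with larger parameters\<close>

context dsr_dp
begin

definition advice :: "nat \<Rightarrow> queues \<Rightarrow> nat option" where
  "advice k q = (let i = pick (gain (post k) q) n in if i = 0 then None else Some i)"

lemma advice_None: "advice k q = None \<Longrightarrow> val (Suc k) q = post k q"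
  using pick_topgain[of "gain (post k) q" n] by (simp add: advice_def Let_def val_Suc split: if_splits)

lemma advice_Some:
  assumes "advice k q = Some j"
  shows "j \<in> {1..n}" "val (Suc k) q = post k q + l k * gain (post k) q j" "0 < gain (post k) q j"
  using pick_topgain[of "gain (post k) q" n] pick_le[of "gain (post k) q" n] pick_pos[of "gain (post k) q" n] assms
  by (auto simp: advice_def Let_def val_Suc split: if_splits)

lemma advice_joinable:
  assumes "advice k q = Some j"
  shows "0 < a j (q j)"
proof (rule ccontr)
  assume "\<not> 0 < a j (q j)"
  then have "a j (q j) = 0" using a_bounds[of j "q j"] advice_Some(1)[OF assms] by force
  then show False using advice_Some(3)[OF assms] by (simp add: gain_def)
qed

end

text \<open>The advice for the smaller instance is applied to the real queues. \<open>D\<close> is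
  the part of the final penalty that the smaller instance ignores; a join raises it by
  \<open>r j - r' j\<close>, exactly the revenue earned in excess, and completions only lower it.
  Larger joining probabilities help because the reward of a join is nonnegative, larger service
  probabilities because values are antitone in the queues.\<close>

lemma advice_value:
  fixes r r' :: "nat \<Rightarrow> real" and n :: nat
  assumes I: "dsr_dp n r a x l" and J: "dsr_dp n r' a' x' l"
    and r: "\<And>j. j \<in> {1..n} \<Longrightarrow> r' j \<le> r j" and x: "\<And>j. j \<in> {1..n} \<Longrightarrow> x' j \<le> x j"
    and a: "\<And>j m. j \<in> {1..n} \<Longrightarrow> a' j m \<le> a j m"
  defines "D \<equiv> \<lambda>q::queues. \<Sum>j=1..n. (r j - r' j) * real (q j)"
  defines "W \<equiv> \<lambda>k. served x {1..n} (\<lambda>q. dsr_dp.val n r' a' x' l k q - D q)"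
  shows "dsr_dp.val n r' a' x' l (Suc k) q - D q \<le>
    (case dsr_dp.advice n r' a' x' l k q of None \<Rightarrow> W k q
     | Some j \<Rightarrow> W k q + l k * (a j (q j) * (r j + W k (inc q j) - W k q)))"
proof -
  interpret I: dsr_dp n r a x l by fact
  interpret J: dsr_dp n r' a' x' l by fact
  have W: "J.post k q - D q \<le> W k q" for q
  proof -
    have "J.post k q \<le> served x {1..n} (J.val k) q"
      unfolding J.post_def
      by (rule served_rate_mono) (use J.x_bounds I.x_bounds x J.val_antimono in auto)
    then have "J.post k q - D q \<le> served x {1..n} (\<lambda>q'. J.val k q' - D q) q"
      by (subst served_diff_const) (use I.x_bounds in auto)
    also have "\<dots> \<le> W k q"
      unfolding W_def D_def
      by (intro served_mono_below diff_left_mono sum_mono mult_left_mono) (use r in auto)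
    finally show ?thesis .
  qed
  show ?thesis
  proof (cases "J.advice k q")
    case None
    then show ?thesis using J.advice_None[OF None] W by simp
  next
    case (Some j)
    note j = J.advice_Some[OF Some]
    define b where "b = l k * a j (q j)"
    have b: "0 \<le> b" "b \<le> 1" using I.join_prob01[OF j(1)] by (auto simp: b_def)
    have "J.val (Suc k) q - D q = J.post k q + (l k * a' j (q j)) * (r' j + J.post k (inc q j) - J.post k q) - D q"
      using j(2) by (simp add: J.gain_def)
    also have "\<dots> \<le> J.post k q + b * (r' j + J.post k (inc q j) - J.post k q) - D q"
      unfolding b_def using a[OF j(1)] J.gain_bounds[OF j(1)] I.l01
      by (intro diff_right_mono add_left_mono mult_right_mono mult_left_mono) auto
    also have "\<dots> = b * (r j + (J.post k (inc q j) - D (inc q j))) + (1 - b) * (J.post k q - D q)"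
      unfolding D_def sum_inc[OF j(1)] by (simp add: algebra_simps)
    also have "\<dots> \<le> b * (r j + W k (inc q j)) + (1 - b) * W k q"
      using b W by (intro convex_mono) auto
    also have "\<dots> = W k q + l k * (a j (q j) * (r j + W k (inc q j) - W k q))"
      by (simp add: b_def algebra_simps)
    finally show ?thesis using Some by simp
  qed
qed

section \<open>Revenue of rules\<close>

text \<open>Time is reversed to count remaining periods; the value \<open>0\<close> beyond the
  horizon makes the locale assumption on \<open>l\<close> hold for every \<open>k\<close>.\<close>

definition arriv_rev :: "dsr \<Rightarrow> nat \<Rightarrow> real" where
  "arriv_rev I k = (if k < horizon I then arriv I (horizon I - k) else 0)"

lemma join_prob_nonneg: "0 \<le> attract I j \<Longrightarrow> 0 \<le> join_prob I j m"
  by (simp add: join_prob_def)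

lemma join_prob_antimono:
  assumes "0 \<le> attract I j" "0 \<le> serv I j" "1 < sens I"
  shows "join_prob I j (Suc m) \<le> join_prob I j m"
  using assms unfolding join_prob_def
  by (intro mult_left_mono powr_mono) (auto simp: divide_right_mono)

lemma join_prob_le_1:
  assumes "0 \<le> attract I j" "attract I j \<le> 1" "0 \<le> serv I j" "1 < sens I"
  shows "join_prob I j m \<le> 1"
proof -
  have "sens I powr (- (real m / serv I j)) \<le> sens I powr 0"
    using assms by (intro powr_mono) auto
  then show ?thesis using assms unfolding join_prob_def by (intro mult_le_one) auto
qed

lemma valid_dsr_dp:
  assumes "valid_dsr I"
  shows "dsr_dp (services I) (revenue I) (join_prob I) (serv I) (arriv_rev I)"
proof
  show "0 \<le> arriv_rev I k \<and> arriv_rev I k \<le> 1" for k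
  proof (cases "k < horizon I")
    case True
    then have "horizon I - k \<in> {1..horizon I}" by auto
    then show ?thesis using assms True by (auto simp: arriv_rev_def valid_dsr_def less_imp_le)
  qed (auto simp: arriv_rev_def)
qed (use assms in \<open>auto simp: valid_dsr_def less_imp_le intro!: join_prob_antimono join_prob_nonneg join_prob_le_1\<close>)

definition earned :: "dsr \<Rightarrow> history \<Rightarrow> real" where
  "earned I h = (\<Sum>(_, _, y)\<leftarrow>h. \<Sum>j=1..services I. revenue I j * of_bool (y = Some j))"

lemma earned_snoc:
  "earned I (h @ [(q, b, y)]) = earned I h +
     (case y of Some j \<Rightarrow> if j \<in> {1..services I} then revenue I j else 0 | None \<Rightarrow> 0)"
  by (auto simp: earned_def of_bool_def if_distrib sum.delta split: option.split cong: if_cong)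

lemma finite_set_period: "finite (set_pmf (period I \<rho> t h q))"
  unfolding period_def
  by (auto simp: set_bind_pmf finite_set_Pi_bernoulli split: option.split)

lemma finite_set_trajectory: "finite (set_pmf (trajectory I \<rho> t))"
  by (induction t) (auto simp: set_bind_pmf finite_set_period)

text \<open>Identifies one period of the probabilistic model with one step of the dynamic program.
  All supports are finite, so arrival, join and completions can be integrated one after the
  other.\<close>

lemma expectation_period:
  fixes G :: "queues \<Rightarrow> real"
  assumes v: "valid_dsr I" and t: "t \<in> {1..horizon I}"
    and \<rho>: "\<rho> h q \<in> insert None (Some ` {1..services I})"
  defines "S \<equiv> served (serv I) {1..services I} G"
  shows "measure_pmf.expectation (period I \<rho> t h q) (\<lambda>(h, q). earned I h + G q) = earned I h +
    (case \<rho> h q of None \<Rightarrow> S q | Some j \<Rightarrow>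
       S q + arriv I t * (join_prob I j (q j) * (revenue I j + S (inc q j) - S q)))"
proof -
  let ?P = "Pi_pmf {1..services I} False (\<lambda>j. bernoulli_pmf (serv I j))"
  let ?f = "\<lambda>(h, q). earned I h + (G q :: real)"
  define C where "C x = (case (if x then \<rho> h q else None) of
               None \<Rightarrow> return_pmf None
             | Some j \<Rightarrow> map_pmf (\<lambda>a. if a then Some j else None)
                                 (bernoulli_pmf (join_prob I j (q j))))" for x
  define E where "E x y = measure_pmf.expectation (?P \<bind>
      (\<lambda>B. return_pmf (h @ [(q, x, y)], \<lambda>j. q j + of_bool (y = Some j) - of_bool (B j)))) ?f" for x y
  have E: "E x y = earned I (h @ [(q, x, y)]) + S (\<lambda>j. q j + of_bool (y = Some j))" for x y
  proof -
    have "E x y = measure_pmf.expectation ?P (\<lambda>B. earned I (h @ [(q, x, y)])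
       + G (\<lambda>j. q j + of_bool (y = Some j) - of_bool (B j)))"
      unfolding E_def by (subst expectation_bind_finite) (auto simp: finite_set_Pi_bernoulli)
    also have "\<dots> = earned I (h @ [(q, x, y)]) + measure_pmf.expectation ?P
       (\<lambda>B. G (\<lambda>j. q j + of_bool (y = Some j) - of_bool (B j)))"
      by (subst Bochner_Integration.integral_add)
         (auto intro!: integrable_measure_pmf_finite simp: finite_set_Pi_bernoulli)
    finally show ?thesis by (simp add: S_def served_def)
  qed
  have E0: "E x None = earned I h + S q" for x by (simp add: E earned_snoc)
  have E1: "E x (Some j) = earned I h + revenue I j + S (inc q j)" if "j \<in> {1..services I}" for x j
  proof -
    have "(\<lambda>i. q i + of_bool (Some j = Some i)) = inc q j" by (auto simp: inc_apply)
    then show ?thesis using that by (simp add: E earned_snoc)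
  qed
  have finC: "finite (set_pmf (C x))" for x by (auto simp: C_def split: option.split)
  have "period I \<rho> t h q = bernoulli_pmf (arriv I t) \<bind> (\<lambda>x. C x \<bind> (\<lambda>y. ?P \<bind>
      (\<lambda>B. return_pmf (h @ [(q, x, y)], \<lambda>j. q j + of_bool (y = Some j) - of_bool (B j)))))"
    by (simp add: period_def C_def)
  then have "measure_pmf.expectation (period I \<rho> t h q) ?f =
     measure_pmf.expectation (bernoulli_pmf (arriv I t)) (\<lambda>x. measure_pmf.expectation (C x) (E x))"
    unfolding E_def
    by (simp only:) (subst expectation_bind_finite,
       (simp_all add: finC finite_set_Pi_bernoulli set_bind_pmf)[2], subst expectation_bind_finite,
       (simp_all add: finC finite_set_Pi_bernoulli set_bind_pmf))
  also have "\<dots> = arriv I t * measure_pmf.expectation (C True) (E True)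
      + (1 - arriv I t) * measure_pmf.expectation (C False) (E False)"
    using v t by (subst integral_bernoulli_pmf) (auto simp: valid_dsr_def less_imp_le)
  also have "\<dots> = earned I h + (case \<rho> h q of None \<Rightarrow> S q | Some j \<Rightarrow>
       S q + arriv I t * (join_prob I j (q j) * (revenue I j + S (inc q j) - S q)))"
  proof (cases "\<rho> h q")
    case None
    then show ?thesis by (simp add: C_def E0 algebra_simps)
  next
    case (Some j)
    then have j: "j \<in> {1..services I}" using \<rho> by auto
    then have "0 \<le> join_prob I j (q j)" "join_prob I j (q j) \<le> 1"
      using v by (auto simp: valid_dsr_def less_imp_le intro!: join_prob_nonneg join_prob_le_1)
    then show ?thesis by (simp add: C_def Some E0 E1[OF j] algebra_simps)
  qed
  finally show ?thesis .
qed

lemma expectation_trajectory_Suc: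
  "measure_pmf.expectation (trajectory I \<rho> (Suc t)) (f :: _ \<Rightarrow> real) =
   measure_pmf.expectation (trajectory I \<rho> t)
     (\<lambda>z. measure_pmf.expectation (period I \<rho> (Suc t) (fst z) (snd z)) f)"
  by (simp add: expectation_bind_finite finite_set_trajectory finite_set_period case_prod_beta)

lemma expectation_trajectory_mono:
  fixes f g :: "_ \<Rightarrow> real"
  assumes "\<And>z. z \<in> set_pmf (trajectory I \<rho> t) \<Longrightarrow> f z \<le> g z"
  shows "measure_pmf.expectation (trajectory I \<rho> t) f \<le> measure_pmf.expectation (trajectory I \<rho> t) g"
  by (intro integral_mono_AE integrable_measure_pmf_finite finite_set_trajectory)
     (auto simp: AE_measure_pmf_iff assms)

lemma rule_revenue_altdef:
  "rule_revenue I \<rho> = measure_pmf.expectation (trajectory I \<rho> (horizon I))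
     (\<lambda>(h, q). earned I h + - (\<Sum>j=1..services I. revenue I j * real (q j)))"
  by (simp add: rule_revenue_def realized_revenue_def earned_def)

context
  fixes I :: dsr
  assumes valid: "valid_dsr I"
begin

interpretation I: dsr_dp "services I" "revenue I" "join_prob I" "serv I" "arriv_rev I"
  by (rule valid_dsr_dp[OF valid])

lemma arriv_eq: "t < horizon I \<Longrightarrow> arriv I (Suc t) = arriv_rev I (horizon I - Suc t)"
  by (auto simp: arriv_rev_def)

text \<open>Revenue so far plus the optimal value of the remaining periods does not increase in
  expectation, whatever the rule does. History dependence is harmless because each period is
  compared for a fixed history.\<close>

lemma rule_revenue_le_val:
  fixes \<rho> :: rule
  assumes \<rho>: "\<And>h q. \<rho> h q \<in> insert None (Some ` {1..services I})"
  shows "rule_revenue I \<rho> \<le> I.val (horizon I) (\<lambda>_. 0)"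
proof -
  have "measure_pmf.expectation (trajectory I \<rho> t) (\<lambda>(h, q). earned I h + I.val (horizon I - t) q)
     \<le> I.val (horizon I) (\<lambda>_. 0)" if "t \<le> horizon I" for t
    using that
  proof (induction t)
    case 0 then show ?case by (simp add: earned_def)
  next
    case (Suc t)
    have S: "horizon I - t = Suc (horizon I - Suc t)" using Suc.prems by simp
    have t: "Suc t \<in> {1..horizon I}" using Suc.prems by auto
    have "measure_pmf.expectation (trajectory I \<rho> (Suc t)) (\<lambda>(h, q). earned I h + I.val (horizon I - Suc t) q)
      \<le> measure_pmf.expectation (trajectory I \<rho> t) (\<lambda>(h, q). earned I h + I.val (horizon I - t) q)"
      unfolding expectation_trajectory_Suc
    proof (rule expectation_trajectory_mono)
      fix z :: "history \<times> queues"
      obtain h q where z: "z = (h, q)" by fastforce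
      have "(case \<rho> h q of None \<Rightarrow> I.post (horizon I - Suc t) q | Some j \<Rightarrow> I.post (horizon I - Suc t) q
         + arriv I (Suc t) * (join_prob I j (q j) * (revenue I j + I.post (horizon I - Suc t) (inc q j)
            - I.post (horizon I - Suc t) q))) \<le> I.val (Suc (horizon I - Suc t)) q"
        using I.val_Suc_ge_post I.val_Suc_ge \<rho>[of h q] Suc.prems
        by (force simp: arriv_eq I.gain_def split: option.split)
      then show "measure_pmf.expectation (period I \<rho> (Suc t) (fst z) (snd z))
           (\<lambda>(h, q). earned I h + I.val (horizon I - Suc t) q)
         \<le> (case z of (h, q) \<Rightarrow> earned I h + I.val (horizon I - t) q)"
        unfolding z fst_conv snd_conv prod.case expectation_period[where \<rho>=\<rho>, OF valid t \<rho>] S I.post_def by simp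
    qed
    then show ?case using Suc by simp
  qed
  from this[of "horizon I"] show ?thesis by (simp add: rule_revenue_altdef I.worth_def)
qed

lemma OPT_le_val: "OPT I \<le> I.val (horizon I) (\<lambda>_. 0)"
  unfolding OPT_def
proof (rule cSUP_least)
  have "(\<lambda>_ _ _. None) \<in> policies I" by (auto simp: policies_def)
  then show "policies I \<noteq> {}" by blast
next
  fix \<pi> assume \<pi>: "\<pi> \<in> policies I"
  let ?V = "I.val (horizon I) (\<lambda>_. 0)"
  have le: "rule_revenue I (\<pi> u) \<le> ?V" for u
    using \<pi> by (intro rule_revenue_le_val) (auto simp: policies_def)
  interpret prob_space "uniform_measure lborel {0..1::real}"
    by (rule prob_space_uniform_measure) auto
  show "net_revenue I \<pi> \<le> ?V"
  proof (cases "integrable (uniform_measure lborel {0..1}) (\<lambda>u. rule_revenue I (\<pi> u))")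
    case True then show ?thesis unfolding net_revenue_def using le by (intro integral_le_const) auto
  next
    \<comment> \<open>The Bochner integral of a non-integrable function is \<open>0\<close>, and the
      optimal value from empty queues is nonnegative.\<close>
    case False then show ?thesis
      using I.val_plus_worth_nonneg[of "horizon I" "\<lambda>_. 0"]
      by (simp add: net_revenue_def not_integrable_integral_eq I.worth_empty)
  qed
qed

lemma net_revenue_const: "net_revenue I (\<lambda>_. \<rho>) = rule_revenue I \<rho>"
proof -
  interpret prob_space "uniform_measure lborel {0..1::real}"
    by (rule prob_space_uniform_measure) auto
  show ?thesis using prob_space by (simp add: net_revenue_def)
qed

text \<open>The counterpart of the upper bound: for this rule, revenue so far plus \<open>G\<close>
  does not decrease in expectation. At the end, \<open>G\<close> is exactly the final penalty of the
  original instance, since \<open>J.val 0\<close> contributes the part with \<open>r'\<close> and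
  the subtracted sum the rest.\<close>

lemma advice_revenue:
  fixes \<rho> :: rule
  assumes J: "dsr_dp (services I) r' a' x' (arriv_rev I)"
    and r: "\<And>j. j \<in> {1..services I} \<Longrightarrow> r' j \<le> revenue I j"
    and x: "\<And>j. j \<in> {1..services I} \<Longrightarrow> x' j \<le> serv I j"
    and a: "\<And>j m. j \<in> {1..services I} \<Longrightarrow> a' j m \<le> join_prob I j m"
    and \<rho>: "\<And>h q. \<rho> h q = dsr_dp.advice (services I) r' a' x' (arriv_rev I) (horizon I - Suc (length h)) q"
  shows "dsr_dp.val (services I) r' a' x' (arriv_rev I) (horizon I) (\<lambda>_. 0) \<le> rule_revenue I \<rho>"
proof -
  interpret J: dsr_dp "services I" r' a' x' "arriv_rev I" by fact
  define G where "G k q = J.val k q - (\<Sum>j=1..services I. (revenue I j - r' j) * real (q j))" for k q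
  have \<rho>_in: "\<rho> h q \<in> insert None (Some ` {1..services I})" for h q
    using J.advice_Some(1) by (cases "\<rho> h q") (auto simp: \<rho>)
  have "J.val (horizon I) (\<lambda>_. 0) \<le> measure_pmf.expectation (trajectory I \<rho> t) (\<lambda>(h, q). earned I h + G (horizon I - t) q)"
    if "t \<le> horizon I" for t
    using that
  proof (induction t)
    case 0 then show ?case by (simp add: earned_def G_def)
  next
    case (Suc t)
    have S: "horizon I - t = Suc (horizon I - Suc t)" using Suc.prems by simp
    have t: "Suc t \<in> {1..horizon I}" using Suc.prems by auto
    have "measure_pmf.expectation (trajectory I \<rho> t) (\<lambda>(h, q). earned I h + G (horizon I - t) q)
      \<le> measure_pmf.expectation (trajectory I \<rho> (Suc t)) (\<lambda>(h, q). earned I h + G (horizon I - Suc t) q)"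
      unfolding expectation_trajectory_Suc
    proof (rule expectation_trajectory_mono)
      fix z :: "history \<times> queues" assume "z \<in> set_pmf (trajectory I \<rho> t)"
      moreover obtain h q where z: "z = (h, q)" by fastforce
      ultimately have "length h = t" using trajectory_length by blast
      then have \<rho>': "\<rho> h q = J.advice (horizon I - Suc t) q" by (simp add: \<rho>)
      show "(case z of (h, q) \<Rightarrow> earned I h + G (horizon I - t) q)
        \<le> measure_pmf.expectation (period I \<rho> (Suc t) (fst z) (snd z))
           (\<lambda>(h, q). earned I h + G (horizon I - Suc t) q)"
        unfolding z fst_conv snd_conv prod.case expectation_period[where \<rho>=\<rho>, OF valid t \<rho>_in] S G_def \<rho>'
          arriv_eq[OF Suc_le_lessD[OF Suc.prems]]
        by (rule add_left_mono, rule advice_value[OF valid_dsr_dp[OF valid] J r x a])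
    qed
    then show ?case using Suc by simp
  qed
  from this[of "horizon I"] show ?thesis
    by (simp add: rule_revenue_altdef G_def J.worth_def algebra_simps sum_subtractf)
qed

text \<open>A queue grows only by a join that the rule has recommended. The bound thus holds in the
  original instance, whose joining probabilities stay positive at every length when
  \<open>attract\<close> is positive.\<close>

lemma trajectory_bounded:
  fixes \<rho> :: rule
  assumes \<rho>: "\<And>h q j. \<rho> h q = Some j \<Longrightarrow> Suc (q j) < b" and b: "0 < b"
  shows "(h, q) \<in> set_pmf (trajectory I \<rho> t) \<Longrightarrow>
    (\<forall>j. q j < b) \<and> (\<forall>(q', _, _)\<in>set h. \<forall>j. q' j < b)"
proof (induction t arbitrary: h q)
  case 0 then show ?case using b by simp
next
  case (Suc t)
  then obtain h' q' where 1: "(h', q') \<in> set_pmf (trajectory I \<rho> t)"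
    and 2: "(h, q) \<in> set_pmf (period I \<rho> (Suc t) h' q')" by auto
  note IH = Suc.IH[OF 1]
  from 2 obtain x y B where h: "h = h' @ [(q', x, y)]"
    and q: "q = (\<lambda>j. q' j + of_bool (y = Some j) - of_bool (B j))"
    and y: "y = None \<or> y = \<rho> h' q'"
    by (auto simp: period_def split: option.splits if_splits)
  have "q j < b" for j
  proof -
    have "q j \<le> q' j + of_bool (y = Some j)" by (simp add: q)
    also have "\<dots> < b"
    proof (cases "y = Some j")
      case True then show ?thesis using y \<rho>[of h' q' j] by auto
    qed (use IH in auto)
    finally show ?thesis .
  qed
  then show ?case using IH h by auto
qed

end

section \<open>A lower bound on the optimal value\<close>

lemma served_zero: "finite A \<Longrightarrow> (\<And>i. i \<in> A \<Longrightarrow> q i = 0) \<Longrightarrow> served x A F q = F q"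
proof -
  assume A: "finite A" and q: "\<And>i. i \<in> A \<Longrightarrow> q i = 0"
  have "(\<lambda>j. q j - of_bool (B j)) = q" if "B \<in> set_pmf (Pi_pmf A False (\<lambda>j. bernoulli_pmf (x j)))" for B
    using set_Pi_pmf_subset[OF A, of False "\<lambda>j. bernoulli_pmf (x j)"] that q by fastforce
  then have "served x A F q = measure_pmf.expectation (Pi_pmf A False (\<lambda>j. bernoulli_pmf (x j))) (\<lambda>_. F q)"
    unfolding served_def by (intro integral_cong_AE) (auto simp: AE_measure_pmf_iff)
  then show ?thesis by simp
qed

context dsr_dp
begin

lemma val_empty_mono: "k \<le> k' \<Longrightarrow> val k (\<lambda>_. 0) \<le> val k' (\<lambda>_. 0)"
proof (induction k' rule: dec_induct)
  case (step m)
  have "post m (\<lambda>_. 0) = val m (\<lambda>_. 0)" unfolding post_def by (rule served_zero) auto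
  then show ?case using step val_Suc_ge_post[of m "\<lambda>_. 0"] by simp
qed simp

text \<open>Idle until \<open>k\<close> periods follow the current one, recommend \<open>j\<close>
  once and idle again: the customer joins with probability \<open>l k * a j 0\<close> and is served
  at once with probability \<open>x j\<close>. Negligible losses are later measured against this
  bound.\<close>

lemma val_empty_ge:
  assumes j: "j \<in> {1..n}" and k: "k < k'"
  shows "l k * a j 0 * x j * r j \<le> val k' (\<lambda>_. 0)"
proof -
  let ?z = "\<lambda>_. 0 :: nat"
  have p0: "post k ?z = val k ?z" unfolding post_def by (rule served_zero) auto
  have v0: "0 \<le> val k ?z" using val_plus_worth_nonneg[of k ?z] by (simp add: worth_empty)
  have e: "{1..n} = insert j ({1..n} - {j})" using j by auto
  have "post k (inc ?z j) = x j * val k ?z + (1 - x j) * val k (inc ?z j)"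
  proof -
    have "served x ({1..n} - {j}) (val k) ?z = val k ?z"
      "served x ({1..n} - {j}) (val k) (inc ?z j) = val k (inc ?z j)"
      by (rule served_zero; auto simp: inc_apply)+
    then show ?thesis
      unfolding post_def by (subst e, subst served_insert) (use x_bounds[OF j] in simp_all)
  qed
  also have "\<dots> \<ge> x j * val k ?z + (1 - x j) * (val k ?z - r j)"
    using x_bounds[OF j] val_lower_slope[OF j, of k ?z] by (intro convex_mono) auto
  finally have "x j * r j \<le> r j + post k (inc ?z j) - post k ?z" using p0 by (simp add: algebra_simps)
  then have "(l k * a j 0) * (x j * r j) \<le> (l k * a j 0) * (r j + post k (inc ?z j) - post k ?z)"
    using join_prob01[OF j, of k 0] by (intro mult_left_mono) auto
  also have "\<dots> \<le> val (Suc k) ?z" using val_Suc_ge[OF j, of k ?z] v0 p0 by (simp add: gain_def)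
  also have "\<dots> \<le> val k' ?z" using k by (intro val_empty_mono) auto
  finally show ?thesis by (simp add: mult_ac)
qed

end

section \<open>Rounding\<close>

locale rounding =
  fixes I :: dsr and \<epsilon> c_lam c_p c_xi :: real
  assumes valid: "valid_dsr I"
    and eps: "0 < \<epsilon>" "\<epsilon> < 1/10"
    and cs: "0 < c_lam" "0 < c_p" "0 < c_xi"
    and lam: "Max (arriv I ` {1..horizon I}) \<ge> real (horizon I) powr (- c_lam)"
    and bounds: "j \<in> {1..services I} \<Longrightarrow> attract I j \<ge> real (horizon I) powr (- c_p) \<and>
                         serv I j \<ge> real (horizon I) powr (- c_xi)"
begin

abbreviation n :: nat where "n \<equiv> services I"
abbreviation T :: nat where "T \<equiv> horizon I"
abbreviation \<gamma> :: real where "\<gamma> \<equiv> sens I"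

text \<open>Chosen so that \<open>exp (- depth)\<close> is the power
  \<open>c_lam + c_p + c_xi + 1\<close> of \<epsilon>/(5T). One factor makes a loss repeated in
  \<open>T\<close> periods cost \<epsilon>/5; the others match the lower bound on the optimum
  relative to \<open>rmax\<close>.\<close>

definition depth :: real where
  "depth = (c_lam + c_p + c_xi + 1) * ln (5 * real T / \<epsilon>)"

text \<open>Number of levels per unit of the logarithm. Rounding the attractiveness costs the
  exponent \<open>1 / grain\<close>; rounding the service probability inside the exponent of
  \<gamma> costs up to \<open>cutoff * ln \<gamma> / grain = 2 * depth / grain\<close>. The sum is
  exactly \<epsilon>/5.\<close>

definition grain :: real where
  "grain = 5 * (1 + 2 * depth) / \<epsilon>"

text \<open>Joining probabilities are below \<open>exp (- depth)\<close> once the queue exceeds half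
  of this multiple of the service probability. The factor \<open>2\<close> leaves room for comparing
  with the rounded service probability, which is at least half the true one.\<close>

definition cutoff :: real where
  "cutoff = 2 * depth / ln \<gamma>"

definition steps :: "real \<Rightarrow> nat" where
  "steps z = nat \<lfloor>- ln z * grain\<rfloor>"

text \<open>The lower end of the logarithmic interval containing \<open>z\<close>, for
  \<open>z\<close> in (0,1]. It depends on \<open>z\<close> only through \<open>steps z\<close>,
  which is what keys record; even an exact level is lowered by one step.\<close>

definition rnd :: "real \<Rightarrow> real" where
  "rnd z = exp (- ((real (steps z) + 1) / grain))"

definition rmax :: real where
  "rmax = topgain (revenue I) n"

definition minor :: "nat \<Rightarrow> bool" where
  "minor j \<longleftrightarrow> revenue I j < rmax * exp (- depth)"

definition r' :: "nat \<Rightarrow> real" where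
  "r' j = (if minor j then 0 else rmax * rnd (revenue I j / rmax))"

definition p' :: "nat \<Rightarrow> real" where
  "p' j = rnd (attract I j)"

definition x' :: "nat \<Rightarrow> real" where
  "x' j = rnd (serv I j)"

text \<open>Truncated at zero and expressed by rounded quantities alone, so that it is a function of
  the cell.\<close>

definition a' :: "nat \<Rightarrow> nat \<Rightarrow> real" where
  "a' j m = (if real m < cutoff * x' j then p' j * exp (- (real m / x' j) * ln \<gamma>) else 0)"

definition K :: nat where
  "K = Suc (nat \<lfloor>depth * grain\<rfloor>)"

text \<open>Joinable lengths are at most the floor of \<open>cutoff\<close>; a join adds one, and
  \<open>H\<close> is a strict bound, hence the \<open>2\<close>.\<close>

definition H :: nat where
  "H = nat \<lfloor>cutoff\<rfloor> + 2"

text \<open>\<open>K\<close> is the revenue digit of the services whose revenue is rounded to \<open>0\<close>.\<close>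

definition key :: "nat \<Rightarrow> nat" where
  "key j = (if minor j then K else steps (revenue I j / rmax)) +
     Suc K * (steps (attract I j) + Suc K * steps (serv I j))"

section \<open>Consequences of the choice of constants\<close>

lemma T_pos: "1 \<le> T" using valid by (simp add: valid_dsr_def)

lemma gamma: "1 < \<gamma>" "0 < ln \<gamma>" using valid by (auto simp: valid_dsr_def)

lemma params:
  assumes "j \<in> {1..n}"
  shows "0 \<le> revenue I j" "0 < attract I j" "attract I j \<le> 1" "0 < serv I j" "serv I j \<le> 1"
proof -
  have "0 < real T powr (- c_p)" using T_pos by simp
  then show "0 < attract I j" using bounds[OF assms] by linarith
qed (use assms valid in \<open>auto simp: valid_dsr_def\<close>)

lemma ratio: "50 \<le> 5 * real T / \<epsilon>" "1 \<le> 5 * real T / \<epsilon>"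
proof -
  have "50 * \<epsilon> \<le> 5" using eps by simp
  also have "5 \<le> 5 * real T" using T_pos by simp
  finally show "50 \<le> 5 * real T / \<epsilon>" using eps by (simp add: pos_le_divide_eq)
  then show "1 \<le> 5 * real T / \<epsilon>" by simp
qed

lemma depth_pos: "0 < depth"
  unfolding depth_def using ratio cs by (intro mult_pos_pos) auto

lemma grain_pos: "0 < grain"
  using depth_pos eps by (simp add: grain_def)

lemma cutoff_pos: "0 < cutoff"
  using depth_pos gamma by (simp add: cutoff_def)

lemma inverse_grain: "(1 + 2 * depth) / grain = \<epsilon> / 5"
  using depth_pos eps by (simp add: grain_def field_simps add_eq_0_iff2)

lemma inverse_grain_le: "1 / grain \<le> \<epsilon> / 5"
proof -
  have "1 / grain \<le> (1 + 2 * depth) / grain"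
    using grain_pos depth_pos by (intro divide_right_mono) auto
  then show ?thesis by (simp add: inverse_grain)
qed

lemma steps_bounds:
  assumes "0 < z" "z \<le> 1"
  shows "real (steps z) \<le> - ln z * grain" "- ln z * grain < real (steps z) + 1"
proof -
  have "0 \<le> - ln z * grain" using assms grain_pos by (intro mult_nonneg_nonneg) auto
  then have "real (steps z) = of_int \<lfloor>- ln z * grain\<rfloor>" unfolding steps_def by simp
  then show "real (steps z) \<le> - ln z * grain" "- ln z * grain < real (steps z) + 1" by linarith+
qed

lemma rnd_bounds:
  assumes "0 < z" "z \<le> 1"
  shows "0 < rnd z" "rnd z \<le> z" "exp (- 1 / grain) * z \<le> rnd z"
proof -
  note s = steps_bounds[OF assms]
  show "0 < rnd z" by (simp add: rnd_def)
  have "- ln z \<le> (real (steps z) + 1) / grain"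
    using s grain_pos by (simp add: pos_le_divide_eq)
  then have "exp (- ((real (steps z) + 1) / grain)) \<le> exp (ln z)" by simp
  then show "rnd z \<le> z" using assms by (simp add: rnd_def)
  have "(real (steps z) + 1) / grain \<le> - ln z + 1 / grain"
  proof -
    have "(real (steps z) + 1) / grain \<le> (- ln z * grain + 1) / grain"
      using s grain_pos by (intro divide_right_mono) auto
    also have "\<dots> = - ln z + 1 / grain" using grain_pos by (simp add: field_simps)
    finally show ?thesis .
  qed
  then have "- 1 / grain + ln z \<le> - ((real (steps z) + 1) / grain)" by simp
  then have "exp (- 1 / grain + ln z) \<le> rnd z" unfolding rnd_def by (simp only: exp_le_cancel_iff)
  then show "exp (- 1 / grain) * z \<le> rnd z" using assms by (simp only: exp_add exp_ln)
qed

lemma rnd_ge: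
  assumes "0 < z" "z \<le> 1"
  shows "(1 - 1 / grain) * z \<le> rnd z"
proof -
  have "1 + (- 1 / grain) \<le> exp (- 1 / grain)" by (rule exp_ge_add_one_self)
  then have "(1 - 1 / grain) * z \<le> exp (- 1 / grain) * z" using assms by (intro mult_right_mono) auto
  then show ?thesis using rnd_bounds[OF assms] by linarith
qed

lemma steps_le:
  assumes "0 < z" "z \<le> 1" "exp (- depth) \<le> z"
  shows "steps z < K"
proof -
  have "- depth \<le> ln z" using assms by (simp add: ln_ge_iff)
  then have "- ln z * grain \<le> depth * grain" using grain_pos by (intro mult_right_mono) auto
  then have "steps z \<le> nat \<lfloor>depth * grain\<rfloor>" unfolding steps_def by (intro nat_mono floor_mono)
  then show ?thesis by (simp add: K_def)
qed

lemma exp_depth_le: "exp (- depth) \<le> \<epsilon> / (5 * real T) * real T powr (- (c_lam + c_p + c_xi))"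
proof -
  let ?c = "c_lam + c_p + c_xi"
  have "exp (- depth) = (5 * real T / \<epsilon>) powr (- (?c + 1))"
  proof -
    have "5 * real T / \<epsilon> \<noteq> 0" using ratio by linarith
    then show ?thesis unfolding powr_def depth_def by (simp only: if_False mult_minus_left)
  qed
  also have "\<dots> = (5 * real T / \<epsilon>) powr (- 1) * (5 * real T / \<epsilon>) powr (- ?c)"
    by (simp only: powr_add[symmetric]) (simp add: algebra_simps)
  also have "(5 * real T / \<epsilon>) powr (- 1) = \<epsilon> / (5 * real T)"
    using ratio eps T_pos by (simp add: powr_minus_divide)
  finally have eq: "exp (- depth) = \<epsilon> / (5 * real T) * (5 * real T / \<epsilon>) powr (- ?c)" .
  have "(5 * real T / \<epsilon>) powr (- ?c) \<le> real T powr (- ?c)"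
  proof (rule powr_mono2')
    show "real T \<le> 5 * real T / \<epsilon>" using eps T_pos by (simp add: field_simps)
  qed (use T_pos cs in auto)
  then show ?thesis unfolding eq using eps by (intro mult_left_mono) auto
qed

text \<open>Attractiveness and service probability are therefore never under the threshold, by
  assumption on the instance. Only revenues need a digit for discarded values.\<close>

lemma exp_depth_le_powr:
  assumes "0 \<le> c" "c \<le> c_lam + c_p + c_xi"
  shows "exp (- depth) \<le> real T powr (- c)"
proof -
  have "exp (- depth) \<le> \<epsilon> / (5 * real T) * real T powr (- (c_lam + c_p + c_xi))" by (rule exp_depth_le)
  also have "\<dots> \<le> 1 * real T powr (- (c_lam + c_p + c_xi))"
    using eps T_pos by (intro mult_right_mono) (auto simp: field_simps)
  also have "\<dots> \<le> real T powr (- c)" using assms T_pos by (simp add: powr_mono)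
  finally show ?thesis .
qed

lemma r_le_rmax: "j \<in> {1..n} \<Longrightarrow> revenue I j \<le> rmax"
  unfolding rmax_def by (rule topgain_ge)

lemma rmax_nonneg: "0 \<le> rmax"
  unfolding rmax_def by (rule topgain_nonneg)

lemma not_minor:
  assumes "j \<in> {1..n}" "\<not> minor j" "0 < rmax"
  shows "0 < revenue I j / rmax" "revenue I j / rmax \<le> 1" "exp (- depth) \<le> revenue I j / rmax"
proof -
  show *: "exp (- depth) \<le> revenue I j / rmax"
    using assms by (simp add: minor_def field_simps)
  show "0 < revenue I j / rmax" by (rule less_le_trans[OF _ *]) simp
  show "revenue I j / rmax \<le> 1" using r_le_rmax[OF assms(1)] assms(3) by simp
qed

lemma digit_revenue_less:
  assumes "j \<in> {1..n}" "\<not> minor j"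
  shows "steps (revenue I j / rmax) < K"
proof (cases "0 < rmax")
  case True then show ?thesis using not_minor[OF assms True] by (intro steps_le)
next
  case False
  then have "rmax = 0" using rmax_nonneg by simp
  \<comment> \<open>Here \<open>x / 0 = 0\<close> and \<open>ln 0 = 0\<close>, so the digit is
    \<open>0\<close>.\<close>
  then show ?thesis by (simp add: steps_def K_def)
qed

lemma digit_attract_less: "j \<in> {1..n} \<Longrightarrow> steps (attract I j) < K"
  using params[of j] bounds[of j] exp_depth_le_powr[of c_p] cs by (intro steps_le) auto

lemma digit_serv_less: "j \<in> {1..n} \<Longrightarrow> steps (serv I j) < K"
  using params[of j] bounds[of j] exp_depth_le_powr[of c_xi] cs by (intro steps_le) auto

lemma key_less: "j \<in> {1..n} \<Longrightarrow> key j < Suc K ^ 3"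
proof -
  assume j: "j \<in> {1..n}"
  define u v w where "u = (if minor j then K else steps (revenue I j / rmax))"
    and "v = steps (attract I j)" and "w = steps (serv I j)"
  have "u \<le> K" "v \<le> K" "w \<le> K"
    using digit_revenue_less[OF j] digit_attract_less[OF j] digit_serv_less[OF j]
    by (auto simp: u_def v_def w_def)
  then have "u + Suc K * (v + Suc K * w) \<le> K + Suc K * (K + Suc K * K)"
    by (intro add_mono mult_le_mono) auto
  also have "\<dots> < Suc K ^ 3" by (simp add: power3_eq_cube algebra_simps)
  finally show ?thesis by (simp add: key_def u_def v_def w_def)
qed

text \<open>Reading off the three digits shows that services with equal keys are indistinguishable
  in the rounded instance. This is what allows counting services instead of naming them.\<close>

lemma key_inj:
  assumes i: "i \<in> {1..n}" and j: "j \<in> {1..n}" and eq: "key i = key j"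
  shows "r' i = r' j" "p' i = p' j" "x' i = x' j"
proof -
  define u where "u j = (if minor j then K else steps (revenue I j / rmax))" for j
  define v where "v j = steps (attract I j)" for j
  define w where "w j = steps (serv I j)" for j
  have b: "u j < Suc K \<and> v j < Suc K" if "j \<in> {1..n}" for j
    using digit_revenue_less[OF that] digit_attract_less[OF that] by (auto simp: u_def v_def)
  have key: "key j = u j + Suc K * (v j + Suc K * w j)" for j
    by (simp add: key_def u_def v_def w_def)
  have m: "key j mod Suc K = u j" "key j div Suc K = v j + Suc K * w j" if "j \<in> {1..n}" for j
    unfolding key using b[OF that] by (simp_all del: mult_Suc)
  have m': "(v j + Suc K * w j) mod Suc K = v j" "(v j + Suc K * w j) div Suc K = w j" if "j \<in> {1..n}" for j
    using b[OF that] by (simp_all del: mult_Suc)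
  have u: "u i = u j" and vw: "v i + Suc K * w i = v j + Suc K * w j"
    using m[OF i] m[OF j] eq by simp_all
  have v: "v i = v j" and w: "w i = w j"
    using m'[OF i] m'[OF j] vw by metis+
  show "p' i = p' j" using v by (simp add: p'_def rnd_def v_def)
  show "x' i = x' j" using w by (simp add: x'_def rnd_def w_def)
  have "minor i = minor j"
    using u digit_revenue_less[OF i] digit_revenue_less[OF j] by (auto simp: u_def split: if_splits)
  then show "r' i = r' j" using u by (auto simp: r'_def rnd_def u_def split: if_splits)
qed

lemma x'_bounds:
  assumes "j \<in> {1..n}"
  shows "0 < x' j" "x' j \<le> serv I j" "x' j \<le> 1" "(1 - 1 / grain) * serv I j \<le> x' j"
  using rnd_bounds[of "serv I j"] rnd_ge[of "serv I j"] params[OF assms] by (auto simp: x'_def)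

lemma p'_bounds:
  assumes "j \<in> {1..n}"
  shows "0 < p' j" "p' j \<le> attract I j" "p' j \<le> 1" "exp (- 1 / grain) * attract I j \<le> p' j"
  using rnd_bounds[of "attract I j"] params[OF assms] by (auto simp: p'_def)

lemma r'_range:
  assumes j: "j \<in> {1..n}"
  shows "0 \<le> r' j \<and> r' j \<le> revenue I j \<and> (1 - \<epsilon> / 5) * revenue I j - rmax * exp (- depth) \<le> r' j"
proof (cases "minor j")
  case True
  have "(1 - \<epsilon> / 5) * revenue I j \<le> 1 * revenue I j"
    using params(1)[OF j] eps by (intro mult_right_mono) auto
  then show ?thesis using True params(1)[OF j] by (simp add: r'_def minor_def)
next
  case False
  show ?thesis
  proof (cases "0 < rmax")
    case True
    define z where "z = revenue I j / rmax"
    have r: "revenue I j = rmax * z" using True by (simp add: z_def)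
    have z: "0 < z" "z \<le> 1" using not_minor[OF j False True] by (auto simp: z_def)
    have "(1 - \<epsilon> / 5) * z \<le> (1 - 1 / grain) * z"
      using inverse_grain_le z by (intro mult_right_mono) auto
    then have "(1 - \<epsilon> / 5) * z \<le> rnd z" using rnd_ge[OF z] by linarith
    then have "rmax * ((1 - \<epsilon> / 5) * z) \<le> rmax * rnd z" "rmax * rnd z \<le> rmax * z" "0 \<le> rmax * rnd z"
      using rnd_bounds[OF z] rmax_nonneg by (auto intro: mult_left_mono)
    moreover have "r' j = rmax * rnd z" using False by (simp add: r'_def z_def)
    moreover have "(1 - \<epsilon> / 5) * revenue I j = rmax * ((1 - \<epsilon> / 5) * z)" by (simp add: r)
    moreover have "0 \<le> rmax * exp (- depth)" using rmax_nonneg by simp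
    ultimately show ?thesis unfolding r by linarith
  next
    case F: False
    then have "rmax = 0" using rmax_nonneg by simp
    then show ?thesis using r_le_rmax[OF j] params(1)[OF j] False by (simp add: r'_def)
  qed
qed

lemmas r'_bounds = r'_range[THEN conjunct1] r'_range[THEN conjunct2, THEN conjunct1]
  r'_range[THEN conjunct2, THEN conjunct2]

lemma join_prob_exp: "join_prob I j m = attract I j * exp (- (real m / serv I j) * ln \<gamma>)"
  using gamma by (simp add: join_prob_def powr_def)

lemma a'_nonneg: "j \<in> {1..n} \<Longrightarrow> 0 \<le> a' j m"
  using p'_bounds[of j] by (simp add: a'_def)

lemma a'_le:
  assumes "j \<in> {1..n}"
  shows "a' j m \<le> join_prob I j m"
proof (cases "real m < cutoff * x' j")
  case True
  have "real m / serv I j \<le> real m / x' j"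
    using x'_bounds[OF assms] by (intro divide_left_mono) auto
  then have "exp (- (real m / x' j) * ln \<gamma>) \<le> exp (- (real m / serv I j) * ln \<gamma>)"
    using gamma by (simp only: exp_le_cancel_iff, intro mult_right_mono) auto
  then show ?thesis using True p'_bounds[OF assms] params[OF assms]
    by (auto simp: a'_def join_prob_exp intro!: mult_mono)
next
  case False
  then show ?thesis using params(2)[OF assms] by (auto simp: a'_def intro: join_prob_nonneg)
qed

lemma a'_antimono:
  assumes "j \<in> {1..n}"
  shows "a' j (Suc m) \<le> a' j m"
proof (cases "real (Suc m) < cutoff * x' j")
  case True
  have "real m / x' j \<le> real (Suc m) / x' j"
    using x'_bounds[OF assms] by (intro divide_right_mono) auto
  then have "exp (- (real (Suc m) / x' j) * ln \<gamma>) \<le> exp (- (real m / x' j) * ln \<gamma>)"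
    using gamma by (simp only: exp_le_cancel_iff, intro mult_right_mono) auto
  then show ?thesis using True p'_bounds[OF assms] by (auto simp: a'_def)
next
  case False
  then show ?thesis using a'_nonneg[OF assms] by (simp add: a'_def)
qed

text \<open>Before the cutoff the loss is the factor
  \<open>exp (- d) * exp (- (2 * depth * d))\<close>, whose exponent is -\<epsilon>/5 by the choice
  of \<open>grain\<close>. Beyond it the original joining probability is itself at most
  \<open>exp (- depth)\<close>.\<close>

lemma a'_ge:
  assumes j: "j \<in> {1..n}"
  shows "(1 - \<epsilon> / 5) * join_prob I j m - exp (- depth) \<le> a' j m"
proof -
  note x = x'_bounds[OF j] and p = p'_bounds[OF j] and I = params[OF j]
  define d where "d = 1 / grain"
  have d: "0 < d" "d \<le> \<epsilon> / 5" using grain_pos inverse_grain_le by (auto simp: d_def)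
  show ?thesis
  proof (cases "real m < cutoff * x' j")
    case True
    have "real m / x' j - real m / serv I j = real m / x' j * (1 - x' j / serv I j)"
      using x I by (simp add: field_simps)
    also have "\<dots> \<le> cutoff * d"
    proof (rule mult_mono)
      show "real m / x' j \<le> cutoff" using True x by (simp add: field_simps)
      show "1 - x' j / serv I j \<le> d" using x(4) I by (simp add: d_def[symmetric] field_simps)
    qed (use x I cutoff_pos in auto)
    finally have "(real m / x' j) * ln \<gamma> \<le> (real m / serv I j + cutoff * d) * ln \<gamma>"
      using gamma by (intro mult_right_mono) auto
    also have "\<dots> = (real m / serv I j) * ln \<gamma> + 2 * depth * d"
      using gamma by (simp add: cutoff_def field_simps)
    finally have 1: "exp (- (real m / serv I j) * ln \<gamma>) * exp (- (2 * depth * d)) \<le> exp (- (real m / x' j) * ln \<gamma>)"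
      by (simp flip: exp_add)
    have "1 - \<epsilon> / 5 \<le> exp (- (\<epsilon> / 5))" using exp_ge_add_one_self[of "- (\<epsilon> / 5)"] by simp
    also have "- (\<epsilon> / 5) = - d + - (2 * depth * d)"
      by (simp add: inverse_grain[symmetric] d_def add_divide_distrib)
    finally have 2: "1 - \<epsilon> / 5 \<le> exp (- d) * exp (- (2 * depth * d))" by (simp only: exp_add)
    have "(1 - \<epsilon> / 5) * join_prob I j m \<le> (exp (- d) * exp (- (2 * depth * d))) * join_prob I j m"
      using 2 I by (intro mult_right_mono join_prob_nonneg) auto
    also have "\<dots> = (exp (- d) * attract I j) * (exp (- (real m / serv I j) * ln \<gamma>) * exp (- (2 * depth * d)))"
      by (simp add: join_prob_exp mult_ac)
    also have "\<dots> \<le> p' j * exp (- (real m / x' j) * ln \<gamma>)"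
      using 1 p by (intro mult_mono) (auto simp: d_def)
    finally have "(1 - \<epsilon> / 5) * join_prob I j m \<le> a' j m" using True by (simp add: a'_def)
    moreover have "0 < exp (- depth)" by simp
    ultimately show ?thesis by linarith
  next
    case False
    have "cutoff / 2 * serv I j \<le> cutoff * ((1 - d) * serv I j)"
      using cutoff_pos I d eps by simp
    also have "\<dots> \<le> cutoff * x' j" using x(4) cutoff_pos by (intro mult_left_mono) (auto simp: d_def)
    also have "\<dots> \<le> real m" using False by simp
    finally have "cutoff / 2 \<le> real m / serv I j" using I by (simp add: field_simps)
    then have "cutoff / 2 * ln \<gamma> \<le> real m / serv I j * ln \<gamma>" using gamma by (intro mult_right_mono) auto
    then have "depth \<le> real m / serv I j * ln \<gamma>" using gamma by (simp add: cutoff_def)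
    then have e: "exp (- (real m / serv I j) * ln \<gamma>) \<le> exp (- depth)" by simp
    have "(1 - \<epsilon> / 5) * join_prob I j m \<le> 1 * join_prob I j m"
      using eps I by (intro mult_right_mono join_prob_nonneg) auto
    also have "\<dots> \<le> 1 * exp (- depth)"
      unfolding join_prob_exp mult_1 using e I mult_mono[of "attract I j" 1 _ "exp (- depth)"] by auto
    finally show ?thesis using a'_nonneg[OF j, of m] by simp
  qed
qed

section \<open>The original, the intermediate and the rounded instance\<close>

sublocale I: dsr_dp n "revenue I" "join_prob I" "serv I" "arriv_rev I"
  by (rule valid_dsr_dp[OF valid])

text \<open>Changes only the joining probabilities, so that the two perturbation results apply in
  turn: the first fixes revenues and service probabilities, the second fixes joining
  probabilities.\<close>

sublocale Mid: dsr_dp n "revenue I" a' "serv I" "arriv_rev I"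
  using I.r_nonneg I.x_bounds I.l_bounds a'_nonneg a'_antimono order_trans[OF a'_le] I.a_bounds
  by unfold_locales blast+

sublocale J: dsr_dp n r' a' x' "arriv_rev I"
  using r'_bounds x'_bounds I.l_bounds Mid.a_bounds a'_antimono less_imp_le
  by unfold_locales blast+

text \<open>One recommendation of the most profitable service in the period with the most likely
  arrival. This is where the lower bounds on the parameters enter the value estimate.\<close>

lemma rmax_le_val: "rmax * real T powr (- (c_lam + c_p + c_xi)) \<le> I.val T (\<lambda>_. 0)"
proof (cases "0 < rmax")
  case True
  then obtain j where j: "j \<in> {1..n}" "rmax = revenue I j"
    using topgain_cases[of "revenue I" n] by (auto simp: rmax_def)
  have "Max (arriv I ` {1..T}) \<in> arriv I ` {1..T}" using T_pos by (intro Max_in) auto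
  then obtain t where t: "t \<in> {1..T}" "Max (arriv I ` {1..T}) = arriv I t" by auto
  have l: "arriv_rev I (T - t) = arriv I t" using t by (auto simp: arriv_rev_def)
  have "real T powr (- (c_lam + c_p + c_xi)) = real T powr (- c_lam) * real T powr (- c_p) * real T powr (- c_xi)"
    by (simp flip: powr_add)
  also have "\<dots> \<le> arriv I t * attract I j * serv I j"
  proof -
    have l: "real T powr - c_lam \<le> arriv I t" using lam t by simp
    have "0 \<le> arriv I t" by (rule order_trans[OF _ l]) simp
    with l show ?thesis
      by (intro mult_mono mult_nonneg_nonneg) (use bounds[OF j(1)] params[OF j(1)] in auto)
  qed
  finally have "rmax * real T powr (- (c_lam + c_p + c_xi)) \<le> rmax * (arriv I t * attract I j * serv I j)"
    using True by (intro mult_left_mono) auto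
  also have "\<dots> = arriv_rev I (T - t) * join_prob I j 0 * serv I j * revenue I j"
    using gamma by (simp add: l j(2) join_prob_def)
  also have "\<dots> \<le> I.val T (\<lambda>_. 0)" using t by (intro I.val_empty_ge j) auto
  finally show ?thesis .
next
  case False
  then have "rmax = 0" using rmax_nonneg by simp
  then show ?thesis using I.val_plus_worth_nonneg[of T "\<lambda>_. 0"] by (simp add: I.worth_empty)
qed

text \<open>With \<open>e = \<epsilon> / 5\<close>, passing to \<open>Mid\<close> costs
  \<open>e\<close> for the factor and \<open>e\<close> for the threshold. Passing to
  \<open>J\<close> costs a factor \<open>1 - 2 * e\<close>, one \<open>e\<close> each for service
  probabilities and revenues, and another \<open>e\<close> for the threshold. Together
  \<open>(1 - 2 * e)\<^sup>2 - e\<close>, which is at least \<open>1 - 5 * e\<close>.\<close>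

lemma rounded_value: "(1 - \<epsilon>) * I.val T (\<lambda>_. 0) \<le> J.val T (\<lambda>_. 0)"
proof -
  let ?z = "\<lambda>_. 0 :: nat"
  define Opt where "Opt = I.val T ?z"
  define e where "e = \<epsilon> / 5"
  have e: "0 < e" "e < 1/50" using eps by (auto simp: e_def)
  have Opt0: "0 \<le> Opt" using I.val_plus_worth_nonneg[of T ?z] by (simp add: I.worth_empty Opt_def)
  have small: "real T * exp (- depth) * rmax \<le> e * Opt"
  proof -
    have "real T * exp (- depth) * rmax \<le> real T * (\<epsilon> / (5 * real T) * real T powr (- (c_lam + c_p + c_xi))) * rmax"
      using exp_depth_le rmax_nonneg by (intro mult_right_mono mult_left_mono) auto
    also have "\<dots> = e * (rmax * real T powr (- (c_lam + c_p + c_xi)))"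
      using T_pos by (simp add: e_def field_simps)
    also have "\<dots> \<le> e * Opt"
      using rmax_le_val e by (intro mult_left_mono) (auto simp: Opt_def)
    finally show ?thesis .
  qed
  have "Mid.val T ?z \<ge> (1 - e) * I.val T ?z + e * I.idle_sum T ?z - real T * exp (- depth) * rmax"
    by (rule join_perturbation[OF I.dsr_dp_axioms Mid.dsr_dp_axioms])
       (use e r_le_rmax rmax_nonneg a'_ge in \<open>auto simp: e_def\<close>)
  then have 1: "(1 - 2 * e) * Opt \<le> Mid.val T ?z"
    using small by (simp add: I.idle_sum_empty Opt_def algebra_simps)
  have "J.val T ?z + J.worth ?z \<ge> (1 - 2 * e) * (Mid.val T ?z + Mid.worth ?z)
      - (rmax * exp (- depth)) * (real T + (\<Sum>j=1..n. real (?z j)))"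
  proof (rule service_perturbation[OF Mid.dsr_dp_axioms J.dsr_dp_axioms])
    fix j assume j: "j \<in> {1..n}"
    show "x' j \<le> serv I j" by (rule x'_bounds[OF j])
    have s0: "0 \<le> serv I j" "0 \<le> revenue I j" using params[OF j] by auto
    have "(1 - 2 * e) * (serv I j * revenue I j) \<le> (1 - e) * (1 - e) * (serv I j * revenue I j)"
      using s0 by (intro mult_right_mono) (auto simp: algebra_simps)
    also have "\<dots> = ((1 - e) * serv I j) * ((1 - e) * revenue I j - rmax * exp (- depth))
        + ((1 - e) * serv I j) * (rmax * exp (- depth))" by (simp add: algebra_simps)
    also have "\<dots> \<le> x' j * r' j + serv I j * (rmax * exp (- depth))"
    proof (rule add_mono)
      have "(1 - e) * serv I j \<le> (1 - 1 / grain) * serv I j"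
        using s0 inverse_grain_le by (intro mult_right_mono) (auto simp: e_def)
      then have x: "(1 - e) * serv I j \<le> x' j" using x'_bounds(4)[OF j] by linarith
      have "((1 - e) * serv I j) * ((1 - e) * revenue I j - rmax * exp (- depth)) \<le> ((1 - e) * serv I j) * r' j"
        using r'_bounds[OF j] s0 e by (intro mult_left_mono) (auto simp: e_def)
      also have "\<dots> \<le> x' j * r' j" using x r'_bounds[OF j] by (intro mult_right_mono)
      finally show "((1 - e) * serv I j) * ((1 - e) * revenue I j - rmax * exp (- depth)) \<le> x' j * r' j" .
      have "(1 - e) * serv I j \<le> 1 * serv I j" using s0 e by (intro mult_right_mono) auto
      then show "((1 - e) * serv I j) * (rmax * exp (- depth)) \<le> serv I j * (rmax * exp (- depth))"
        using rmax_nonneg by (intro mult_right_mono) auto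
    qed
    finally show "(1 - 2 * e) * (serv I j * revenue I j) \<le> x' j * r' j + rmax * exp (- depth) * serv I j"
      by (simp add: mult_ac)
  qed (use e rmax_nonneg in auto)
  then have "(1 - 2 * e) * Mid.val T ?z - e * Opt \<le> J.val T ?z"
    using small by (simp add: Mid.worth_empty J.worth_empty mult_ac)
  moreover have "(1 - 2 * e) * ((1 - 2 * e) * Opt) \<le> (1 - 2 * e) * Mid.val T ?z"
    using 1 e by (intro mult_left_mono) auto
  moreover have "(1 - \<epsilon>) * Opt \<le> (1 - 2 * e) * ((1 - 2 * e) * Opt) - e * Opt"
  proof -
    have "0 \<le> 4 * e * e * Opt" using e Opt0 by simp
    then show ?thesis by (simp add: e_def algebra_simps)
  qed
  ultimately show ?thesis unfolding Opt_def by linarith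
qed

lemma joinable_bounded:
  assumes j: "j \<in> {1..n}" and "a' j m \<noteq> 0"
  shows "Suc m < H"
proof -
  have "real m < cutoff * x' j" using assms by (auto simp: a'_def split: if_splits)
  also have "\<dots> \<le> cutoff * 1" using x'_bounds[OF j] cutoff_pos by (intro mult_left_mono) auto
  finally have "int m \<le> \<lfloor>cutoff\<rfloor>" by (simp add: le_floor_iff)
  then show ?thesis by (simp add: H_def)
qed

lemma advice_bounded: "J.advice k q = Some j \<Longrightarrow> Suc (q j) < H"
  by (rule joinable_bounded[OF J.advice_Some(1)]) (auto dest: J.advice_joinable)

end

text \<open>With \<open>L = ln (T / \<epsilon>)\<close>, \<open>depth\<close> is at most
  \<open>A * L\<close> and \<open>grain\<close> at most \<open>15 * (A * L) / \<epsilon>\<close>. So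
  \<open>Suc K\<close> is O(L^2 / \<epsilon>), the constant \<open>17\<close> including its two
  extra units, and \<open>H\<close> is O(L). The resulting \<open>L ^ 7\<close> is weakened to
  \<open>L ^ 8\<close>, as \<open>1 \<le> L\<close> follows from T/\<epsilon> being at least
  \<open>10\<close>.\<close>

lemma (in rounding) cells_le:
  defines "A \<equiv> 2 * (c_lam + c_p + c_xi + 1)"
  shows "real (Suc K ^ 3 * H) \<le> (17 * A\<^sup>2) ^ 3 * (2 * A / ln \<gamma> + 2) * (ln (real T / \<epsilon>) ^ 8 / \<epsilon> ^ 3)"
proof -
  define L where "L = ln (real T / \<epsilon>)"
  have T10: "10 \<le> real T / \<epsilon>"
  proof -
    have "10 * \<epsilon> \<le> real T" using eps T_pos by linarith
    then show ?thesis using eps by (simp add: pos_le_divide_eq)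
  qed
  have L5: "ln 5 \<le> L" unfolding L_def using T10 by (subst ln_le_cancel_iff) auto
  have "exp 1 \<le> real T / \<epsilon>" using T10 exp_le by linarith
  then have L: "1 \<le> L" unfolding L_def using T10 by (subst ln_ge_iff) auto
  have A: "2 \<le> A" using cs by (simp add: A_def)
  have "ln (5 * real T / \<epsilon>) = ln 5 + L"
    using T10 eps T_pos by (simp add: L_def ln_mult ln_div)
  also have "\<dots> \<le> 2 * L" using L5 by simp
  finally have y: "depth \<le> A * L"
    unfolding depth_def A_def using cs mult_left_mono[of "ln (5 * real T / \<epsilon>)" "2 * L" "c_lam + c_p + c_xi + 1"]
    by (simp add: algebra_simps)
  have AL: "1 \<le> A * L" using A L mult_mono[of 1 A 1 L] by simp
  have "1 + 2 * depth \<le> 3 * (A * L)" using y AL by linarith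
  then have g: "grain \<le> 15 * (A * L) / \<epsilon>"
    unfolding grain_def using eps by (intro divide_right_mono) auto
  have A2: "1 \<le> A\<^sup>2 * L\<^sup>2 / \<epsilon>"
  proof -
    have "1 * 1 \<le> (A * L) * (A * L)" using AL by (intro mult_mono) auto
    then have "\<epsilon> \<le> A\<^sup>2 * L\<^sup>2" using eps by (simp add: power2_eq_square mult_ac)
    then show ?thesis using eps by (simp add: pos_le_divide_eq)
  qed
  have "depth * grain \<le> (A * L) * (15 * (A * L) / \<epsilon>)"
    using y g depth_pos grain_pos AL by (intro mult_mono) auto
  also have "\<dots> = 15 * (A\<^sup>2 * L\<^sup>2 / \<epsilon>)" by (simp add: power2_eq_square)
  finally have yg: "depth * grain \<le> 15 * (A\<^sup>2 * L\<^sup>2 / \<epsilon>)" .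
  have "real (nat \<lfloor>depth * grain\<rfloor>) \<le> depth * grain"
    using depth_pos grain_pos by simp
  then have "real (Suc K) \<le> depth * grain + 2" by (simp add: K_def)
  also have "\<dots> \<le> 17 * (A\<^sup>2 * L\<^sup>2 / \<epsilon>)" using yg A2 by linarith
  finally have "real (Suc K) ^ 3 \<le> (17 * (A\<^sup>2 * L\<^sup>2 / \<epsilon>)) ^ 3"
    by (intro power_mono) auto
  also have "\<dots> = (17 * A\<^sup>2) ^ 3 * (L ^ 6 / \<epsilon> ^ 3)"
    by (simp add: power_mult_distrib power_divide flip: power_mult)
  finally have 1: "real (Suc K) ^ 3 \<le> (17 * A\<^sup>2) ^ 3 * (L ^ 6 / \<epsilon> ^ 3)" .
  have "real (nat \<lfloor>cutoff\<rfloor>) \<le> cutoff" using cutoff_pos by simp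
  then have "real H \<le> cutoff + 2" by (simp add: H_def)
  also have "cutoff \<le> 2 * (A * L) / ln \<gamma>"
    unfolding cutoff_def using y gamma by (intro divide_right_mono) auto
  also have "2 * (A * L) / ln \<gamma> + 2 \<le> (2 * A / ln \<gamma> + 2) * L" using L by (simp add: algebra_simps)
  finally have 2: "real H \<le> (2 * A / ln \<gamma> + 2) * L" by simp
  have "real (Suc K ^ 3 * H) \<le> ((17 * A\<^sup>2) ^ 3 * (L ^ 6 / \<epsilon> ^ 3)) * ((2 * A / ln \<gamma> + 2) * L)"
    unfolding of_nat_mult of_nat_power
  proof (rule mult_mono[OF 1 2])
    show "0 \<le> (17 * A\<^sup>2) ^ 3 * (L ^ 6 / \<epsilon> ^ 3)" using A L eps by simp
  qed simp
  also have "\<dots> = (17 * A\<^sup>2) ^ 3 * (2 * A / ln \<gamma> + 2) * (L ^ 7 / \<epsilon> ^ 3)"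
    by (simp add: eval_nat_numeral mult_ac)
  also have "\<dots> \<le> (17 * A\<^sup>2) ^ 3 * (2 * A / ln \<gamma> + 2) * (L ^ 8 / \<epsilon> ^ 3)"
    using L A gamma eps by (intro mult_left_mono divide_right_mono power_increasing) auto
  finally show ?thesis by (simp only: L_def)
qed

section \<open>Reasoning about programs\<close>

abbreviation SC :: arr where "SC \<equiv> Work 0"

definition runs :: "com \<Rightarrow> nat \<Rightarrow> (memory \<Rightarrow> bool) \<Rightarrow> memory \<Rightarrow> bool" where
  "runs c b Q m \<longleftrightarrow> (\<exists>k m'. exec c m k m' \<and> k \<le> b \<and> Q m')"

primrec loop_free :: "com \<Rightarrow> bool" where
  "loop_free Skip = True"
| "loop_free (Assign a i e) = True"
| "loop_free (Seq c c') = (loop_free c \<and> loop_free c')"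
| "loop_free (If b c c') = (loop_free c \<and> loop_free c')"
| "loop_free (While b c) = False"

primrec result :: "com \<Rightarrow> memory \<Rightarrow> memory" where
  "result Skip m = m"
| "result (Assign a i e) m = m(a := (m a)(index (exp_val i m) := exp_val e m))"
| "result (Seq c c') m = result c' (result c m)"
| "result (If b c c') m = (if bexp_val b m then result c m else result c' m)"
| "result (While b c) m = m"

text \<open>Both branches of a conditional are charged, so the bound does not depend on the
  memory.\<close>

primrec steps_of :: "com \<Rightarrow> nat" where
  "steps_of Skip = 1"
| "steps_of (Assign a i e) = 1 + exp_cost i + exp_cost e"
| "steps_of (Seq c c') = steps_of c + steps_of c'"
| "steps_of (If b c c') = 1 + bexp_cost b + steps_of c + steps_of c'"
| "steps_of (While b c) = 0"

lemma exec_loop_free: "loop_free c \<Longrightarrow> \<exists>k\<le>steps_of c. exec c m k (result c m)"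
proof (induction c arbitrary: m)
  case (Seq c c')
  then obtain k k' where "k \<le> steps_of c" "exec c m k (result c m)"
    "k' \<le> steps_of c'" "exec c' (result c m) k' (result c' (result c m))" by force
  then show ?case by (intro exI[of _ "k + k'"]) (auto intro: exec.Seq)
next
  case (If b c c')
  show ?case
  proof (cases "bexp_val b m")
    case True
    from If obtain k where "k \<le> steps_of c" "exec c m k (result c m)" by force
    then show ?thesis using True by (intro exI[of _ "1 + bexp_cost b + k"]) (auto intro: exec.IfTrue[simplified])
  next
    case False
    from If obtain k where "k \<le> steps_of c'" "exec c' m k (result c' m)" by force
    then show ?thesis using False by (intro exI[of _ "1 + bexp_cost b + k"]) (auto intro: exec.IfFalse[simplified])
  qed
next
  case Skip
  show ?case by (intro exI[of _ 1]) (simp add: exec.Skip[simplified])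
next
  case (Assign a i e)
  show ?case by (intro exI[of _ "1 + exp_cost i + exp_cost e"]) (simp only: steps_of.simps result.simps le_refl exec.Assign simp_thms)
qed simp

lemma runs_loop_free: "loop_free c \<Longrightarrow> Q (result c m) \<Longrightarrow> runs c (steps_of c) Q m"
  using exec_loop_free[of c m] by (auto simp: runs_def)

lemma runs_Seq: "runs c b R m \<Longrightarrow> (\<And>m'. R m' \<Longrightarrow> runs c' b' Q m') \<Longrightarrow> runs (Seq c c') (b + b') Q m"
  unfolding runs_def by (metis exec.Seq add_mono)

lemma runs_weaken: "runs c b R m \<Longrightarrow> b \<le> b' \<Longrightarrow> (\<And>m'. R m' \<Longrightarrow> Q m') \<Longrightarrow> runs c b' Q m"
  unfolding runs_def by (meson le_trans)

lemma runs_If_False: "\<not> bexp_val e m \<Longrightarrow> runs c' b Q m \<Longrightarrow> runs (If e c c') (1 + bexp_cost e + b) Q m"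
  unfolding runs_def by (meson exec.IfFalse add_left_mono)

lemma runs_If_True: "bexp_val e m \<Longrightarrow> runs c b Q m \<Longrightarrow> runs (If e c c') (1 + bexp_cost e + b) Q m"
  unfolding runs_def by (meson exec.IfTrue add_left_mono)

abbreviation scalar :: "nat \<Rightarrow> exp" where
  "scalar i \<equiv> Get SC (Num (of_nat i))"

definition set_scalar :: "nat \<Rightarrow> real \<Rightarrow> memory \<Rightarrow> memory" where
  "set_scalar i x m = m(Work 0 := (m SC)(i := x))"

lemma set_scalar_apply [simp]:
  "set_scalar i x m SC = (m SC)(i := x)"
  "a \<noteq> Work 0 \<Longrightarrow> set_scalar i x m a = m a"
  by (auto simp: set_scalar_def)

definition for_loop :: "nat \<Rightarrow> exp \<Rightarrow> com \<Rightarrow> com" where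
  "for_loop v e c = Seq (Assign SC (Num (of_nat v)) (Num 0))
     (While (Less (scalar v) e)
        (Seq c (Assign SC (Num (of_nat v)) (Binop Add (scalar v) (Num 1)))))"

lemma index_real [simp]: "index (real k) = k"
  by (simp add: index_def)

lemma index_numeral [simp]: "index (numeral k) = numeral k" "index 0 = 0" "index 1 = 1"
  by (simp_all add: index_def)

abbreviation after :: "nat \<Rightarrow> nat \<Rightarrow> (nat \<Rightarrow> memory \<Rightarrow> bool) \<Rightarrow> memory \<Rightarrow> bool" where
  "after v i Inv \<equiv> \<lambda>m. m SC v = real i \<and> Inv (Suc i) (set_scalar v (real (Suc i)) m)"

text \<open>A round costs the body plus \<open>12\<close>: six steps for the test and six for the
  increment. The initial assignment and the final test fit into the extra round of
  \<open>Suc N\<close>. By \<open>after\<close>, the body must leave its counter intact.\<close>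

lemma runs_for:
  assumes e: "\<And>i m. i \<le> N \<Longrightarrow> Inv i m \<Longrightarrow> m SC v = real i \<Longrightarrow> m a w = real N"
    and step: "\<And>i m. i < N \<Longrightarrow> Inv i m \<Longrightarrow> m SC v = real i \<Longrightarrow>
        runs c b (after v i Inv) m"
    and init: "Inv 0 (set_scalar v 0 m)"
    and final: "\<And>m'. Inv N m' \<Longrightarrow> Q m'"
  shows "runs (for_loop v (Get a (Num (of_nat w))) c) (Suc N * (b + 12)) Q m"
proof -
  let ?e = "Get a (Num (of_nat w))"
  let ?inc = "Assign SC (Num (of_nat v)) (Binop Add (scalar v) (Num 1))"
  let ?w = "While (Less (scalar v) ?e) (Seq c ?inc)"
  have loop: "runs ?w ((N - i) * (b + 12) + 9) (Inv N) m"
    if "i \<le> N" "Inv i m" "m SC v = real i" for i m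
    using that
  proof (induction "N - i" arbitrary: i m)
    case 0
    then have "i = N" by simp
    have "\<not> bexp_val (Less (scalar v) ?e) m" using e[OF 0(2-4)] 0(4) \<open>i = N\<close> by simp
    from exec.WhileFalse[OF this, of "Seq c ?inc"] show ?case
      using 0 \<open>i = N\<close> unfolding runs_def by (intro exI conjI) auto
  next
    case (Suc d)
    then have i: "i < N" by simp
    have true: "bexp_val (Less (scalar v) ?e) m" using e[OF Suc(3-5)] Suc(5) i by simp
    from step[OF i Suc(4,5)] obtain k m1 where 1: "exec c m k m1" "k \<le> b" "m1 SC v = real i"
      "Inv (Suc i) (set_scalar v (real (Suc i)) m1)" unfolding runs_def by blast
    let ?m2 = "set_scalar v (real (Suc i)) m1"
    have "exec ?inc m1 6 ?m2"
      using exec.Assign[of "Work 0" "Num (of_nat v)" "Binop Add (scalar v) (Num 1)" m1] 1(3)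
      by (simp add: set_scalar_def add.commute eval_nat_numeral)
    then have body: "exec (Seq c ?inc) m (k + 6) ?m2" by (rule exec.Seq[OF 1(1)])
    have "runs ?w ((N - Suc i) * (b + 12) + 9) (Inv N) ?m2"
      using Suc i 1(4) by (intro Suc(1)) auto
    then obtain k' m3 where 2: "exec ?w ?m2 k' m3" "k' \<le> (N - Suc i) * (b + 12) + 9" "Inv N m3"
      unfolding runs_def by blast
    have "N - i = Suc (N - Suc i)" using i by simp
    then have "1 + bexp_cost (Less (scalar v) ?e) + (k + 6) + k' \<le> (N - i) * (b + 12) + 9"
      using 1(2) 2(2) by simp
    with exec.WhileTrue[OF true body 2(1)] 2(3) show ?case unfolding runs_def by blast
  qed
  have "exec (Assign SC (Num (of_nat v)) (Num 0)) m 3 (set_scalar v 0 m)"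
    using exec.Assign[of "Work 0" "Num (of_nat v)" "Num 0" m] by (simp add: set_scalar_def eval_nat_numeral)
  then have "runs (Assign SC (Num (of_nat v)) (Num 0)) 3 (\<lambda>m'. m' = set_scalar v 0 m) m"
    unfolding runs_def by blast
  then have "runs (for_loop v ?e c) (3 + (N * (b + 12) + 9)) (Inv N) m"
    unfolding for_loop_def
    by (rule runs_Seq) (use loop[of 0] init in \<open>simp del: of_nat_0 add: of_nat_0[where 'a=real]\<close>)
  then show ?thesis by (rule runs_weaken) (use final in auto)
qed

section \<open>Tables indexed by counts\<close>

text \<open>The state of the queues is stored as the number of services in each cell, where the cell of a
  service is given by its key and its queue length, in base \<open>n + 1\<close>.  As one digit never overflows,
  this number is a plain sum over the services.\<close>

context rounding
begin

definition B :: nat where "B = Suc n"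
definition D :: nat where "D = Suc K ^ 3 * H"
definition N :: nat where "N = B ^ D"

definition cell :: "nat \<Rightarrow> nat \<Rightarrow> nat" where
  "cell j m = key j * H + m"

definition idx :: "nat set \<Rightarrow> queues \<Rightarrow> nat" where
  "idx A q = (\<Sum>j\<in>A. B ^ cell j (q j))"

lemma B_pos: "0 < B" by (simp add: B_def)

lemma H_pos: "2 \<le> H" by (simp add: H_def)

lemma cell_less: "j \<in> {1..n} \<Longrightarrow> m < H \<Longrightarrow> cell j m < D"
proof -
  assume j: "j \<in> {1..n}" and m: "m < H"
  have "cell j m < Suc (key j) * H" using m by (simp add: cell_def)
  also have "\<dots> \<le> D" unfolding D_def using key_less[OF j] by (intro mult_le_mono1) simp
  finally show ?thesis .
qed

lemma cell_eq:
  assumes "cell i l = cell j m" "l < H" "m < H"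
  shows "key i = key j" "l = m"
proof -
  have "cell i l div H = key i" "cell j m div H = key j" "cell i l mod H = l" "cell j m mod H = m"
    using assms(2,3) by (auto simp: cell_def)
  then show "key i = key j" "l = m" using assms(1) by auto
qed

text \<open>There are at most \<open>n\<close> summands, each at most \<open>B ^ (d - 1)\<close>,
  and \<open>n < B\<close>: no carry can occur.\<close>

lemma sum_powers_less:
  assumes "A \<subseteq> {1..n}" "\<And>j. j \<in> A \<Longrightarrow> f j < d"
  shows "(\<Sum>j\<in>A. B ^ f j) < B ^ d"
proof (cases "A = {}")
  case False
  then obtain j where "j \<in> A" by blast
  then have d: "0 < d" using assms(2) by fastforce
  have "(\<Sum>j\<in>A. B ^ f j) \<le> card A * B ^ (d - 1)"
  proof (rule sum_bounded_above[where 'a=nat, simplified])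
    fix j assume "j \<in> A"
    then have "f j \<le> d - 1" using assms(2) by fastforce
    then show "B ^ f j \<le> B ^ (d - 1)" using B_pos by (intro power_increasing) auto
  qed
  also have "card A \<le> card {1..n}" using assms(1) by (intro card_mono) auto
  then have "card A * B ^ (d - 1) < B * B ^ (d - 1)"
    using B_pos by (intro mult_strict_right_mono) (auto simp: B_def)
  also have "\<dots> = B ^ d" using d by (simp add: power_eq_if)
  finally show ?thesis .
qed (use B_pos in simp)

lemma idx_less:
  assumes "A \<subseteq> {1..n}" "\<And>j. q j < H"
  shows "idx A q < N"
  unfolding idx_def N_def using assms by (intro sum_powers_less cell_less) auto

text \<open>Says that digit \<open>d\<close> of \<open>u\<close> in base \<open>B\<close> is
  nonzero, in a form that the machine can test with division and rounding.\<close>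

definition digit :: "nat \<Rightarrow> nat \<Rightarrow> bool" where
  "digit u d \<longleftrightarrow> B * (u div B ^ Suc d) < u div B ^ d"

text \<open>Services in cells below \<open>d\<close> contribute less than \<open>B ^ d\<close> and
  those above \<open>d\<close> a multiple of \<open>B ^ Suc d\<close>, so digit \<open>d\<close> is
  the number of services in that cell.\<close>

lemma digit_idx:
  assumes A: "A \<subseteq> {1..n}"
  shows "digit (idx A q) d \<longleftrightarrow> (\<exists>j\<in>A. cell j (q j) = d)"
proof -
  let ?f = "\<lambda>j. cell j (q j)"
  have fin: "finite A" by (rule finite_subset[OF A]) simp
  define L E U where "L = {j\<in>A. ?f j < d}" and "E = {j\<in>A. ?f j = d}" and "U = {j\<in>A. d < ?f j}"
  have split: "A = L \<union> (E \<union> U)" "L \<inter> (E \<union> U) = {}" "E \<inter> U = {}" and finLEU: "finite L" "finite E" "finite U"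
    using fin by (auto simp: L_def E_def U_def)
  define low where "low = (\<Sum>j\<in>L. B ^ ?f j)"
  define high where "high = (\<Sum>j\<in>U. B ^ (?f j - Suc d))"
  have low: "low < B ^ d"
    unfolding low_def using A by (intro sum_powers_less) (auto simp: L_def)
  have "(\<Sum>j\<in>U. B ^ ?f j) = (\<Sum>j\<in>U. B ^ Suc d * B ^ (?f j - Suc d))"
    by (intro sum.cong refl) (auto simp: U_def simp flip: power_add power_Suc)
  then have U: "(\<Sum>j\<in>U. B ^ ?f j) = B ^ Suc d * high" by (simp only: high_def sum_distrib_left)
  have E: "(\<Sum>j\<in>E. B ^ ?f j) = card E * B ^ d" by (simp add: E_def)
  have "idx A q = low + ((\<Sum>j\<in>E. B ^ ?f j) + (\<Sum>j\<in>U. B ^ ?f j))"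
    unfolding idx_def split(1) low_def using split finLEU by (simp add: sum.union_disjoint)
  also have "\<dots> = low + B ^ d * (card E + B * high)"
    unfolding U E by (simp add: algebra_simps)
  finally have idx: "idx A q = low + B ^ d * (card E + B * high)" .
  then have 1: "idx A q div B ^ d = card E + B * high"
    using low B_pos by (simp add: div_mult_self2)
  have "card E \<le> card {1..n}" using A by (intro card_mono) (auto simp: E_def)
  then have "card E < B" by (simp add: B_def)
  moreover have "idx A q div B ^ Suc d = (idx A q div B ^ d) div B"
    by (simp only: power_Suc2 div_mult2_eq)
  ultimately have 2: "idx A q div B ^ Suc d = high" unfolding 1 by simp
  have "digit (idx A q) d \<longleftrightarrow> 0 < card E"
    unfolding digit_def 1 2 by simp
  also have "\<dots> \<longleftrightarrow> E \<noteq> {}" using finLEU by (simp add: card_gt_0_iff)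
  finally show ?thesis by (auto simp: E_def)
qed

lemma idx_remove:
  assumes "A \<subseteq> {1..n}" "j \<in> A"
  shows "idx A q = B ^ cell j (q j) + idx (A - {j}) q"
  unfolding idx_def by (rule sum.remove[OF finite_subset[OF assms(1)] assms(2)]) simp

lemma idx_cong: "(\<And>j. j \<in> A \<Longrightarrow> q j = q' j) \<Longrightarrow> idx A q = idx A q'"
  unfolding idx_def by (intro sum.cong) auto

lemma idx_insert:
  assumes "A \<subseteq> {1..n}" "j \<notin> A"
  shows "idx (insert j A) q = B ^ cell j (q j) + idx A q"
  unfolding idx_def using finite_subset[OF assms(1)] assms(2) by (subst sum.insert) auto

text \<open>Consecutive lengths of a service occupy adjacent cells, so a join moves one unit to the
  next digit.\<close>

lemma idx_inc:
  assumes "j \<in> {1..n}"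
  shows "idx {1..n} (inc q j) + B ^ cell j (q j) = idx {1..n} q + B ^ Suc (cell j (q j))"
proof -
  have "idx ({1..n} - {j}) (inc q j) = idx ({1..n} - {j}) q" by (rule idx_cong) (simp add: inc_apply)
  then show ?thesis
    using idx_remove[OF order_refl assms, of q] idx_remove[OF order_refl assms, of "inc q j"]
    by (simp add: inc_apply cell_def)
qed

definition addr :: "nat \<Rightarrow> nat \<Rightarrow> nat \<Rightarrow> nat" where
  "addr k u p = (k * N + u) * N + p"

lemma addr_eq:
  assumes "addr k u p = addr k' u' v'" "u < N" "p < N" "u' < N" "v' < N"
  shows "k = k'" "u = u'" "p = v'"
proof -
  have *: "addr k u p div N = k * N + u" "addr k u p mod N = p" if "p < N" for k u p
    using that by (auto simp: addr_def)
  have **: "(k * N + u) div N = k" "(k * N + u) mod N = u" if "u < N" for k u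
    using that by auto
  show "p = v'" using *[of p k u] *[of v' k' u'] assms by simp
  have "k * N + u = k' * N + u'" using *[of p k u] *[of v' k' u'] assms by simp
  then show "k = k'" "u = u'" using **[of u k] **[of u' k'] assms by metis+
qed

text \<open>Only the services of \<open>A\<close> are completed, which avoids a sum over all joint
  outcomes. Adding \<open>worth\<close> has two benefits: for \<open>k = 0\<close> and
  \<open>A = {}\<close> the value is \<open>0\<close>, the initial content of memory, and the
  revenue of a join is contained in a difference of two entries.\<close>

definition part_value :: "nat \<Rightarrow> nat set \<Rightarrow> queues \<Rightarrow> real" where
  "part_value k A q = served x' A (J.val k) q + J.worth q"

lemma part_value_empty: "part_value k {} q = J.val k q + J.worth q"
  by (simp add: part_value_def)

lemma part_value_step:
  assumes A: "A \<subseteq> {1..n}" and j: "j \<in> A"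
  shows "part_value k A q = (if q j = 0 then part_value k (A - {j}) q
     else x' j * (r' j + part_value k (A - {j}) (dec q j)) + (1 - x' j) * part_value k (A - {j}) q)"
proof -
  have fin: "finite (A - {j})" using finite_subset[OF A] by simp
  have e: "A = insert j (A - {j})" using j by auto
  have jn: "j \<in> {1..n}" using A j by auto
  have x: "0 \<le> x' j" "x' j \<le> 1" using J.x_bounds[OF jn] by auto
  have s: "served x' A F q = x' j * served x' (A - {j}) F (dec q j) + (1 - x' j) * served x' (A - {j}) F q" for F
    by (subst e, rule served_insert) (use fin x in auto)
  show ?thesis
  proof (cases "q j = 0")
    case True
    then show ?thesis by (simp add: part_value_def s dec_zero algebra_simps)
  next
    case False
    have "J.worth (dec q j) = J.worth q - r' j"
      unfolding J.worth_def by (rule sum_dec[where q=q, OF jn False])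
    then have w: "J.worth q = r' j + J.worth (dec q j)" by simp
    show ?thesis unfolding part_value_def s w using False by (simp add: algebra_simps)
  qed
qed

text \<open>A table of real numbers represents \<open>part_value\<close> if the entry at the indices of the services
  that still have to be treated and of the remaining ones is correct.\<close>

definition entry_ok :: "(nat \<Rightarrow> real) \<Rightarrow> nat \<Rightarrow> nat set \<Rightarrow> queues \<Rightarrow> bool" where
  "entry_ok h k A q \<longleftrightarrow> h (addr k (idx A q) (idx ({1..n} - A) q)) = part_value k A q"

text \<open>The quantification over all \<open>A\<close> and \<open>q\<close> builds the symmetry
  between services of equal key into the invariant: one entry is shown correct for every state with
  these indices.\<close>

definition table_ok :: "(nat \<Rightarrow> real) \<Rightarrow> nat \<Rightarrow> bool" where
  "table_ok h k \<longleftrightarrow> (\<forall>A q. A \<subseteq> {1..n} \<longrightarrow> (\<forall>j. q j < H) \<longrightarrow> entry_ok h k A q)"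

definition values_ok :: "(nat \<Rightarrow> real) \<Rightarrow> nat \<Rightarrow> bool" where
  "values_ok w k \<longleftrightarrow> (\<forall>q. (\<forall>j. q j < H) \<longrightarrow> w (idx {1..n} q) = J.val k q + J.worth q)"

lemma table_ok_post:
  assumes "table_ok h k" "\<And>j. q j < H"
  shows "h (addr k (idx {1..n} q) 0) = J.post k q + J.worth q"
  using assms unfolding table_ok_def entry_ok_def
  by (auto simp: J.post_def part_value_def idx_def dest!: spec[of _ "{1..n}"])

text \<open>Cells of empty queues store service probability \<open>0\<close>. The update formula
  then needs no case distinction: what it reads for a shortened queue is multiplied by
  \<open>0\<close>.\<close>

definition cells_ok :: "(nat \<Rightarrow> real) \<Rightarrow> (nat \<Rightarrow> real) \<Rightarrow> (nat \<Rightarrow> real) \<Rightarrow> bool" where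
  "cells_ok cr cx ca \<longleftrightarrow> (\<forall>j\<in>{1..n}. \<forall>m<H. cr (cell j m) = r' j \<and>
     cx (cell j m) = (if m = 0 then 0 else x' j) \<and> ca (cell j m) = a' j m)"

text \<open>Invariants of the three nested loops, over \<open>u\<close>, \<open>p\<close> and \<open>d\<close>, that fill block \<open>k\<close> of the table.\<close>

definition upto_u :: "(nat \<Rightarrow> real) \<Rightarrow> nat \<Rightarrow> nat \<Rightarrow> bool" where
  "upto_u h k u \<longleftrightarrow> (\<forall>k'<k. table_ok h k') \<and>
     (\<forall>A q. A \<subseteq> {1..n} \<longrightarrow> (\<forall>j. q j < H) \<longrightarrow> idx A q < u \<longrightarrow> entry_ok h k A q)"

definition upto_p :: "(nat \<Rightarrow> real) \<Rightarrow> nat \<Rightarrow> nat \<Rightarrow> nat \<Rightarrow> bool" where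
  "upto_p h k u p \<longleftrightarrow> upto_u h k u \<and>
     (\<forall>A q. A \<subseteq> {1..n} \<longrightarrow> (\<forall>j. q j < H) \<longrightarrow> idx A q = u \<longrightarrow> idx ({1..n} - A) q < p \<longrightarrow> entry_ok h k A q)"

definition upto_d :: "(nat \<Rightarrow> real) \<Rightarrow> (nat \<Rightarrow> real) \<Rightarrow> nat \<Rightarrow> nat \<Rightarrow> nat \<Rightarrow> nat \<Rightarrow> bool" where
  "upto_d h w k u p d \<longleftrightarrow> upto_p h k u p \<and>
     (\<forall>A q. A \<subseteq> {1..n} \<longrightarrow> (\<forall>j. q j < H) \<longrightarrow> idx A q = u \<longrightarrow> idx ({1..n} - A) q = p \<longrightarrow>
        (if \<exists>j\<in>A. cell j (q j) < d then entry_ok h k A q else h (addr k u p) = w p))"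

lemma upto_p_update:
  assumes "upto_p h k u p" "u < N" "p < N"
  shows "upto_p (h(addr k u p := z)) k u p"
proof -
  have *: "entry_ok (h(addr k u p := z)) k' A q"
    if ok: "entry_ok h k' A q" and A: "A \<subseteq> {1..n}" "\<forall>j. q j < H"
      and ne: "\<not> (k' = k \<and> idx A q = u \<and> idx ({1..n} - A) q = p)" for k' A q
  proof -
    have "idx A q < N" "idx ({1..n} - A) q < N" using A by (auto intro!: idx_less)
    then have "addr k' (idx A q) (idx ({1..n} - A) q) \<noteq> addr k u p"
      using ne assms(2,3) addr_eq by blast
    then show ?thesis using ok by (simp add: entry_ok_def)
  qed
  show ?thesis
    unfolding upto_p_def upto_u_def table_ok_def
  proof (intro conjI allI impI)
    fix k' A and q :: queues assume A: "k' < k" "A \<subseteq> {1..n}" "\<forall>j. q j < H"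
    then have "entry_ok h k' A q" using assms(1) by (simp add: upto_p_def upto_u_def table_ok_def)
    then show "entry_ok (h(addr k u p := z)) k' A q" using A by (intro *) auto
  next
    fix A and q :: queues assume A: "A \<subseteq> {1..n}" "\<forall>j. q j < H" "idx A q < u"
    then have "entry_ok h k A q" using assms(1) by (simp add: upto_p_def upto_u_def)
    then show "entry_ok (h(addr k u p := z)) k A q" using A by (intro *) auto
  next
    fix A and q :: queues assume A: "A \<subseteq> {1..n}" "\<forall>j. q j < H" "idx A q = u" "idx ({1..n} - A) q < p"
    then have "entry_ok h k A q" using assms(1) by (simp add: upto_p_def)
    then show "entry_ok (h(addr k u p := z)) k A q" using A by (intro *) auto
  qed
qed

lemma upto_d_init:
  assumes "upto_p h k u p" "u < N" "p < N"
  shows "upto_d (h(addr k u p := w p)) w k u p 0"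
  using upto_p_update[OF assms] by (simp add: upto_d_def)

text \<open>Any service of \<open>A\<close> in cell \<open>d\<close> may be completed next, and the
  relevant entries have the smaller first index \<open>u - B ^ d\<close>, hence are final. Every
  nonempty cell rewrites the entry, each time with a correct value. For \<open>d = 0\<close> the
  address \<open>i\<close> is arbitrary, but then \<open>q j = 0\<close> and its content is
  multiplied by \<open>0\<close>.\<close>

lemma upto_d_step:
  assumes h: "upto_d h w k u p d" and up: "u < N" "p < N" and c: "cells_ok cr cx ca" and dg: "digit u d"
    and z: "z = cx d * (cr d + h i) + (1 - cx d) * h (addr k (u - B ^ d) (p + B ^ d))"
    and i: "0 < d \<Longrightarrow> i = addr k (u - B ^ d) (p + B ^ (d - 1))"
  shows "upto_d (h(addr k u p := z)) w k u p (Suc d)"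
  unfolding upto_d_def
proof (intro conjI allI impI)
  from h have hp: "upto_p h k u p" by (simp add: upto_d_def)
  then show "upto_p (h(addr k u p := z)) k u p" by (rule upto_p_update[OF _ up])
  fix A and q :: queues assume A: "A \<subseteq> {1..n}" and q: "\<forall>j. q j < H" and u: "idx A q = u" and p: "idx ({1..n} - A) q = p"
  obtain j where j: "j \<in> A" "cell j (q j) = d" using dg digit_idx[OF A, of q d] u by auto
  have jn: "j \<in> {1..n}" using A j by auto
  let ?A = "A - {j}"
  have A': "?A \<subseteq> {1..n}" and c': "{1..n} - ?A = insert j ({1..n} - A)" using A jn by auto
  have u': "idx ?A q = u - B ^ d" "B ^ d \<le> u" "idx ?A q < u"
    using idx_remove[OF A j(1), of q] u j(2) B_pos by auto
  have p': "idx ({1..n} - ?A) q = p + B ^ d"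
    unfolding c' using p j by (subst idx_insert) auto
  have ok: "entry_ok h k ?A q'" if "\<forall>j. q' j < H" "idx ?A q' < u" for q'
    using hp A' that by (auto simp: upto_p_def upto_u_def)
  have e1: "h (addr k (u - B ^ d) (p + B ^ d)) = part_value k ?A q"
    using ok[OF q u'(3)] unfolding entry_ok_def u'(1) p' .
  have cc: "cr d = r' j" "cx d = (if q j = 0 then 0 else x' j)"
    using c q jn j(2) unfolding cells_ok_def by fastforce+
  have "z = part_value k A q"
  proof (cases "q j = 0")
    case True
    then show ?thesis using part_value_step[OF A j(1), of k q] by (simp add: z cc e1)
  next
    case False
    have d: "d = Suc (cell j (q j - 1))" using j(2) False by (simp add: cell_def)
    have u'': "idx ?A (dec q j) = u - B ^ d" using u'(1) by (subst idx_cong[of _ _ q]) (auto simp: dec_apply)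
    have "idx ({1..n} - A) (dec q j) = p" using p j by (subst idx_cong[of _ _ q]) (auto simp: dec_apply)
    then have p'': "idx ({1..n} - ?A) (dec q j) = p + B ^ (d - 1)"
      unfolding c' using j d by (subst idx_insert) (auto simp: dec_apply)
    have "entry_ok h k ?A (dec q j)"
      using q u'(3) u'' u'(1) by (intro ok) (auto simp: dec_apply less_imp_diff_less)
    then have "h i = part_value k ?A (dec q j)"
      unfolding entry_ok_def u'' p'' using i d by simp
    then show ?thesis using False part_value_step[OF A j(1), of k q] by (simp add: z cc e1)
  qed
  then have "entry_ok (h(addr k u p := z)) k A q" using u p by (simp add: entry_ok_def)
  then show "if \<exists>j\<in>A. cell j (q j) < Suc d then entry_ok (h(addr k u p := z)) k A q
       else (h(addr k u p := z)) (addr k u p) = w p"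
    using j by auto
qed

lemma upto_d_skip:
  assumes h: "upto_d h w k u p d" and dg: "\<not> digit u d"
  shows "upto_d h w k u p (Suc d)"
  unfolding upto_d_def
proof (intro conjI allI impI)
  from h show "upto_p h k u p" by (simp add: upto_d_def)
  fix A and q :: queues assume A: "A \<subseteq> {1..n}" "\<forall>j. q j < H" "idx A q = u" "idx ({1..n} - A) q = p"
  have "(\<exists>j\<in>A. cell j (q j) < Suc d) \<longleftrightarrow> (\<exists>j\<in>A. cell j (q j) < d)"
    using dg digit_idx[OF A(1), of q d] A(3) by (auto simp: less_Suc_eq)
  then show "if \<exists>j\<in>A. cell j (q j) < Suc d then entry_ok h k A q else h (addr k u p) = w p"
    using h A by (auto simp: upto_d_def)
qed

text \<open>If \<open>A\<close> is nonempty, the scan has met one of its cells. Otherwise the entry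
  still holds its initial content \<open>w p\<close>, the value with no completion pending.\<close>

lemma upto_d_final:
  assumes h: "upto_d h w k u p D" and w: "values_ok w k"
  shows "upto_p h k u (Suc p)"
  unfolding upto_p_def
proof (intro conjI allI impI)
  from h show "upto_u h k u" by (simp add: upto_d_def upto_p_def)
  fix A and q :: queues assume A: "A \<subseteq> {1..n}" "\<forall>j. q j < H" "idx A q = u" "idx ({1..n} - A) q < Suc p"
  show "entry_ok h k A q"
  proof (cases "idx ({1..n} - A) q = p")
    case True
    show ?thesis
    proof (cases "A = {}")
      case False
      then have "\<exists>j\<in>A. cell j (q j) < D" using A cell_less by blast
      then show ?thesis using h A True by (auto simp: upto_d_def)
    next
      case empty: True
      then have "h (addr k u p) = w p" using h A True by (auto simp: upto_d_def)
      moreover have "w p = J.val k q + J.worth q" using w A(2) True empty by (auto simp: values_ok_def)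
      ultimately show ?thesis using A(3) True by (simp add: entry_ok_def empty part_value_empty)
    qed
  next
    case False
    then show ?thesis using h A by (auto simp: upto_d_def upto_p_def)
  qed
qed

lemma upto_p_0: "upto_u h k u \<Longrightarrow> upto_p h k u 0"
  by (simp add: upto_p_def)

lemma upto_p_final:
  assumes "upto_p h k u N"
  shows "upto_u h k (Suc u)"
  using assms idx_less unfolding upto_p_def upto_u_def by (auto simp: less_Suc_eq)

lemma upto_u_0: "(\<forall>k'<k. table_ok h k') \<Longrightarrow> upto_u h k 0"
  by (simp add: upto_u_def)

lemma upto_u_final:
  assumes "upto_u h k N"
  shows "\<forall>k'<Suc k. table_ok h k'"
  using assms idx_less unfolding upto_u_def table_ok_def by (auto simp: less_Suc_eq)

definition cell_gain :: "(nat \<Rightarrow> real) \<Rightarrow> (nat \<Rightarrow> real) \<Rightarrow> nat \<Rightarrow> nat \<Rightarrow> nat \<Rightarrow> real" where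
  "cell_gain h ca k s d = ca d * (h (addr k (s - B ^ d + B ^ Suc d) 0) - h (addr k s 0))"

text \<open>The entries include \<open>worth\<close>, so their difference already contains the
  revenue. If \<open>a'\<close> vanishes, the index of the longer queue may denote no state in
  range, but the factor \<open>0\<close> cancels whatever is read; otherwise the longer queue is
  still below \<open>H\<close>.\<close>

lemma cell_gain_eq:
  assumes h: "table_ok h k" and c: "cells_ok cr cx ca" and q: "\<And>j. q j < H" and j: "j \<in> {1..n}"
  shows "cell_gain h ca k (idx {1..n} q) (cell j (q j)) = J.gain (J.post k) q j"
proof -
  have ca: "ca (cell j (q j)) = a' j (q j)" using c q j by (auto simp: cells_ok_def)
  show ?thesis
  proof (cases "a' j (q j) = 0")
    case True
    then show ?thesis by (simp add: cell_gain_def ca J.gain_def)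
  next
    case False
    then have "Suc (q j) < H" by (rule joinable_bounded[OF j])
    then have q': "inc q j i < H" for i using q by (simp add: inc_apply)
    have "B ^ cell j (q j) \<le> idx {1..n} q" using idx_remove[OF order_refl j, of q] by simp
    then have "idx {1..n} q - B ^ cell j (q j) + B ^ Suc (cell j (q j)) = idx {1..n} (inc q j)"
      using idx_inc[OF j, of q] by simp
    then show ?thesis
      unfolding cell_gain_def ca J.gain_def
      using table_ok_post[OF h q] table_ok_post[OF h q'] J.worth_inc[OF j, of q] by simp
  qed
qed

text \<open>States are visited by index, without knowing the queues behind it. So the program
  maximizes over nonempty cells, and the claim is made for every \<open>q\<close> with this index;
  for an index that encodes no state only \<open>0 \<le> best\<close> is claimed.\<close>

definition upto_gain :: "nat \<Rightarrow> nat \<Rightarrow> nat \<Rightarrow> real \<Rightarrow> bool" where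
  "upto_gain k s d best \<longleftrightarrow> 0 \<le> best \<and> (\<forall>q. (\<forall>j. q j < H) \<longrightarrow> idx {1..n} q = s \<longrightarrow>
     (\<forall>j\<in>{1..n}. cell j (q j) < d \<longrightarrow> J.gain (J.post k) q j \<le> best) \<and>
     (best = 0 \<or> (\<exists>j\<in>{1..n}. best = J.gain (J.post k) q j)))"

lemma upto_gain_0: "upto_gain k s 0 0"
  by (simp add: upto_gain_def)

lemma upto_gain_step:
  assumes h: "table_ok h k" and c: "cells_ok cr cx ca" and g: "upto_gain k s d best"
    and b: "best' = (if digit s d then max best (cell_gain h ca k s d) else best)"
  shows "upto_gain k s (Suc d) best'"
proof -
  have "(\<forall>j\<in>{1..n}. cell j (q j) < Suc d \<longrightarrow> J.gain (J.post k) q j \<le> best') \<and>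
     (best' = 0 \<or> (\<exists>j\<in>{1..n}. best' = J.gain (J.post k) q j))"
    if q: "\<forall>j. q j < H" and s: "idx {1..n} q = s" for q
  proof -
    have g1: "\<And>j. j \<in> {1..n} \<Longrightarrow> cell j (q j) < d \<Longrightarrow> J.gain (J.post k) q j \<le> best"
      and g2: "best = 0 \<or> (\<exists>j\<in>{1..n}. best = J.gain (J.post k) q j)"
      using g q s by (auto simp: upto_gain_def)
    have cg: "cell_gain h ca k s d = J.gain (J.post k) q j" if "j \<in> {1..n}" "cell j (q j) = d" for j
      using cell_gain_eq[OF h c, of q j] q s that by auto
    have dg: "digit s d \<longleftrightarrow> (\<exists>j\<in>{1..n}. cell j (q j) = d)"
      using digit_idx[OF order_refl, of q d] s by simp
    have le: "best \<le> best'" by (simp add: b)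
    have 1: "J.gain (J.post k) q j \<le> best'" if j: "j \<in> {1..n}" "cell j (q j) < Suc d" for j
    proof (cases "cell j (q j) = d")
      case True
      then have "digit s d" using dg j by auto
      then show ?thesis using cg[OF j(1) True] by (simp add: b)
    next
      case False
      then show ?thesis using g1[OF j(1)] j le by simp
    qed
    have 2: "best' = 0 \<or> (\<exists>j\<in>{1..n}. best' = J.gain (J.post k) q j)"
    proof (cases "digit s d \<and> best < cell_gain h ca k s d")
      case True
      then obtain j where "j \<in> {1..n}" "cell j (q j) = d" using dg by auto
      then show ?thesis using True cg[of j] by (auto simp: b)
    next
      case False
      then have "best' = best" by (auto simp: b)
      then show ?thesis using g2 by simp
    qed
    from 1 2 show ?thesis by blast
  qed
  moreover have "0 \<le> best'" using g by (auto simp: upto_gain_def b)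
  ultimately show ?thesis by (auto simp: upto_gain_def)
qed

lemma upto_gain_final:
  assumes g: "upto_gain k s D best" and q: "\<And>j. q j < H" and s: "idx {1..n} q = s"
  shows "best = topgain (J.gain (J.post k) q) n"
proof (rule antisym)
  have g1: "\<And>j. j \<in> {1..n} \<Longrightarrow> J.gain (J.post k) q j \<le> best"
    and g2: "best = 0 \<or> (\<exists>j\<in>{1..n}. best = J.gain (J.post k) q j)" and g0: "0 \<le> best"
    using g q s cell_less by (auto simp: upto_gain_def)
  show "best \<le> topgain (J.gain (J.post k) q) n"
    using g2 topgain_nonneg topgain_ge by metis
  show "topgain (J.gain (J.post k) q) n \<le> best"
    using topgain_cases[of "J.gain (J.post k) q" n] g0 g1 by auto
qed

lemma values_ok_Suc:
  assumes h: "table_ok h k" and w: "\<And>q. (\<And>j. q j < H) \<Longrightarrow>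
     w (idx {1..n} q) = h (addr k (idx {1..n} q) 0) + arriv_rev I k * topgain (J.gain (J.post k) q) n"
  shows "values_ok w (Suc k)"
  unfolding values_ok_def using w table_ok_post[OF h] by (auto simp: J.val_Suc)

end

section \<open>The programs\<close>

abbreviation plus_exp (infixl ".+" 65) where "e .+ e' \<equiv> Binop Add e e'"
abbreviation minus_exp (infixl ".-" 65) where "e .- e' \<equiv> Binop Sub e e'"
abbreviation times_exp (infixl ".*" 70) where "e .* e' \<equiv> Binop Mul e e'"
abbreviation divide_exp (infixl ".'/" 70) where "e ./ e' \<equiv> Binop Div e e'"
abbreviation seq_com (infixr ";;" 55) where "c ;; c' \<equiv> Seq c c'"
abbreviation set_com (infix "::=" 60) where "i ::= e \<equiv> Assign SC (Num (of_nat i)) e"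
abbreviation param :: "nat \<Rightarrow> exp" where "param i \<equiv> Get Param (Num (of_nat i))"

text \<open>Array \<open>Work 0\<close> holds scalars: 0--9 are \<open>depth\<close>, \<open>grain\<close>, \<open>ln \<gamma>\<close>, \<open>cutoff\<close>, \<open>Suc K\<close>, \<open>H\<close>, \<open>B\<close>, \<open>N\<close>,
  \<open>D\<close>, \<open>rmax\<close>; the others are loop counters and temporaries.  \<open>Work 1\<close> holds the first cell of each
  service, \<open>Work 2\<close>--\<open>4\<close> the revenue, service probability and joining probability of each cell,
  \<open>Work 5\<close> the table of \<open>part_value\<close> and \<open>Work 6\<close> that of the current values.\<close>

definition exp_exp :: "exp \<Rightarrow> exp" where
  "exp_exp e = Binop Pow (param 3) (e ./ scalar 2)"

definition pw :: "exp \<Rightarrow> exp" where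
  "pw e = Binop Pow (scalar 6) e"

definition addr_exp :: "exp \<Rightarrow> exp \<Rightarrow> exp" where
  "addr_exp e e' = (scalar 21 .* scalar 7 .+ e) .* scalar 7 .+ e'"

definition digit_bexp :: "bexp" where
  "digit_bexp = Less (scalar 6 .* Unop Floor (scalar 22 ./ pw (scalar 24 .+ Num 1)))
                     (Unop Floor (scalar 22 ./ pw (scalar 24)))"

definition gain_exp :: "exp \<Rightarrow> exp" where
  "gain_exp e = Get (Work 4) (scalar 24) .*
     (Get (Work 5) (addr_exp (e .- pw (scalar 24) .+ pw (scalar 24 .+ Num 1)) (Num 0))
      .- Get (Work 5) (addr_exp e (Num 0)))"

definition constants_com :: com where
  "constants_com =
     (0 ::= (param 4 .+ param 5 .+ param 6 .+ Num 1) .* Unop Ln (Num 5 .* param 1 ./ param 2);;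
      1 ::= Num 5 .* (Num 1 .+ Num 2 .* scalar 0) ./ param 2;;
      2 ::= Unop Ln (param 3);;
      3 ::= Num 2 .* scalar 0 ./ scalar 2;;
      4 ::= Unop Floor (scalar 0 .* scalar 1) .+ Num 2;;
      5 ::= Unop Floor (scalar 3) .+ Num 2;;
      6 ::= param 0 .+ Num 1;;
      8 ::= scalar 4 .* scalar 4 .* scalar 4 .* scalar 5;;
      7 ::= pw (scalar 8);;
      9 ::= Num 0)"

definition rmax_body :: com where
  "rmax_body = If (Less (scalar 9) (Get Rev (scalar 10 .+ Num 1))) (9 ::= Get Rev (scalar 10 .+ Num 1)) Skip"

definition revenue_com :: com where
  "revenue_com = If (Less (scalar 12) (scalar 9 .* exp_exp (Num 0 .- scalar 0)))
     (13 ::= Num 0;; 14 ::= scalar 4 .- Num 1)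
     (14 ::= Unop Floor ((Num 0 .- Unop Ln (scalar 12 ./ scalar 9)) .* scalar 1);;
      13 ::= scalar 9 .* exp_exp (Num 0 .- (scalar 14 .+ Num 1) ./ scalar 1))"

definition key_com :: com where
  "key_com =
     (15 ::= Unop Floor ((Num 0 .- Unop Ln (Get Attract (scalar 11))) .* scalar 1);;
      16 ::= exp_exp (Num 0 .- (scalar 15 .+ Num 1) ./ scalar 1);;
      17 ::= Unop Floor ((Num 0 .- Unop Ln (Get Serv (scalar 11))) .* scalar 1);;
      18 ::= exp_exp (Num 0 .- (scalar 17 .+ Num 1) ./ scalar 1);;
      19 ::= (scalar 14 .+ scalar 4 .* (scalar 15 .+ scalar 4 .* scalar 17)) .* scalar 5;;
      Assign (Work 1) (scalar 11) (scalar 19))"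

definition round_com :: com where
  "round_com = (11 ::= scalar 10 .+ Num 1;; 12 ::= Get Rev (scalar 11);; revenue_com;; key_com)"

definition level_body :: com where
  "level_body =
     (Assign (Work 2) (scalar 19 .+ scalar 20) (scalar 13);;
      If (Less (scalar 20) (Num 1)) (Assign (Work 3) (scalar 19 .+ scalar 20) (Num 0))
         (Assign (Work 3) (scalar 19 .+ scalar 20) (scalar 18));;
      If (Less (scalar 20) (scalar 3 .* scalar 18))
         (Assign (Work 4) (scalar 19 .+ scalar 20)
            (scalar 16 .* exp_exp (Num 0 .- scalar 20 ./ scalar 18 .* scalar 2)))
         (Assign (Work 4) (scalar 19 .+ scalar 20) (Num 0)))"

definition service_com :: com where
  "service_com = (round_com;; for_loop 20 (scalar 5) level_body)"

definition part_body :: com where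
  "part_body = If digit_bexp
     (Assign (Work 5) (addr_exp (scalar 22) (scalar 23))
       (Get (Work 3) (scalar 24) .* (Get (Work 2) (scalar 24) .+
          Get (Work 5) (addr_exp (scalar 22 .- pw (scalar 24)) (scalar 23 .+ pw (scalar 24 .- Num 1))))
        .+ (Num 1 .- Get (Work 3) (scalar 24)) .*
          Get (Work 5) (addr_exp (scalar 22 .- pw (scalar 24)) (scalar 23 .+ pw (scalar 24)))))
     Skip"

definition init_part :: com where
  "init_part = Assign (Work 5) (addr_exp (scalar 22) (scalar 23)) (Get (Work 6) (scalar 23))"

definition entry_com :: com where
  "entry_com = (init_part;; for_loop 24 (scalar 8) part_body)"

definition part_com :: com where
  "part_com = for_loop 22 (scalar 7) (for_loop 23 (scalar 7) entry_com)"

definition gain_body :: com where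
  "gain_body = If digit_bexp
     (26 ::= gain_exp (scalar 22);; If (Less (scalar 25) (scalar 26)) (25 ::= scalar 26) Skip) Skip"

definition set_value :: com where
  "set_value = Assign (Work 6) (scalar 22) (Get (Work 5) (addr_exp (scalar 22) (Num 0)) .+
     Get Arriv (param 1 .- scalar 21) .* scalar 25)"

definition value_com :: com where
  "value_com = for_loop 22 (scalar 7) (25 ::= Num 0;; for_loop 24 (scalar 8) gain_body;; set_value)"

text \<open>Without services the time allowed is \<open>C * T\<close>, whatever the accuracy; the
  initial test keeps to it.\<close>

definition prep_com :: com where
  "prep_com = If (Less (param 0) (Num 1)) Skip
     (constants_com;;
      for_loop 10 (param 0) rmax_body;;
      for_loop 10 (param 0) service_com;;
      for_loop 21 (param 1) (part_com;; value_com))"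

definition cell_exp :: exp where
  "cell_exp = Get (Work 1) (scalar 22 .+ Num 1) .+ Get Queue (scalar 22 .+ Num 1)"

definition period_com :: com where
  "period_com = (21 ::= param 1 .- Get Obs (Num 0))"

definition index_body :: com where
  "index_body = (27 ::= scalar 27 .+ pw cell_exp)"

definition advice_body :: com where
  "advice_body =
     (24 ::= cell_exp;;
      26 ::= gain_exp (scalar 27);;
      If (Less (scalar 25) (scalar 26)) (25 ::= scalar 26;; Assign Rec (Num 0) (scalar 22 .+ Num 1)) Skip)"

text \<open>The index is recomputed from the observed queues and the gains are compared service by
  service, since the answer must name a service, not a cell. Of the past only the period number is
  used, and the cost is linear in \<open>n\<close>.\<close>

definition eval_com :: com where
  "eval_com = If (Less (param 0) (Num 1)) Skip
     (period_com;;
      27 ::= Num 0;;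
      for_loop 22 (param 0) index_body;;
      25 ::= Num 0;;
      Assign Rec (Num 0) (Num 0);;
      for_loop 22 (param 0) advice_body)"

definition cost_d :: "nat \<Rightarrow> nat" where
  "cost_d d = steps_of init_part + Suc d * (steps_of part_body + 12)"

definition cost_v :: "nat \<Rightarrow> nat" where
  "cost_v d = 3 + (Suc d * (steps_of gain_body + 12) + steps_of set_value)"

definition cost_k :: "nat \<Rightarrow> nat \<Rightarrow> nat" where
  "cost_k N d = Suc N * (Suc N * (cost_d d + 12) + 12) + Suc N * (cost_v d + 12)"

section \<open>Correctness of the programs\<close>

context rounding
begin

definition env :: "memory \<Rightarrow> bool" where
  "env m \<longleftrightarrow> m Param 0 = real n \<and> m Param 1 = real T \<and>
     m SC 6 = real B \<and> m SC 7 = real N \<and> m SC 8 = real D \<and>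
     (\<forall>j\<in>{1..n}. m (Work 1) j = real (key j * H)) \<and>
     cells_ok (m (Work 2)) (m (Work 3)) (m (Work 4)) \<and>
     (\<forall>k<T. m Arriv (T - k) = arriv_rev I k)"

lemma env_upd [simp]:
  "i \<notin> {6, 7, 8} \<Longrightarrow> env (set_scalar i x m) \<longleftrightarrow> env m"
  "s 6 = m SC 6 \<Longrightarrow> s 7 = m SC 7 \<Longrightarrow> s 8 = m SC 8 \<Longrightarrow> env (m(Work 0 := s)) \<longleftrightarrow> env m"
  "env (m(Work 5 := h)) \<longleftrightarrow> env m" "env (m(Work 6 := h)) \<longleftrightarrow> env m" "env (m(Rec := h)) \<longleftrightarrow> env m"
  by (simp_all add: env_def)

lemma pw_val:
  assumes "m SC 6 = real B" "exp_val e m = real d"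
  shows "exp_val (pw e) m = real (B ^ d)"
  using assms B_pos by (simp add: pw_def powr_realpow)

lemma addr_val:
  assumes "m SC 7 = real N" "m SC 21 = real k" "exp_val e m = real u" "exp_val e' m = real p"
  shows "index (exp_val (addr_exp e e') m) = addr k u p"
proof -
  have "exp_val (addr_exp e e') m = real (addr k u p)"
    using assms by (simp add: addr_exp_def addr_def)
  then show ?thesis by simp
qed

lemma digit_val:
  assumes "m SC 6 = real B" "m SC 22 = real u" "m SC 24 = real d"
  shows "bexp_val digit_bexp m \<longleftrightarrow> digit u d"
proof -
  define b b' where "b = B ^ d" and "b' = B ^ Suc d"
  have "exp_val (pw (scalar 24)) m = real b" "exp_val (pw (scalar 24 .+ Num 1)) m = real b'"
    unfolding b_def b'_def by (rule pw_val; use assms in simp)+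
  then have "bexp_val digit_bexp m \<longleftrightarrow> real B * real (u div b') < real (u div b)"
    using assms by (simp add: digit_bexp_def floor_divide_of_nat_eq)
  then show ?thesis unfolding digit_def b_def b'_def by (simp only: of_nat_less_iff flip: of_nat_mult)
qed

lemma digit_le: "digit u d \<Longrightarrow> B ^ d \<le> u"
  unfolding digit_def by (metis div_less not_less not_less_zero)

lemma gain_val:
  assumes "m SC 6 = real B" "m SC 7 = real N" "m SC 21 = real k" "m SC 24 = real d"
    "exp_val e m = real s" "B ^ d \<le> s"
  shows "exp_val (gain_exp e) m = cell_gain (m (Work 5)) (m (Work 4)) k s d"
proof -
  have pw: "exp_val (pw (scalar 24)) m = real (B ^ d)" "exp_val (pw (scalar 24 .+ Num 1)) m = real (B ^ Suc d)"
    by (rule pw_val; use assms in simp)+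
  have "exp_val (e .- pw (scalar 24) .+ pw (scalar 24 .+ Num 1)) m = real (s - B ^ d + B ^ Suc d)"
    using assms(5,6) pw by (simp add: of_nat_diff)
  then have "index (exp_val (addr_exp (e .- pw (scalar 24) .+ pw (scalar 24 .+ Num 1)) (Num 0)) m) =
      addr k (s - B ^ d + B ^ Suc d) 0"
    by (intro addr_val) (use assms in auto)
  moreover have "index (exp_val (addr_exp e (Num 0)) m) = addr k s 0"
    by (intro addr_val) (use assms in auto)
  ultimately show ?thesis using assms(4) by (simp add: gain_exp_def cell_gain_def)
qed

lemma part_body_result:
  assumes "m SC 6 = real B" "m SC 7 = real N"
    and s: "m SC 21 = real k" "m SC 22 = real u" "m SC 23 = real p" "m SC 24 = real d"
  obtains "\<not> digit u d" "result part_body m = m"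
    | z i where "digit u d" "result part_body m = m(Work 5 := (m (Work 5))(addr k u p := z))"
       "z = m (Work 3) d * (m (Work 2) d + m (Work 5) i) + (1 - m (Work 3) d) * m (Work 5) (addr k (u - B ^ d) (p + B ^ d))"
       "0 < d \<longrightarrow> i = addr k (u - B ^ d) (p + B ^ (d - 1))"
proof (cases "digit u d")
  case False
  then have "result part_body m = m" by (simp add: part_body_def digit_val[where m=m, OF assms(1) s(2,4)])
  then show ?thesis using that False by blast
next
  case True
  let ?i = "index (exp_val (addr_exp (scalar 22 .- pw (scalar 24)) (scalar 23 .+ pw (scalar 24 .- Num 1))) m)"
  have pw: "exp_val (pw (scalar 24)) m = real (B ^ d)" by (rule pw_val) (use assms in auto)
  have u: "exp_val (scalar 22 .- pw (scalar 24)) m = real (u - B ^ d)"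
    using digit_le[OF True] pw s by (simp add: of_nat_diff)
  have 1: "index (exp_val (addr_exp (scalar 22) (scalar 23)) m) = addr k u p"
    by (rule addr_val) (use assms in auto)
  have 2: "index (exp_val (addr_exp (scalar 22 .- pw (scalar 24)) (scalar 23 .+ pw (scalar 24))) m) = addr k (u - B ^ d) (p + B ^ d)"
    by (rule addr_val) (use assms u pw in auto)
  have 3: "?i = addr k (u - B ^ d) (p + B ^ (d - 1))" if "0 < d"
  proof (rule addr_val)
    have "exp_val (pw (scalar 24 .- Num 1)) m = real (B ^ (d - 1))"
      by (rule pw_val) (use assms that in \<open>auto simp: of_nat_diff\<close>)
    then show "exp_val (scalar 23 .+ pw (scalar 24 .- Num 1)) m = real (p + B ^ (d - 1))" using s by simp
  qed (use assms u in auto)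
  show ?thesis
  proof (rule that(2)[of _ ?i])
    show "result part_body m = m(Work 5 := (m (Work 5))(addr k u p :=
       m (Work 3) d * (m (Work 2) d + m (Work 5) ?i) + (1 - m (Work 3) d) * m (Work 5) (addr k (u - B ^ d) (p + B ^ d))))"
      using True digit_val[where m=m, OF assms(1) s(2,4)] 1 2 s by (simp add: part_body_def)
  qed (use True 3 in auto)
qed

lemma part_loop:
  assumes m: "env m" "m SC 21 = real k" "m SC 22 = real u" "m SC 23 = real p"
    and up: "u < N" "p < N" and h: "upto_d (m (Work 5)) (m (Work 6)) k u p 0"
  shows "runs (for_loop 24 (scalar 8) part_body) (Suc D * (steps_of part_body + 12))
     (\<lambda>m'. env m' \<and> m' SC 21 = real k \<and> m' SC 22 = real u \<and> m' SC 23 = real p \<and>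
        m' (Work 6) = m (Work 6) \<and> upto_d (m' (Work 5)) (m (Work 6)) k u p D) m"
proof -
  define w where "w = m (Work 6)"
  define Inv where "Inv d m' \<longleftrightarrow> env m' \<and> m' SC 21 = real k \<and> m' SC 22 = real u \<and> m' SC 23 = real p \<and>
        m' (Work 6) = w \<and> upto_d (m' (Work 5)) w k u p d" for d m'
  show ?thesis
  proof (rule runs_for[where Inv=Inv])
    show "m' SC 8 = real D" if "Inv i m'" for i m' using that by (simp add: Inv_def env_def)
  next
    fix d m' assume d: "Inv d m'" "m' SC 24 = real d"
    have e: "m' SC 6 = real B" "m' SC 7 = real N" "cells_ok (m' (Work 2)) (m' (Work 3)) (m' (Work 4))"
      and s: "m' SC 21 = real k" "m' SC 22 = real u" "m' SC 23 = real p"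
      and h: "upto_d (m' (Work 5)) w k u p d"
      using d by (auto simp: Inv_def env_def)
    show "runs part_body (steps_of part_body) (after 24 d Inv) m'"
    proof (rule runs_loop_free)
      show "loop_free part_body" by (simp add: part_body_def)
      show "after 24 d Inv (result part_body m')"
        using e(1,2) s d(2)
      proof (cases rule: part_body_result)
        case 1
        then show ?thesis using d upto_d_skip[OF h 1(1)] by (simp add: Inv_def)
      next
        case (2 z i)
        define h' where "h' = (m' (Work 5))(addr k u p := z)"
        from upto_d_step[OF h up e(3) 2(1,3)] 2(4)
        have "upto_d h' w k u p (Suc d)" unfolding h'_def by blast
        then show ?thesis using d 2(2)[folded h'_def] by (simp add: Inv_def)
      qed
    qed
  qed (use m h in \<open>simp_all add: Inv_def w_def\<close>)
qed

lemma p_loop: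
  assumes m: "env m" "m SC 21 = real k" "m SC 22 = real u"
    and u: "u < N" and h: "upto_u (m (Work 5)) k u" and w: "values_ok (m (Work 6)) k"
  shows "runs (for_loop 23 (scalar 7) entry_com) (Suc N * (cost_d D + 12))
     (\<lambda>m'. env m' \<and> m' SC 21 = real k \<and> m' SC 22 = real u \<and>
        m' (Work 6) = m (Work 6) \<and> upto_u (m' (Work 5)) k (Suc u)) m"
proof -
  define w where "w = m (Work 6)"
  define Inv where "Inv p m' \<longleftrightarrow> env m' \<and> m' SC 21 = real k \<and> m' SC 22 = real u \<and>
        m' (Work 6) = w \<and> upto_p (m' (Work 5)) k u p" for p m'
  show ?thesis
  proof (rule runs_for[where Inv=Inv])
    show "m' SC 7 = real N" if "Inv i m'" for i m' using that by (simp add: Inv_def env_def)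
  next
    fix p m' assume p: "p < N" "Inv p m'" "m' SC 23 = real p"
    define R where "R m'' \<longleftrightarrow> env m'' \<and> m'' SC 21 = real k \<and> m'' SC 22 = real u \<and> m'' SC 23 = real p \<and>
      m'' (Work 6) = w \<and> upto_d (m'' (Work 5)) w k u p 0" for m''
    show "runs entry_com (cost_d D)
       (after 23 p Inv) m'"
      unfolding cost_d_def entry_com_def
    proof (rule runs_Seq[where R=R])
      have "index (exp_val (addr_exp (scalar 22) (scalar 23)) m') = addr k u p"
        by (rule addr_val) (use p in \<open>auto simp: Inv_def env_def\<close>)
      then have "result init_part m' = m'(Work 5 := (m' (Work 5))(addr k u p := w p))"
        using p by (simp add: init_part_def Inv_def)
      then have "R (result init_part m')"
        using p upto_d_init[of "m' (Work 5)" k u p w] u by (simp add: R_def Inv_def)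
      then show "runs init_part (steps_of init_part) R m'"
        by (intro runs_loop_free) (simp_all add: init_part_def)
    next
      fix m1 assume R: "R m1"
      show "runs (for_loop 24 (scalar 8) part_body) (Suc D * (steps_of part_body + 12))
          (after 23 p Inv) m1"
      proof (rule runs_weaken[OF part_loop[of m1 k u p] order_refl])
        fix m2 assume "env m2 \<and> m2 SC 21 = real k \<and> m2 SC 22 = real u \<and> m2 SC 23 = real p \<and>
        m2 (Work 6) = m1 (Work 6) \<and> upto_d (m2 (Work 5)) (m1 (Work 6)) k u p D"
        then show "after 23 p Inv m2"
          using R assms(6) upto_d_final[of "m2 (Work 5)" w k u p] by (simp add: Inv_def R_def w_def)
      qed (use R u p in \<open>auto simp: R_def\<close>)
    qed
  qed (use m h in \<open>simp_all add: Inv_def w_def upto_p_0 upto_p_final\<close>)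
qed

lemma part_com_runs:
  assumes m: "env m" "m SC 21 = real k" and h: "\<forall>k'<k. table_ok (m (Work 5)) k'"
    and w: "values_ok (m (Work 6)) k"
  shows "runs part_com (Suc N * (Suc N * (cost_d D + 12) + 12))
     (\<lambda>m'. env m' \<and> m' SC 21 = real k \<and> (\<forall>k'<Suc k. table_ok (m' (Work 5)) k')) m"
proof -
  define w where "w = m (Work 6)"
  define Inv where "Inv u m' \<longleftrightarrow> env m' \<and> m' SC 21 = real k \<and>
        m' (Work 6) = w \<and> upto_u (m' (Work 5)) k u" for u m'
  show ?thesis
    unfolding part_com_def
  proof (rule runs_for[where Inv=Inv])
    show "m' SC 7 = real N" if "Inv i m'" for i m' using that by (simp add: Inv_def env_def)
  next
    fix u m' assume u: "u < N" "Inv u m'" "m' SC 22 = real u"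
    show "runs (for_loop 23 (scalar 7) entry_com) (Suc N * (cost_d D + 12))
       (after 22 u Inv) m'"
      by (rule runs_weaken[OF p_loop[of m' k u] order_refl]) (use u assms(4) in \<open>auto simp: Inv_def w_def\<close>)
  qed (use m h upto_u_final in \<open>auto simp: Inv_def w_def upto_u_0\<close>)
qed

lemma gain_loop:
  assumes m: "env m" "m SC 21 = real k" "m SC 22 = real u" "m SC 25 = 0"
    and h: "\<forall>k'<Suc k. table_ok (m (Work 5)) k'"
  shows "runs (for_loop 24 (scalar 8) gain_body) (Suc D * (steps_of gain_body + 12))
     (\<lambda>m'. env m' \<and> m' SC 21 = real k \<and> m' SC 22 = real u \<and> m' (Work 5) = m (Work 5) \<and>
        m' (Work 6) = m (Work 6) \<and> upto_gain k u D (m' SC 25)) m"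
proof -
  define h ca w where "h = m (Work 5)" and "ca = m (Work 4)" and "w = m (Work 6)"
  define Inv where "Inv d m' \<longleftrightarrow> env m' \<and> m' SC 21 = real k \<and> m' SC 22 = real u \<and>
        m' (Work 4) = ca \<and> m' (Work 5) = h \<and> m' (Work 6) = w \<and> upto_gain k u d (m' SC 25)" for d m'
  show ?thesis
  proof (rule runs_for[where Inv=Inv])
    show "m' SC 8 = real D" if "Inv i m'" for i m' using that by (simp add: Inv_def env_def)
  next
    fix d m' assume d: "Inv d m'" "m' SC 24 = real d"
    have e: "m' SC 6 = real B" "m' SC 7 = real N" "cells_ok (m' (Work 2)) (m' (Work 3)) ca"
      and s: "m' SC 21 = real k" "m' SC 22 = real u"
      and g: "upto_gain k u d (m' SC 25)"
      using d by (auto simp: Inv_def env_def)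
    have tab: "table_ok h k" using assms(5) by (simp add: h_def)
    note dg = digit_val[where m=m', OF e(1) s(2) d(2)]
    show "runs gain_body (steps_of gain_body) (after 24 d Inv) m'"
    proof (rule runs_loop_free)
      show "loop_free gain_body" by (simp add: gain_body_def)
      show "after 24 d Inv (result gain_body m')"
      proof (cases "digit u d")
        case False
        then have "upto_gain k u (Suc d) (m' SC 25)"
          by (intro upto_gain_step[OF tab e(3) g]) simp
        then show ?thesis using d False by (simp add: gain_body_def dg Inv_def)
      next
        case True
        have "exp_val (gain_exp (scalar 22)) m' = cell_gain (m' (Work 5)) (m' (Work 4)) k u d"
          by (rule gain_val) (use e s d digit_le[OF True] in auto)
        then have c: "exp_val (gain_exp (scalar 22)) m' = cell_gain h ca k u d" using d by (simp add: Inv_def)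
        have "upto_gain k u (Suc d) (max (m' SC 25) (cell_gain h ca k u d))"
          by (rule upto_gain_step[OF tab e(3) g]) (use True in simp)
        then have g': "upto_gain k u (Suc d) (if m' SC 25 < exp_val (gain_exp (scalar 22)) m'
            then exp_val (gain_exp (scalar 22)) m' else m' SC 25)"
        proof -
          have "max y z = (if y < z then z else y)" for y z :: real by (simp add: max_def)
          then show ?thesis using \<open>upto_gain k u (Suc d) (max _ _)\<close> by (simp only: c)
        qed
        show ?thesis using d True g'
          by (simp add: gain_body_def dg Inv_def split: if_splits)
      qed
    qed
  qed (use m in \<open>simp_all add: Inv_def h_def ca_def w_def upto_gain_0\<close>)
qed

lemma value_com_runs:
  assumes m: "env m" "m SC 21 = real k" "k < T" and h: "\<forall>k'<Suc k. table_ok (m (Work 5)) k'"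
  shows "runs value_com (Suc N * (cost_v D + 12))
     (\<lambda>m'. env m' \<and> m' SC 21 = real k \<and> (\<forall>k'<Suc k. table_ok (m' (Work 5)) k') \<and>
        values_ok (m' (Work 6)) (Suc k)) m"
proof -
  define h where "h = m (Work 5)"
  have tab: "table_ok h k" using assms(4) by (simp add: h_def)
  define val_ok where "val_ok w q \<longleftrightarrow> w (idx {1..n} q) = h (addr k (idx {1..n} q) 0) +
      arriv_rev I k * topgain (J.gain (J.post k) q) n" for w q
  define Inv where "Inv u m' \<longleftrightarrow> env m' \<and> m' SC 21 = real k \<and> m' (Work 5) = h \<and>
     (\<forall>q. (\<forall>j. q j < H) \<longrightarrow> idx {1..n} q < u \<longrightarrow> val_ok (m' (Work 6)) q)" for u m'
  show ?thesis
    unfolding value_com_def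
  proof (rule runs_for[where Inv=Inv])
    show "m' SC 7 = real N" if "Inv i m'" for i m' using that by (simp add: Inv_def env_def)
  next
    fix u m' assume u: "Inv u m'" "m' SC 22 = real u"
    define w where "w = m' (Work 6)"
    let ?m1 = "set_scalar 25 0 m'"
    define R where "R m'' \<longleftrightarrow> env m'' \<and> m'' SC 21 = real k \<and> m'' SC 22 = real u \<and> m'' (Work 5) = h \<and>
        m'' (Work 6) = w \<and> upto_gain k u D (m'' SC 25)" for m''
    have "steps_of (25 ::= Num 0) = 3" by simp
    moreover have "runs (25 ::= Num 0) (steps_of (25 ::= Num 0)) (\<lambda>m''. m'' = ?m1) m'"
      by (rule runs_loop_free) (auto simp: set_scalar_def)
    ultimately have 1: "runs (25 ::= Num 0) 3 (\<lambda>m''. m'' = ?m1) m'" by (simp only:)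
    have 2: "runs (for_loop 24 (scalar 8) gain_body) (Suc D * (steps_of gain_body + 12)) R ?m1"
      by (rule runs_weaken[OF gain_loop[of ?m1 k u] order_refl]) (use u assms(4) in \<open>auto simp: R_def Inv_def w_def h_def\<close>)
    have 3: "runs set_value (steps_of set_value) (after 22 u Inv) m2"
      if R: "R m2" for m2
    proof (rule runs_loop_free)
      show "loop_free set_value" by (simp add: set_value_def)
      have "index (exp_val (addr_exp (scalar 22) (Num 0)) m2) = addr k u 0"
        by (rule addr_val) (use R in \<open>auto simp: R_def env_def\<close>)
      moreover have "index (real T - real k) = T - k" using assms(3) index_real[of "T - k"] by (simp add: of_nat_diff)
      ultimately have r: "result set_value m2 = m2(Work 6 := w(u := h (addr k u 0) + arriv_rev I k * m2 SC 25))"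
        using R assms(3) by (simp add: set_value_def R_def env_def)
      have "val_ok (w(u := h (addr k u 0) + arriv_rev I k * m2 SC 25)) q"
        if q: "\<forall>j. q j < H" "idx {1..n} q < Suc u" for q
      proof (cases "idx {1..n} q = u")
        case True
        then have "m2 SC 25 = topgain (J.gain (J.post k) q) n"
          using R q upto_gain_final[of k u] by (auto simp: R_def)
        then show ?thesis using True by (simp add: val_ok_def)
      next
        case False
        then show ?thesis using q u by (simp add: val_ok_def Inv_def w_def)
      qed
      moreover define w' where "w' = w(u := h (addr k u 0) + arriv_rev I k * m2 SC 25)"
      ultimately have "\<forall>q. (\<forall>j. q j < H) \<longrightarrow> idx {1..n} q < Suc u \<longrightarrow> val_ok w' q" by blast
      then show "after 22 u Inv (result set_value m2)"
        using R unfolding r w'_def[symmetric] by (simp add: R_def Inv_def)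
    qed
    show "runs (25 ::= Num 0;; for_loop 24 (scalar 8) gain_body;; set_value) (cost_v D)
       (after 22 u Inv) m'"
      unfolding cost_v_def
      by (rule runs_Seq[OF 1], simp only:, rule runs_Seq[OF 2], rule 3)
  next
    fix m' assume "Inv N m'"
    then show "env m' \<and> m' SC 21 = real k \<and> (\<forall>k'<Suc k. table_ok (m' (Work 5)) k') \<and> values_ok (m' (Work 6)) (Suc k)"
      using assms(4) values_ok_Suc[OF tab, of "m' (Work 6)"] idx_less[OF order_refl]
      by (auto simp: Inv_def h_def val_ok_def)
  qed (use m in \<open>simp add: Inv_def h_def\<close>)
qed

text \<open>What evaluations rely on. They write only counters, temporaries and \<open>Rec\<close>,
  so it survives from period to period.\<close>

definition ready :: "memory \<Rightarrow> bool" where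
  "ready m \<longleftrightarrow> env m \<and> (\<forall>k<T. table_ok (m (Work 5)) k)"

lemma k_loop:
  assumes m: "env m" and w: "m (Work 6) = (\<lambda>_. 0)"
  shows "runs (for_loop 21 (param 1) (part_com;; value_com)) (Suc T * (cost_k N D + 12)) ready m"
proof -
  define Inv where "Inv k m' \<longleftrightarrow> env m' \<and> (\<forall>k'<k. table_ok (m' (Work 5)) k') \<and> values_ok (m' (Work 6)) k" for k m'
  show ?thesis
  proof (rule runs_for[where Inv=Inv])
    show "m' Param 1 = real T" if "Inv i m'" for i m' using that by (simp add: Inv_def env_def)
  next
    fix k m' assume k: "k < T" "Inv k m'" "m' SC 21 = real k"
    show "runs (part_com;; value_com) (cost_k N D) (after 21 k Inv) m'"
      unfolding cost_k_def
    proof (rule runs_Seq[OF part_com_runs])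
      fix m1 assume "env m1 \<and> m1 SC 21 = real k \<and> (\<forall>k'<Suc k. table_ok (m1 (Work 5)) k')"
      then show "runs value_com (Suc N * (cost_v D + 12))
        (after 21 k Inv) m1"
        by (intro runs_weaken[OF value_com_runs[of m1 k] order_refl]) (use k in \<open>auto simp: Inv_def\<close>)
    qed (use k in \<open>auto simp: Inv_def\<close>)
  qed (use m w in \<open>simp_all add: Inv_def values_ok_def ready_def\<close>)
qed

end

definition service_cost :: "nat \<Rightarrow> nat" where
  "service_cost H = steps_of round_com + Suc H * (steps_of level_body + 12)"

definition prep_cost :: "nat \<Rightarrow> nat \<Rightarrow> nat \<Rightarrow> nat \<Rightarrow> nat \<Rightarrow> nat" where
  "prep_cost n T H N D = 1 + bexp_cost (Less (param 0) (Num 1)) +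
     (steps_of constants_com + (Suc n * (steps_of rmax_body + 12) +
       (Suc n * (service_cost H + 12) +
        Suc T * (cost_k N D + 12))))"

definition eval_cost :: "nat \<Rightarrow> nat" where
  "eval_cost n = 1 + bexp_cost (Less (param 0) (Num 1)) +
     (steps_of period_com + (steps_of (27 ::= Num 0) +
      (Suc n * (steps_of index_body + 12) + (steps_of (25 ::= Num 0) +
       (steps_of (Assign Rec (Num 0) (Num 0)) + Suc n * (steps_of advice_body + 12))))))"

lemma index_Suc [simp]: "index (1 + real i) = Suc i" "index (real i + 1) = Suc i"
  using index_real[of "Suc i"] by (simp_all add: add.commute)

section \<open>Preprocessing from the initial memory, and evaluation\<close>

context rounding
begin

abbreviation im :: memory where "im \<equiv> instance_memory I \<epsilon> [c_lam, c_p, c_xi]"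

lemma im_simps [simp]:
  "im Param 0 = real n" "im Param (Suc 0) = real T" "im Param 1 = real T" "im Param 2 = \<epsilon>" "im Param 3 = \<gamma>"
  "im Param 4 = c_lam" "im Param 5 = c_p" "im Param 6 = c_xi"
  "im (Work k) i = 0" "im Rec i = 0"
  by (simp_all add: instance_memory_def Let_def nth_Cons' del: One_nat_def)

definition base :: "memory \<Rightarrow> bool" where
  "base m \<longleftrightarrow> (\<forall>a\<in>{Param, Rev, Attract, Serv, Arriv}. m a = im a) \<and> m (Work 6) = (\<lambda>_. 0) \<and>
     m SC 0 = depth \<and> m SC 1 = grain \<and> m SC 2 = ln \<gamma> \<and> m SC 3 = cutoff \<and>
     m SC 4 = real (Suc K) \<and> m SC 5 = real H \<and> m SC 6 = real B \<and>
     m SC 7 = real N \<and> m SC 8 = real D"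

lemma baseD:
  assumes "base m"
  shows "m Param = im Param" "m Rev = im Rev" "m Attract = im Attract" "m Serv = im Serv" "m Arriv = im Arriv"
    "m SC 0 = depth" "m SC 1 = grain" "m SC (Suc 0) = grain" "m SC 2 = ln \<gamma>" "m SC 3 = cutoff"
    "m SC 4 = real (Suc K)" "m SC 5 = real H" "m SC 6 = real B"
    "m SC 7 = real N" "m SC 8 = real D"
  using assms by (auto simp: base_def)

lemma base_upd [simp]:
  "9 \<le> i \<Longrightarrow> base (set_scalar i x m) \<longleftrightarrow> base m"
  "(\<And>i. i < (9::nat) \<Longrightarrow> s i = m SC i) \<Longrightarrow> base (m(Work 0 := s)) \<longleftrightarrow> base m"
  "a \<in> {Work 1, Work 2, Work 3, Work 4} \<Longrightarrow> base (m(a := h)) \<longleftrightarrow> base m"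
  by (auto simp: base_def)

lemma exp_exp_val:
  assumes "m Param 3 = \<gamma>" "m SC 2 = ln \<gamma>"
  shows "exp_val (exp_exp e) m = exp (exp_val e m)"
  using assms gamma by (simp add: exp_exp_def powr_def)

lemma K_real: "of_int \<lfloor>depth * grain\<rfloor> + 2 = real (Suc K)"
  using depth_pos grain_pos by (simp add: K_def)

lemma H_real: "of_int \<lfloor>cutoff\<rfloor> + 2 = real H"
  using cutoff_pos by (simp add: H_def)

lemma constants_result: "base (result constants_com im)" "result constants_com im SC 9 = 0"
proof -
  have D: "real (Suc K) * real (Suc K) * real (Suc K) * real H = real D"
    by (simp only: D_def of_nat_mult of_nat_power power3_eq_cube)
  have "result constants_com im = im(Work 0 := (im SC)(0 := depth, 1 := grain, 2 := ln \<gamma>, 3 := cutoff,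
     4 := real (Suc K), 5 := real H, 6 := real B, 8 := real D, 7 := real N, 9 := 0))"
  proof -
    have d: "(c_lam + c_p + c_xi + 1) * ln (5 * real T / \<epsilon>) = depth" by (simp add: depth_def)
    have g: "(5 + 10 * depth) / \<epsilon> = grain" by (simp add: grain_def)
    have c: "2 * depth / ln \<gamma> = cutoff" by (simp add: cutoff_def)
    have b: "real n + 1 = real B" by (simp add: B_def)
    have nn: "exp_val (pw (Get SC (Num 8))) m = real N" if "m SC 6 = real B" "m SC 8 = real D" for m
      unfolding N_def by (rule pw_val) (use that in simp_all)
    show ?thesis
      unfolding constants_com_def
      by (simp add: d g c b nn K_real H_real D del: of_nat_Suc of_nat_mult mult_Suc)
  qed
  then show "base (result constants_com im)" "result constants_com im SC 9 = 0"
    by (simp_all add: base_def fun_eq_iff)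
qed

lemma im_services:
  assumes "j \<in> {1..n}"
  shows "im Rev j = revenue I j" "im Attract j = attract I j" "im Serv j = serv I j"
  using assms by (simp_all add: instance_memory_def)

lemma rmax_loop:
  assumes m: "base m" "m SC 9 = 0"
  shows "runs (for_loop 10 (param 0) rmax_body) (Suc n * (steps_of rmax_body + 12))
     (\<lambda>m'. base m' \<and> m' SC 9 = rmax) m"
proof -
  define Inv where "Inv i m' \<longleftrightarrow> base m' \<and> m' SC 9 = topgain (revenue I) i" for i m'
  show ?thesis
  proof (rule runs_for[where Inv=Inv])
    show "m' Param 0 = real n" if "Inv i m'" for i m' using that by (simp add: Inv_def baseD)
  next
    fix i m' assume i: "i < n" "Inv i m'" "m' SC 10 = real i"
    then have r: "im Rev (Suc i) = revenue I (Suc i)" by (intro im_services) auto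
    show "runs rmax_body (steps_of rmax_body) (after 10 i Inv) m'"
      by (rule runs_loop_free)
        (use i r in \<open>simp_all add: rmax_body_def Inv_def baseD topgain_Suc max_def del: of_nat_Suc\<close>)
  qed (use m in \<open>simp_all add: Inv_def topgain_def rmax_def\<close>)
qed

text \<open>The case \<open>z = 0\<close> arises when all revenues vanish, as the program then
  divides by \<open>rmax = 0\<close>.\<close>

lemma floor_steps:
  assumes "0 < z \<and> z \<le> 1 \<or> z = 0"
  shows "of_int \<lfloor>(0 - ln z) * grain\<rfloor> = real (steps z)"
proof -
  have "0 \<le> - ln z * grain"
  proof (cases "z = 0")
    case False
    then show ?thesis using assms grain_pos by (intro mult_nonneg_nonneg) auto
  qed simp
  then show ?thesis by (simp add: steps_def)
qed

lemma round_result: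
  assumes m: "base m" "m SC 9 = rmax" "m SC 10 = real i" and i: "i < n"
  defines "m' \<equiv> result round_com m"
  shows "base m' \<and> m' SC 9 = rmax \<and> m' SC 10 = real i \<and> m' SC 13 = r' (Suc i) \<and> m' SC 16 = p' (Suc i) \<and>
    m' SC 18 = x' (Suc i) \<and> m' SC 19 = real (key (Suc i) * H) \<and>
    m' (Work 1) = (m (Work 1))(Suc i := real (key (Suc i) * H)) \<and>
    m' (Work 2) = m (Work 2) \<and> m' (Work 3) = m (Work 3) \<and> m' (Work 4) = m (Work 4)"
proof -
  let ?s = "Suc i"
  have s: "?s \<in> {1..n}" using i by auto
  note im = im_services[OF s] and P = params[OF s]
  define kr where "kr = (if minor ?s then K else steps (revenue I ?s / rmax))"
  have z: "0 < revenue I ?s / rmax \<and> revenue I ?s / rmax \<le> 1 \<or> revenue I ?s / rmax = 0" if "\<not> minor ?s"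
    using not_minor[OF s that] rmax_nonneg by (cases "0 < rmax") auto
  define m1 where "m1 = m(Work 0 := (m SC)(11 := real ?s, 12 := revenue I ?s))"
  have m1: "base m1" "m1 SC 9 = rmax" "m1 SC 10 = real i" "m1 SC 11 = real ?s" "m1 SC 12 = revenue I ?s"
    using m by (simp_all add: m1_def)
  have keep: "m1 (Work k) = m (Work k)" if "k \<noteq> 0" for k using that by (simp add: m1_def)
  have ee: "exp_val (exp_exp e) m' = exp (exp_val e m')" if "m' Param = im Param" "m' SC 2 = ln \<gamma>" for e m'
    using that by (intro exp_exp_val) auto
  define m2 where "m2 = result revenue_com m1"
  have m2: "base m2 \<and> m2 SC 9 = rmax \<and> m2 SC 10 = real i \<and> m2 SC 11 = real ?s \<and>
     m2 SC 13 = r' ?s \<and> m2 SC 14 = real kr \<and> (\<forall>k. k \<noteq> 0 \<longrightarrow> m2 (Work k) = m (Work k))"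
  proof (cases "minor ?s")
    case True
    then have "m2 = m1(Work 0 := (m1 SC)(13 := 0, 14 := real K))"
      using m1 by (simp add: m2_def revenue_com_def ee baseD minor_def)
    then show ?thesis using m1 keep True by (simp add: r'_def kr_def)
  next
    case False
    have "m2 = m1(Work 0 := (m1 SC)(14 := real (steps (revenue I ?s / rmax)),
       13 := rmax * rnd (revenue I ?s / rmax)))"
    proof -
      have f: "of_int \<lfloor>- (ln (revenue I ?s / rmax) * grain)\<rfloor> = real (steps (revenue I ?s / rmax))"
        using floor_steps[OF z[OF False]] by simp
      show ?thesis
        using m1 False by (simp add: m2_def revenue_com_def ee baseD minor_def f rnd_def add.commute)
    qed
    then show ?thesis using m1 keep False by (simp add: r'_def kr_def)
  qed
  define m3 where "m3 = m2(Work 0 := (m2 SC)(15 := real (steps (attract I ?s)), 16 := p' ?s,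
     17 := real (steps (serv I ?s)), 18 := x' ?s, 19 := real (key ?s * H)),
     Work 1 := (m2 (Work 1))(?s := real (key ?s * H)))"
  have f: "of_int \<lfloor>- (ln (attract I ?s) * grain)\<rfloor> = real (steps (attract I ?s))"
    "of_int \<lfloor>- (ln (serv I ?s) * grain)\<rfloor> = real (steps (serv I ?s))"
    using floor_steps[of "attract I ?s"] floor_steps[of "serv I ?s"] P by auto
  have key: "(real kr + real (Suc K) * (real (steps (attract I ?s)) + real (Suc K) * real (steps (serv I ?s)))) * real H
      = real (key ?s * H)"
    unfolding key_def kr_def[symmetric] by (simp only: of_nat_mult of_nat_add)
  have "m' = m3"
  proof -
    have "result (11 ::= scalar 10 .+ Num 1;; 12 ::= Get Rev (scalar 11)) m = m1"
      using m im(1) by (simp add: m1_def baseD add.commute)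
    then have "m' = result key_com m2"
      unfolding m'_def round_com_def m2_def by (simp only: result.simps)
    also have "\<dots> = m3"
      using m2 im f key by (simp add: key_com_def m3_def ee baseD p'_def x'_def rnd_def add.commute del: of_nat_Suc of_nat_mult mult_Suc)
    finally show ?thesis .
  qed
  then show ?thesis using m2 by (simp add: m3_def)
qed

definition cells_upto :: "(nat \<Rightarrow> real) \<Rightarrow> (nat \<Rightarrow> real) \<Rightarrow> (nat \<Rightarrow> real) \<Rightarrow> nat \<Rightarrow> nat \<Rightarrow> bool" where
  "cells_upto cr cx ca i l \<longleftrightarrow> (\<forall>j\<in>{1..n}. \<forall>m<H. j \<le> i \<or> j = Suc i \<and> m < l \<longrightarrow> cr (cell j m) = r' j \<and>
     cx (cell j m) = (if m = 0 then 0 else x' j) \<and> ca (cell j m) = a' j m)"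

text \<open>Services with equal keys write to the same cells. By \<open>key_inj\<close> they write
  the same contents, so later services do not spoil the cells of earlier ones.\<close>

lemma cells_upto_step:
  assumes c: "cells_upto cr cx ca i l" and i: "i < n" and l: "l < H"
  shows "cells_upto (cr(cell (Suc i) l := r' (Suc i))) (cx(cell (Suc i) l := if l = 0 then 0 else x' (Suc i)))
     (ca(cell (Suc i) l := a' (Suc i) l)) i (Suc l)"
  unfolding cells_upto_def
proof (intro ballI allI impI)
  fix j m assume j: "j \<in> {1..n}" "m < H" "j \<le> i \<or> j = Suc i \<and> m < Suc l"
  show "(cr(cell (Suc i) l := r' (Suc i))) (cell j m) = r' j \<and>
     (cx(cell (Suc i) l := if l = 0 then 0 else x' (Suc i))) (cell j m) = (if m = 0 then 0 else x' j) \<and>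
     (ca(cell (Suc i) l := a' (Suc i) l)) (cell j m) = a' j m"
  proof (cases "cell j m = cell (Suc i) l")
    case True
    have s: "Suc i \<in> {1..n}" using i by auto
    from cell_eq[OF True j(2) l] have "key j = key (Suc i)" "m = l" by auto
    then show ?thesis using key_inj[OF j(1) s] True by (simp add: a'_def)
  next
    case False
    then have "j \<le> i \<or> j = Suc i \<and> m < l" using j by (auto simp: less_Suc_eq)
    then show ?thesis using c[unfolded cells_upto_def, rule_format, OF j(1,2)] False by simp
  qed
qed

lemma level_loop:
  assumes m: "base m" "m SC 9 = rmax" "m SC 10 = real i"
    "m SC 13 = r' (Suc i)" "m SC 16 = p' (Suc i)" "m SC 18 = x' (Suc i)"
    "m SC 19 = real (key (Suc i) * H)" and i: "i < n"
    and c: "cells_upto (m (Work 2)) (m (Work 3)) (m (Work 4)) i 0"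
  shows "runs (for_loop 20 (scalar 5) level_body) (Suc H * (steps_of level_body + 12))
    (\<lambda>m'. base m' \<and> m' SC 9 = rmax \<and> m' SC 10 = real i \<and> m' (Work 1) = m (Work 1) \<and>
       cells_upto (m' (Work 2)) (m' (Work 3)) (m' (Work 4)) i H) m"
proof -
  define w1 where "w1 = m (Work 1)"
  define Inv where "Inv l m' \<longleftrightarrow> base m' \<and> m' SC 9 = rmax \<and> m' SC 10 = real i \<and>
    m' SC 13 = r' (Suc i) \<and> m' SC 16 = p' (Suc i) \<and> m' SC 18 = x' (Suc i) \<and>
    m' SC 19 = real (key (Suc i) * H) \<and> m' (Work 1) = w1 \<and>
    cells_upto (m' (Work 2)) (m' (Work 3)) (m' (Work 4)) i l" for l m'
  show ?thesis
  proof (rule runs_for[where Inv=Inv])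
    show "m' SC 5 = real H" if "Inv i m'" for i m' using that by (simp add: Inv_def baseD)
  next
    fix l m' assume l: "l < H" "Inv l m'" "m' SC 20 = real l"
    let ?c = "cell (Suc i) l"
    have ix: "index (real (key (Suc i)) * real H + real l) = ?c"
      using index_real[of ?c] by (simp add: cell_def)
    define h2 h3 h4 where "h2 = (m' (Work 2))(?c := r' (Suc i))"
      and "h3 = (m' (Work 3))(?c := if l = 0 then 0 else x' (Suc i))" and "h4 = (m' (Work 4))(?c := a' (Suc i) l)"
    have up: "cells_upto h2 h3 h4 i (Suc l)"
      unfolding h2_def h3_def h4_def using l i by (intro cells_upto_step) (auto simp: Inv_def)
    have ee: "exp_val (exp_exp e) m'' = exp (exp_val e m'')" if "m'' Param = im Param" "m'' SC 2 = ln \<gamma>" for e m''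
      using that by (intro exp_exp_val) auto
    define y where "y = real l"
    have h: "h3 = (m' (Work 3))(?c := if y < 1 then 0 else x' (Suc i))"
      "h4 = (m' (Work 4))(?c := if y < cutoff * x' (Suc i) then p' (Suc i) * exp (- (y / x' (Suc i)) * ln \<gamma>) else 0)"
      by (simp_all add: h3_def h4_def a'_def y_def)
    note lv = l[unfolded Inv_def, folded y_def] ix[folded y_def]
    have "result level_body m' = m'(Work 2 := h2, Work 3 := h3, Work 4 := h4)"
      unfolding h h2_def using lv
      by (cases "y < 1"; cases "y < cutoff * x' (Suc i)") (simp_all add: level_body_def baseD ee)
    then show "runs level_body (steps_of level_body) (after 20 l Inv) m'"
      using l up by (intro runs_loop_free) (simp_all add: level_body_def[THEN arg_cong[where f=loop_free]] Inv_def)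
  qed (use m c in \<open>simp_all add: Inv_def w1_def\<close>)
qed

lemma round_loop:
  assumes m: "base m" "m SC 9 = rmax"
  shows "runs (for_loop 10 (param 0) service_com)
     (Suc n * (service_cost H + 12))
     (\<lambda>m'. env m' \<and> m' (Work 6) = (\<lambda>_. 0)) m"
proof -
  define Inv where "Inv i m' \<longleftrightarrow> base m' \<and> m' SC 9 = rmax \<and>
    (\<forall>j\<in>{1..i}. m' (Work 1) j = real (key j * H)) \<and>
    cells_upto (m' (Work 2)) (m' (Work 3)) (m' (Work 4)) i 0" for i m'
  show ?thesis
  proof (rule runs_for[where Inv=Inv])
    show "m' Param 0 = real n" if "Inv i m'" for i m' using that by (simp add: Inv_def baseD)
  next
    fix i m' assume i: "i < n" "Inv i m'" "m' SC 10 = real i"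
    define m1 where "m1 = result round_com m'"
    have b: "base m'" "m' SC 9 = rmax" using i by (auto simp: Inv_def)
    note m1 = round_result[OF b i(3,1), folded m1_def]
    have 1: "runs round_com (steps_of round_com) (\<lambda>m''. m'' = m1) m'"
      by (rule runs_loop_free) (simp_all add: m1_def round_com_def revenue_com_def key_com_def)
    have c: "cells_upto cr cx ca (Suc i) 0" if "cells_upto cr cx ca i H" for cr cx ca
      using that unfolding cells_upto_def by (metis le_SucE not_less_zero)
    have k: "\<forall>j\<in>{1..Suc i}. m1 (Work 1) j = real (key j * H)"
      using i m1 by (auto simp: Inv_def le_Suc_eq)
    show "runs service_com (service_cost H)
       (after 10 i Inv) m'"
      unfolding service_com_def service_cost_def
    proof (rule runs_Seq[OF 1])
      fix m2 assume "m2 = m1"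
      then show "runs (for_loop 20 (scalar 5) level_body) (Suc H * (steps_of level_body + 12))
         (after 10 i Inv) m2"
        by (simp only:, intro runs_weaken[OF level_loop[of m1 i] order_refl])
           (use m1 i k c in \<open>auto simp: Inv_def\<close>)
    qed
  next
    fix m' assume inv: "Inv n m'"
    then have b: "base m'" by (simp add: Inv_def)
    have "im Arriv (T - k) = arriv_rev I k" if "k < T" for k
      using that by (auto simp: instance_memory_def arriv_rev_def)
    then show "env m' \<and> m' (Work 6) = (\<lambda>_. 0)"
      using inv baseD[OF b] b by (auto simp: env_def Inv_def cells_ok_def cells_upto_def base_def)
  qed (use m in \<open>simp add: Inv_def cells_upto_def\<close>)
qed

lemma prep_runs:
  assumes "0 < n"
  shows "runs prep_com (prep_cost n T H N D) ready im"
proof -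
  have n: "\<not> bexp_val (Less (param 0) (Num 1)) im" using assms by simp
  have 1: "runs constants_com (steps_of constants_com) (\<lambda>m. base m \<and> m SC 9 = 0) im"
    by (rule runs_loop_free) (use constants_result in \<open>auto simp: constants_com_def[THEN arg_cong[where f=loop_free]]\<close>)
  show ?thesis
    unfolding prep_com_def prep_cost_def
    by (rule runs_If_False[OF n], rule runs_Seq[OF 1], rule runs_Seq[OF rmax_loop], simp, simp,
        rule runs_Seq[OF round_loop], simp, simp, rule k_loop, auto)
qed

lemma ready_observe [simp]: "ready (observe I u h q b m) \<longleftrightarrow> ready m"
  by (simp add: ready_def env_def observe_def)

lemma eval_runs:
  assumes n: "0 < n" and m: "ready m" and h: "length h < T" and q: "\<And>j. q j < H"
  shows "runs eval_com (eval_cost n)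
    (\<lambda>m'. ready m' \<and> m' Rec 0 = encode (J.advice (T - Suc (length h)) q)) (observe I u h q b m)"
proof -
  define k where "k = T - Suc (length h)"
  have k: "k < T" using h by (simp add: k_def)
  define m0 where "m0 = observe I u h q b m"
  define good where "good m' \<longleftrightarrow> ready m' \<and> m' SC 21 = real k \<and> m' Queue = m0 Queue" for m'
  have Q: "m0 Queue j = real (q j)" if "j \<in> {1..n}" for j using that by (simp add: m0_def observe_def)
  have r0: "ready m0" using m by (simp add: m0_def)
  have good_upd: "i \<notin> {6, 7, 8, 21} \<Longrightarrow> good (set_scalar i x m') \<longleftrightarrow> good m'"
    "good (m'(Rec := f)) \<longleftrightarrow> good m'" for i x m' f
    by (simp_all add: good_def ready_def)
  have cellv: "exp_val cell_exp m' = real (cell (Suc i) (q (Suc i)))"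
    if "good m'" "m' SC 22 = real i" "i < n" for m' i
    using that Q[of "Suc i"] by (simp add: cell_exp_def good_def ready_def env_def cell_def)
  define g where "g = J.gain (J.post k) q"
  have 1: "runs period_com (steps_of period_com) good m0"
  proof (rule runs_loop_free)
    have "m0 Obs 0 = real (Suc (length h))" "m0 Param 1 = real T" using r0 by (auto simp: m0_def observe_def ready_def env_def)
    then show "good (result period_com m0)"
      using r0 h by (simp add: period_com_def good_def ready_def k_def of_nat_diff)
  qed (simp add: period_com_def)
  have 2: "runs (27 ::= Num 0) (steps_of (27 ::= Num 0)) (\<lambda>m'. good m' \<and> m' SC 27 = 0) m'" if "good m'" for m'
    by (rule runs_loop_free) (use that in \<open>simp_all add: good_def ready_def\<close>)
  define Inv1 where "Inv1 i m' \<longleftrightarrow> good m' \<and> m' SC 27 = real (idx {1..i} q)" for i m'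
  have 3: "runs (for_loop 22 (param 0) index_body) (Suc n * (steps_of index_body + 12)) (Inv1 n) m'"
    if m': "good m' \<and> m' SC 27 = 0" for m'
  proof (rule runs_for[where Inv=Inv1])
    show "m'' Param 0 = real n" if "Inv1 i m''" for i m'' using that by (simp add: Inv1_def good_def ready_def env_def)
  next
    fix i m'' assume i: "i < n" "Inv1 i m''" "m'' SC 22 = real i"
    have g: "good m''" using i by (simp add: Inv1_def)
    have "exp_val (pw cell_exp) m'' = real (B ^ cell (Suc i) (q (Suc i)))"
      by (rule pw_val[OF _ cellv[OF g i(3,1)]]) (use g in \<open>simp add: good_def ready_def env_def\<close>)
    moreover have "idx {1..Suc i} q = idx {1..i} q + B ^ cell (Suc i) (q (Suc i))"
      by (simp add: idx_def)
    ultimately have v: "exp_val (scalar 27 .+ pw cell_exp) m'' = real (idx {1..Suc i} q)"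
      using i by (simp add: Inv1_def)
    have r: "result index_body m'' = set_scalar 27 (real (idx {1..Suc i} q)) m''"
      unfolding index_body_def result.simps v by (simp add: set_scalar_def)
    show "runs index_body (steps_of index_body) (after 22 i Inv1) m''"
    proof (rule runs_loop_free)
      show "after 22 i Inv1 (result index_body m'')"
        unfolding r using g i(3) by (simp add: Inv1_def good_upd(1))
    qed (simp add: index_body_def)
  qed (use m' in \<open>simp_all add: Inv1_def good_upd(1) idx_def\<close>)
  have 4: "runs (25 ::= Num 0) (steps_of (25 ::= Num 0)) (\<lambda>m'. Inv1 n m' \<and> m' SC 25 = 0) m'" if "Inv1 n m'" for m'
    by (rule runs_loop_free) (use that in \<open>simp_all add: Inv1_def good_def ready_def\<close>)
  define Inv2 where "Inv2 i m' \<longleftrightarrow> Inv1 n m' \<and> m' SC 25 = topgain g i \<and> m' Rec 0 = real (pick g i)" for i m'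
  have 5: "runs (Assign Rec (Num 0) (Num 0)) (steps_of (Assign Rec (Num 0) (Num 0))) (Inv2 0) m'"
    if "Inv1 n m' \<and> m' SC 25 = 0" for m'
    by (rule runs_loop_free) (use that in \<open>simp_all add: Inv2_def Inv1_def good_def ready_def topgain_def\<close>)
  have 6: "runs (for_loop 22 (param 0) advice_body) (Suc n * (steps_of advice_body + 12)) (Inv2 n) m'"
    if m': "Inv2 0 m'" for m'
  proof (rule runs_for[where Inv=Inv2])
    show "m'' Param 0 = real n" if "Inv2 i m''" for i m'' using that by (simp add: Inv2_def Inv1_def good_def ready_def env_def)
  next
    fix i m'' assume i: "i < n" "Inv2 i m''" "m'' SC 22 = real i"
    let ?s = "Suc i"
    have s: "?s \<in> {1..n}" using i by auto
    have g: "good m''" and s27: "m'' SC 27 = real (idx {1..n} q)" using i by (auto simp: Inv2_def Inv1_def)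
    define m3 where "m3 = set_scalar 24 (real (cell ?s (q ?s))) m''"
    have r3: "result (24 ::= cell_exp) m'' = m3"
      unfolding result.simps cellv[OF g i(3,1)] by (simp add: m3_def set_scalar_def)
    have m3: "ready m3" "m3 SC 21 = real k" "m3 SC 24 = real (cell ?s (q ?s))" "m3 SC 27 = real (idx {1..n} q)"
      using g s27 by (auto simp: m3_def good_def ready_def)
    have "exp_val (gain_exp (scalar 27)) m3 = cell_gain (m3 (Work 5)) (m3 (Work 4)) k (idx {1..n} q) (cell ?s (q ?s))"
      by (rule gain_val) (use m3 idx_remove[OF order_refl s, of q] in \<open>auto simp: ready_def env_def\<close>)
    also have "\<dots> = g ?s"
      unfolding g_def by (rule cell_gain_eq[OF _ _ q s]) (use m3(1) k in \<open>auto simp: ready_def env_def\<close>)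
    finally have v: "exp_val (gain_exp (scalar 27)) m3 = g ?s" .
    have r: "result advice_body m'' = (let m4 = set_scalar 26 (g ?s) m3 in
       if topgain g i < g ?s then (set_scalar 25 (g ?s) m4)(Rec := (m4 Rec)(0 := real ?s)) else m4)"
    proof -
      have "m3 SC 25 = topgain g i" "m3 SC 22 = real i" using i by (auto simp: m3_def Inv2_def)
      moreover have "result (26 ::= gain_exp (scalar 27)) m3 = set_scalar 26 (g ?s) m3"
        unfolding result.simps v by (simp add: set_scalar_def)
      ultimately show ?thesis
        unfolding advice_body_def result.simps(3)
        by (simp only: r3) (simp add: Let_def set_scalar_def add.commute)
    qed
    show "runs advice_body (steps_of advice_body) (after 22 i Inv2) m''"
    proof (rule runs_loop_free)
      show "loop_free advice_body" by (simp add: advice_body_def)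
      show "after 22 i Inv2 (result advice_body m'')"
        unfolding r using i g s27
        by (cases "topgain g i < g ?s")
           (simp_all add: Let_def Inv2_def Inv1_def good_upd(1,2) m3_def pick_topgain topgain_Suc max_def)
    qed
  qed (use m' in \<open>simp_all add: Inv2_def Inv1_def good_upd(1)\<close>)
  have "\<not> bexp_val (Less (param 0) (Num 1)) m0" using n r0 by (simp add: ready_def env_def)
  then have "runs eval_com (eval_cost n) (Inv2 n) m0"
    unfolding eval_com_def eval_cost_def
    by (rule runs_If_False) (rule runs_Seq[OF 1], rule runs_Seq[OF 2], assumption, rule runs_Seq[OF 3], assumption,
        rule runs_Seq[OF 4], assumption, rule runs_Seq[OF 5], assumption, rule 6)
  then show ?thesis
    unfolding m0_def
  proof (rule runs_weaken)
    fix m' assume "Inv2 n m'"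
    then show "ready m' \<and> m' Rec 0 = encode (J.advice (T - Suc (length h)) q)"
      by (auto simp: Inv2_def Inv1_def good_def J.advice_def encode_def Let_def g_def k_def)
  qed simp
qed

end

section \<open>Running time and conclusion\<close>

text \<open>\<open>P\<close> is what each evaluation hands on to the next one through the memory;
  the bound \<open>M\<close> restricts attention to queues that the tables cover.\<close>

lemma follows_exists:
  assumes eval: "\<And>h q b m. P m \<Longrightarrow> length h < L \<Longrightarrow> (\<And>j. q j < (M::nat)) \<Longrightarrow>
      runs c t (\<lambda>m'. P m' \<and> m' Rec 0 = encode (\<rho> h q)) (observe I u h q b m)"
    and m: "P m"
  shows "length h \<le> L \<Longrightarrow> (\<forall>(q, _, _)\<in>set h. \<forall>j. q j < M) \<Longrightarrow>
     \<exists>k m'. follows I c \<rho> u m h k m' \<and> k \<le> length h * t \<and> P m'"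
proof (induction h rule: rev_induct)
  case Nil
  show ?case using m by (intro exI[of _ 0] exI[of _ m]) (auto intro: follows.Nil)
next
  case (snoc z h)
  obtain q b y where z: "z = (q, b, y)" by (cases z)
  from snoc obtain k m1 where 1: "follows I c \<rho> u m h k m1" "k \<le> length h * t" "P m1" by auto
  have "runs c t (\<lambda>m'. P m' \<and> m' Rec 0 = encode (\<rho> h q)) (observe I u h q b m1)"
    by (rule eval) (use 1 snoc.prems z in auto)
  then obtain k' m2 where 2: "exec c (observe I u h q b m1) k' m2" "k' \<le> t" "P m2" "m2 Rec 0 = encode (\<rho> h q)"
    unfolding runs_def by blast
  have "follows I c \<rho> u m (h @ [(q, b, y)]) (k + k') m2"
    by (rule follows.snoc[OF 1(1) 2(1)]) (use 2 in auto)
  then show ?case using 1 2 z by (intro exI[of _ "k + k'"] exI[of _ m2]) auto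
qed

text \<open>A coarse calculus for running times: every loop bound that depends on these sizes is at
  most \<open>N\<close>, so the degree in \<open>N\<close> counts nested loops, and one constant
  serves all instances.\<close>

definition cost_bounded :: "nat \<Rightarrow> (nat \<Rightarrow> nat \<Rightarrow> nat \<Rightarrow> nat \<Rightarrow> nat) \<Rightarrow> bool" where
  "cost_bounded i f \<longleftrightarrow> (\<exists>C. \<forall>n H D N. n < N \<longrightarrow> H < N \<longrightarrow> D < N \<longrightarrow> f n H D N \<le> C * N ^ i)"

lemma cost_boundedI:
  "(\<And>n H D N. n < N \<Longrightarrow> H < N \<Longrightarrow> D < N \<Longrightarrow> f n H D N \<le> C * N ^ i) \<Longrightarrow> cost_bounded i f"
  unfolding cost_bounded_def by (intro exI[of _ C] allI impI)

lemma cost_boundedE: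
  assumes "cost_bounded i f"
  obtains C where "\<And>n H D N. n < N \<Longrightarrow> H < N \<Longrightarrow> D < N \<Longrightarrow> f n H D N \<le> C * N ^ i"
proof -
  from assms obtain C where "\<forall>n H D N. n < N \<longrightarrow> H < N \<longrightarrow> D < N \<longrightarrow> f n H D N \<le> C * N ^ i"
    unfolding cost_bounded_def by (rule exE)
  then show ?thesis by (intro that[of C]) simp
qed

lemma cost_bounded_const: "cost_bounded i (\<lambda>n H D N. c)"
proof (rule cost_boundedI[where C=c])
  fix n N :: nat assume "n < N"
  then have "c * 1 \<le> c * N ^ i" by (intro mult_le_mono2 one_le_power) linarith
  then show "c \<le> c * N ^ i" by (simp only: mult_1_right)
qed

lemma cost_bounded_add:
  assumes "cost_bounded i f" "cost_bounded i g"
  shows "cost_bounded i (\<lambda>n H D N. f n H D N + g n H D N)"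
proof -
  obtain a where a: "\<And>n H D N. n < N \<Longrightarrow> H < N \<Longrightarrow> D < N \<Longrightarrow> f n H D N \<le> a * N ^ i"
    by (rule cost_boundedE[OF assms(1)]) (rule that)
  obtain b where b: "\<And>n H D N. n < N \<Longrightarrow> H < N \<Longrightarrow> D < N \<Longrightarrow> g n H D N \<le> b * N ^ i"
    by (rule cost_boundedE[OF assms(2)]) (rule that)
  show ?thesis
    by (rule cost_boundedI[where C="a + b"]) (simp only: distrib_right, intro add_mono a b)
qed

lemma cost_bounded_loop:
  assumes f: "cost_bounded i f" and M: "\<And>n H D N. n < N \<Longrightarrow> H < N \<Longrightarrow> D < N \<Longrightarrow> M n H D N \<le> N"
  shows "cost_bounded (Suc i) (\<lambda>n H D N. Suc (M n H D N) * f n H D N)"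
proof -
  obtain a where a: "\<And>n H D N. n < N \<Longrightarrow> H < N \<Longrightarrow> D < N \<Longrightarrow> f n H D N \<le> a * N ^ i"
    by (rule cost_boundedE[OF f]) (rule that)
  show ?thesis
  proof (rule cost_boundedI[where C="2 * a"])
    fix n H D N :: nat assume *: "n < N" "H < N" "D < N"
    have "Suc (M n H D N) \<le> 2 * N" using M[OF *] *(1) by linarith
    then have "Suc (M n H D N) * f n H D N \<le> (2 * N) * (a * N ^ i)" using a[OF *] by (rule mult_le_mono)
    then show "Suc (M n H D N) * f n H D N \<le> (2 * a) * N ^ Suc i" by (simp only: power_Suc mult_ac)
  qed
qed

lemma cost_bounded_Suc: "cost_bounded i f \<Longrightarrow> cost_bounded (Suc i) f"
  using cost_bounded_loop[of i f "\<lambda>_ _ _ _. 0"] by simp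

lemma total_cost_le:
  "\<exists>C. \<forall>n T H N D. n < N \<longrightarrow> H < N \<longrightarrow> D < N \<longrightarrow> 1 \<le> T \<longrightarrow>
     prep_cost n T H N D + T * eval_cost n \<le> C * (T * N ^ 3)"
proof -
  note rules = cost_bounded_add cost_bounded_const
  have loop: "cost_bounded (Suc i) (\<lambda>n H D N. Suc n * (f n H D N + 12))"
    "cost_bounded (Suc i) (\<lambda>n H D N. Suc H * (f n H D N + 12))"
    "cost_bounded (Suc i) (\<lambda>n H D N. Suc D * (f n H D N + 12))"
    "cost_bounded (Suc i) (\<lambda>n H D N. Suc N * (f n H D N + 12))" if "cost_bounded i f" for i f
    by (rule cost_bounded_loop[OF cost_bounded_add[OF that cost_bounded_const]]; simp)+
  note loop0 = loop[OF cost_bounded_const[of 0]]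
  have d: "cost_bounded (Suc 0) (\<lambda>n H D N. cost_d D)" and v: "cost_bounded (Suc 0) (\<lambda>n H D N. cost_v D)"
    and s: "cost_bounded (Suc 0) (\<lambda>n H D N. service_cost H)"
    unfolding cost_d_def cost_v_def service_cost_def by (intro rules loop0)+
  have k: "cost_bounded (Suc (Suc (Suc 0))) (\<lambda>n H D N. cost_k N D + 12)"
    unfolding cost_k_def
    by (rule cost_bounded_add[OF cost_bounded_add[OF loop(4)[OF loop(4)[OF d]] cost_bounded_Suc[OF loop(4)[OF v]]] cost_bounded_const])
  define g where "g n H = 1 + bexp_cost (Less (param 0) (Num 1)) + (steps_of constants_com +
      (Suc n * (steps_of rmax_body + 12) + Suc n * (service_cost H + 12)))" for n H
  have g: "cost_bounded (Suc (Suc (Suc 0))) (\<lambda>n H D N. g n H)"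
    unfolding g_def
    by (rule cost_bounded_Suc, intro cost_bounded_add[where i="Suc (Suc 0)"] cost_bounded_const,
        rule cost_bounded_Suc[OF loop0(1)], rule loop(1)[OF s])
  have e: "cost_bounded (Suc (Suc (Suc 0))) (\<lambda>n H D N. eval_cost n)"
    unfolding eval_cost_def by (rule cost_bounded_Suc, rule cost_bounded_Suc) (intro rules loop0)
  obtain a where a: "\<And>n H D N. n < N \<Longrightarrow> H < N \<Longrightarrow> D < N \<Longrightarrow> g n H \<le> a * N ^ Suc (Suc (Suc 0))"
    by (rule cost_boundedE[OF g]) (rule that)
  obtain b where b: "\<And>n H D N. n < N \<Longrightarrow> H < N \<Longrightarrow> D < N \<Longrightarrow> cost_k N D + 12 \<le> b * N ^ Suc (Suc (Suc 0))"
    by (rule cost_boundedE[OF k]) (rule that)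
  obtain c where c: "\<And>n H D N. n < N \<Longrightarrow> H < N \<Longrightarrow> D < N \<Longrightarrow> eval_cost n \<le> c * N ^ Suc (Suc (Suc 0))"
    by (rule cost_boundedE[OF e]) (rule that)
  note abc = a[folded numeral_3_eq_3] b[folded numeral_3_eq_3] c[folded numeral_3_eq_3]
  have "prep_cost n T H N D + T * eval_cost n \<le> (a + 2 * b + c) * (T * N ^ 3)"
    if *: "n < N" "H < N" "D < N" and T: "1 \<le> T" for n T H N D
  proof -
    have "prep_cost n T H N D + T * eval_cost n = g n H + Suc T * (cost_k N D + 12) + T * eval_cost n"
      by (simp only: prep_cost_def g_def add.assoc)
    also have "\<dots> \<le> T * (a * N ^ 3) + (2 * T) * (b * N ^ 3) + T * (c * N ^ 3)"
      using T mult_le_mono[OF T abc(1)[OF *]] by (intro add_mono mult_le_mono abc[OF *]) simp_all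
    also have "\<dots> = (a + 2 * b + c) * (T * N ^ 3)" by (simp add: algebra_simps)
    finally show ?thesis .
  qed
  then show ?thesis by blast
qed

context rounding
begin

definition advice_rule :: rule where
  "advice_rule h q = J.advice (T - Suc (length h)) q"

lemma advice_rule_policy: "(\<lambda>_. advice_rule) \<in> policies I"
proof -
  have "advice_rule h q \<in> insert None (Some ` {1..n})" for h q
    using J.advice_Some(1) by (cases "advice_rule h q") (simp_all add: advice_rule_def)
  then show ?thesis by (simp add: policies_def)
qed

lemma advice_rule_revenue: "(1 - \<epsilon>) * OPT I \<le> net_revenue I (\<lambda>_. advice_rule)"
proof -
  have "(1 - \<epsilon>) * OPT I \<le> (1 - \<epsilon>) * I.val T (\<lambda>_. 0)"
    using OPT_le_val[OF valid] eps by (intro mult_left_mono) auto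
  also have "\<dots> \<le> J.val T (\<lambda>_. 0)" by (rule rounded_value)
  also have "\<dots> \<le> rule_revenue I advice_rule"
    by (rule advice_revenue[OF valid J.dsr_dp_axioms r'_bounds(2) x'_bounds(2) a'_le advice_rule_def])
  also have "\<dots> = net_revenue I (\<lambda>_. advice_rule)" by (simp add: net_revenue_const[OF valid])
  finally show ?thesis .
qed

text \<open>Only histories of positive probability matter, and there all queues stay below
  \<open>H\<close>. \<open>P\<close> is left open because the case without services builds no
  tables.\<close>

lemma advice_rule_computed:
  assumes prep: "runs prep_com t P im"
    and eval: "\<And>u h q b m. P m \<Longrightarrow> length h < T \<Longrightarrow> (\<And>j. q j < H) \<Longrightarrow>
      runs eval_com t' (\<lambda>m'. P m' \<and> m' Rec 0 = encode (advice_rule h q)) (observe I u h q b m)"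
    and \<tau>: "real (t + T * t') \<le> \<tau>"
  shows "computes_within prep_com eval_com I \<epsilon> [c_lam, c_p, c_xi] (\<lambda>_. advice_rule) \<tau>"
proof -
  obtain k m where km: "exec prep_com im k m" "k \<le> t" "P m" using prep by (auto simp: runs_def)
  have "\<exists>k' m'. follows I eval_com advice_rule u m h k' m' \<and> real (k + k') \<le> \<tau>"
    if hq: "(h, q) \<in> set_pmf (trajectory I advice_rule T)" for u h q
  proof -
    have len: "length h = T" by (rule trajectory_length[OF hq])
    have \<rho>: "Suc (q j) < H" if "advice_rule h q = Some j" for h q j
      using that unfolding advice_rule_def by (rule advice_bounded)
    have "(\<forall>j. q j < H) \<and> (\<forall>(q', _, _)\<in>set h. \<forall>j. q' j < H)"
    proof (rule trajectory_bounded[where \<rho>=advice_rule, OF valid _ _ hq])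
      show "Suc (q j) < H" if "advice_rule h q = Some j" for h q j by (rule \<rho>[OF that])
    qed (use H_pos in simp)
    then have bounded: "\<forall>(q', _, _)\<in>set h. \<forall>j. q' j < H" by (rule conjunct2)
    have "\<exists>k m'. follows I eval_com advice_rule u m h k m' \<and> k \<le> length h * t' \<and> P m'"
    proof (rule follows_exists[where P=P and L=T and M=H, OF _ km(3) _ bounded])
      show "runs eval_com t' (\<lambda>m'. P m' \<and> m' Rec 0 = encode (advice_rule h q)) (observe I u h q b m)"
        if "P m" "length h < T" "\<And>j. q j < H" for h q b m by (rule eval[OF that])
    qed (simp add: len)
    then obtain k' m' where "follows I eval_com advice_rule u m h k' m'" "k' \<le> length h * t'"
      by (elim exE conjE)
    moreover from this have "k + k' \<le> t + T * t'" using km len by (intro add_mono) auto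
    then have "real (k + k') \<le> \<tau>" using \<tau> of_nat_mono[of "k + k'" "t + T * t'", where 'a=real] by linarith
    ultimately show ?thesis by blast
  qed
  then show ?thesis unfolding computes_within_def using km by blast
qed

text \<open>For \<open>0 < n\<close> the base \<open>B\<close> is at least \<open>2\<close>, so
  \<open>N\<close> exceeds its exponent \<open>D\<close>.\<close>

lemma cells_less_N: "0 < n \<Longrightarrow> D < N" "0 < n \<Longrightarrow> H < N" "0 < n \<Longrightarrow> n < N"
proof -
  assume n: "0 < n"
  have "D < 2 ^ D" by simp
  also have "\<dots> \<le> N" unfolding N_def using n by (intro power_mono) (auto simp: B_def)
  finally show 1: "D < N" .
  have D: "H \<le> D" by (simp add: D_def)
  then show "H < N" using 1 by simp
  have "B ^ 1 \<le> N" unfolding N_def using D H_pos B_pos by (intro power_increasing) auto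
  then show "n < N" by (simp add: B_def)
qed

end

theorem theorem1:
  fixes \<gamma> c_lam c_p c_xi :: real
  assumes "\<gamma> > 1" and "c_lam > 0" and "c_p > 0" and "c_xi > 0"
  shows "\<exists>prep evalc. \<exists>C>0. \<forall>I \<epsilon>.
    valid_dsr I \<and> sens I = \<gamma> \<and> 0 < \<epsilon> \<and> \<epsilon> < 1/10 \<and>
    Max (arriv I ` {1..horizon I}) \<ge> real (horizon I) powr (- c_lam) \<and>
    (\<forall>j\<in>{1..services I}. attract I j \<ge> real (horizon I) powr (- c_p) \<and>
                         serv I j \<ge> real (horizon I) powr (- c_xi)) \<longrightarrow>
    (\<exists>\<pi>\<in>policies I.
      computes_within prep evalc I \<epsilon> [c_lam, c_p, c_xi] \<pi>
        (C * (real (horizon I) *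
              real (services I + 1) powr (C * (ln (real (horizon I) / \<epsilon>) ^ 8 / \<epsilon> ^ 3)))) \<and>
      net_revenue I \<pi> \<ge> (1 - \<epsilon>) * OPT I)"
proof -
  obtain C1 where C1: "\<And>n T H N D. n < N \<Longrightarrow> H < N \<Longrightarrow> D < N \<Longrightarrow> 1 \<le> T \<Longrightarrow>
     prep_cost n T H N D + T * eval_cost n \<le> C1 * (T * N ^ 3)"
    using total_cost_le by blast
  define A where "A = 2 * (c_lam + c_p + c_xi + 1)"
  define C2 where "C2 = (17 * A\<^sup>2) ^ 3 * (2 * A / ln \<gamma> + 2)"
  define c0 where "c0 = 1 + bexp_cost (Less (param 0) (Num 1)) + 1"
  have A: "0 < A" using assms by (simp add: A_def)
  have C2: "0 < C2" unfolding C2_def using A assms by (intro mult_pos_pos add_pos_pos) auto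
  \<comment> \<open>\<open>C\<close> is both factor and exponent. \<open>C1\<close> bounds the
    factor; \<open>3 * C2\<close> the exponent, since \<open>N ^ 3\<close> has exponent
    \<open>3 * D\<close> and \<open>D\<close> is at most \<open>C2\<close> times the logarithmic
    expression; \<open>2 * c0\<close> covers the case without services.\<close>
  define C where "C = real C1 + 3 * C2 + 2 * real c0"
  have C: "0 < C" "real C1 \<le> C" "3 * C2 \<le> C" "2 * real c0 \<le> C" using C2 by (auto simp: C_def c0_def)
  show ?thesis
  proof (intro exI conjI allI impI)
    show "0 < C" by (rule C)
    fix I and \<epsilon> :: real
    assume "valid_dsr I \<and> sens I = \<gamma> \<and> 0 < \<epsilon> \<and> \<epsilon> < 1/10 \<and>
      Max (arriv I ` {1..horizon I}) \<ge> real (horizon I) powr (- c_lam) \<and>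
      (\<forall>j\<in>{1..services I}. attract I j \<ge> real (horizon I) powr (- c_p) \<and>
                         serv I j \<ge> real (horizon I) powr (- c_xi))"
    then interpret rounding I \<epsilon> c_lam c_p c_xi
      using assms by unfold_locales auto
    have \<gamma>: "sens I = \<gamma>" using \<open>valid_dsr I \<and> _\<close> by simp
    let ?X = "ln (real T / \<epsilon>) ^ 8 / \<epsilon> ^ 3"
    let ?\<tau> = "C * (real T * real (n + 1) powr (C * ?X))"
    have "computes_within prep_com eval_com I \<epsilon> [c_lam, c_p, c_xi] (\<lambda>_. advice_rule) ?\<tau>"
    \<comment> \<open>For \<open>n = 0\<close> one has \<open>N = 1\<close>, so the cost bounds,
      which assume \<open>n\<close>, \<open>H\<close> and \<open>D\<close> below \<open>N\<close>,
      do not apply; both programs halt at their initial test.\<close>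
    proof (cases "n = 0")
      case True
      define P where "P m \<longleftrightarrow> m Param 0 = 0 \<and> m Rec 0 = 0" for m :: memory
      have skip: "runs (If (Less (param 0) (Num 1)) Skip c) c0 Q m" if "m Param 0 = 0" "Q m" for c Q m
      proof -
        have "runs Skip 1 Q m" unfolding runs_def using exec.Skip that(2) by blast
        then show ?thesis unfolding c0_def using that(1) by (intro runs_If_True) simp_all
      qed
      have none: "encode (advice_rule h q) = 0" for h q
      proof -
        have "J.advice k q = None" for k unfolding J.advice_def using True by simp
        then show ?thesis by (simp only: advice_rule_def encode_def option.case)
      qed
      show ?thesis
      proof (rule advice_rule_computed)
        show "runs prep_com c0 P im" unfolding prep_com_def by (rule skip) (use True in \<open>auto simp: P_def\<close>)
        show "runs eval_com c0 (\<lambda>m'. P m' \<and> m' Rec 0 = encode (advice_rule h q)) (observe I u h q b m)"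
          if "P m" for u h q b m
          unfolding eval_com_def
          by (rule skip) (use that in \<open>simp_all add: P_def observe_def none\<close>)
        have "c0 \<le> T * c0" using T_pos by simp
        then have "c0 + T * c0 \<le> 2 * (T * c0)" by linarith
        then have "real (c0 + T * c0) \<le> real (2 * (T * c0))" by (simp only: of_nat_le_iff)
        also have "\<dots> = 2 * real c0 * real T" by simp
        also have "\<dots> \<le> C * real T" using C by (intro mult_right_mono) auto
        also have "\<dots> = ?\<tau>" using True by simp
        finally show "real (c0 + T * c0) \<le> ?\<tau>" .
      qed
    next
      case False
      then have n: "0 < n" by simp
      show ?thesis
      proof (rule advice_rule_computed)
        show "runs prep_com (prep_cost n T H N D) ready im" by (rule prep_runs[OF n])
        show "runs eval_com (eval_cost n) (\<lambda>m'. ready m' \<and> m' Rec 0 = encode (advice_rule h q)) (observe I u h q b m)"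
          if "ready m" "length h < T" "\<And>j. q j < H" for u h q b m
          unfolding advice_rule_def using eval_runs[OF n that] .
        have "real (prep_cost n T H N D + T * eval_cost n) \<le> real (C1 * (T * N ^ 3))"
          using C1[OF cells_less_N(3,2,1)[OF n] T_pos] by (simp only: of_nat_le_iff)
        also have "\<dots> = real C1 * (real T * real (N ^ 3))" by (simp only: of_nat_mult)
        also have "real (N ^ 3) = real (n + 1) powr (real D * 3)"
          by (simp add: N_def B_def powr_realpow[symmetric] powr_powr add.commute)
        also have "real C1 * (real T * real (n + 1) powr (real D * 3)) \<le> ?\<tau>"
        proof -
          have "real D \<le> C2 * ?X"
            using cells_le unfolding D_def C2_def A_def \<gamma> .
          moreover have "0 \<le> ?X" using eps by simp
          then have "3 * C2 * ?X \<le> C * ?X" using C by (intro mult_right_mono) auto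
          ultimately have "real D * 3 \<le> C * ?X" by linarith
          then have "real (n + 1) powr (real D * 3) \<le> real (n + 1) powr (C * ?X)"
            by (intro powr_mono) auto
          then have "real T * real (n + 1) powr (real D * 3) \<le> real T * real (n + 1) powr (C * ?X)"
            by (rule mult_left_mono) simp
          then show ?thesis using C(1,2) by (intro mult_mono[of "real C1" C]) auto
        qed
        finally show "real (prep_cost n T H N D + T * eval_cost n) \<le> ?\<tau>" .
      qed
    qed
    then show "\<exists>\<pi>\<in>policies I. computes_within prep_com eval_com I \<epsilon> [c_lam, c_p, c_xi] \<pi> ?\<tau> \<and>
        net_revenue I \<pi> \<ge> (1 - \<epsilon>) * OPT I"
      using advice_rule_policy advice_rule_revenue by blast
  qed
qed

end
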